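(* We have $\mathcal{A}\left(23,\frac25;\left(-\frac12,-\frac15\right)\right)=\mathcal{A}\left(23,\frac25;\left(-\frac15,\frac1{10}\right)\right)=11178$. Consequently, $C_{\sqrt6/6}$ is a maximal $\left(-\frac12,-\frac15\right)$-avoiding spherical $\frac25$-code and a maximal $\left(-\frac15,\frac1{10}\right)$-avoiding spherical $\frac25$-code.
   Context: A spherical code is a finite set $C\subset\mathbb{S}^{n-1}$; $I(C)=\{x\cdot y: x,y\in C,\ x\ne y\}$ and $s(C)=\max I(C)$; $C$ is called an $s$-code when $s(C)=s$. For $T\subset[-1,1)$, $C$ is $T$-avoiding if $I(C)\cap T=\varnothing$. $\mathcal{A}(n,s;T)$ is the maximum of $|C|$ over all $T$-avoiding spherical codes $C\subset\mathbb{S}^{n-1}$ with $s(C)\le s$; a $T$-avoiding $s$-code attaining this maximum is called maximal. The code $C_{\sqrt6/6}$: let $L\subset\mathbb{S}^{23}$ be the set of the $196560$ minimal vectors (length $2$) of the Leech lattice $\Lambda_{24}$ (the even unimodular lattice in $\mathbb{R}^{24}$ of minimum norm $4$) rescaled to unit length. Let $W\in\Lambda_{24}$ be a vector of length $\sqrt6$ and $\widetilde w=W/\sqrt6$. With $\alpha=\frac{\sqrt6}6$, $C_{\sqrt6/6}$ is the set of vectors $(y-\alpha\widetilde w)/\sqrt{1-\alpha^2}$ with $y\in L$, $y\cdot\widetilde w=\alpha$, regarded as a subset of the unit sphere $\mathbb{S}^{22}$ of $\widetilde w^\perp\cong\mathbb{R}^{23}$. It has $11178$ points and inner products $-\frac12,-\frac15,\frac1{10},\frac25$.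 *)

theory Defs
  imports "HOL-Analysis.Analysis"
begin

section \<open>Spherical codes\<close>

definition spherical_code :: "(real^'n) set \<Rightarrow> bool" where
  "spherical_code C \<longleftrightarrow> finite C \<and> C \<subseteq> sphere 0 1"

definition inner_products :: "(real^'n) set \<Rightarrow> real set" where
  "inner_products C = {x \<bullet> y | x y. x \<in> C \<and> y \<in> C \<and> x \<noteq> y}"

text \<open>Only meaningful for codes with at least two points; the predicates below treat the
  case \<open>inner_products C = {}\<close> explicitly.\<close>

definition max_inner_product :: "(real^'n) set \<Rightarrow> real" where
  "max_inner_product C = Max (inner_products C)"

definition s_code :: "real \<Rightarrow> (real^'n) set \<Rightarrow> bool" where
  "s_code s C \<longleftrightarrow>
     spherical_code C \<and> inner_products C \<noteq> {} \<and> max_inner_product C = s"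

text \<open>The condition \<open>s(C) \<le> s\<close>, with \<open>s(C) = -\<infinity>\<close> for codes with at most one point.\<close>

definition max_inner_product_le :: "(real^'n) set \<Rightarrow> real \<Rightarrow> bool" where
  "max_inner_product_le C s \<longleftrightarrow> inner_products C = {} \<or> max_inner_product C \<le> s"

definition avoiding :: "real set \<Rightarrow> (real^'n) set \<Rightarrow> bool" where
  "avoiding T C \<longleftrightarrow> inner_products C \<inter> T = {}"

text \<open>\<open>\<A>(n,s;T)\<close>, where \<open>n\<close> is the cardinality of the index type. For \<open>s < 1\<close> the
  cardinalities are bounded, so this is a maximum over a finite nonempty set.\<close>

definition max_code_size :: "'n::finite itself \<Rightarrow> real \<Rightarrow> real set \<Rightarrow> nat" where
  "max_code_size _ s T =
     Max (card ` {C :: (real^'n) set.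
            spherical_code C \<and> max_inner_product_le C s \<and> avoiding T C})"

definition maximal_avoiding_code :: "real \<Rightarrow> real set \<Rightarrow> (real^'n::finite) set \<Rightarrow> bool" where
  "maximal_avoiding_code s T C \<longleftrightarrow>
     s_code s C \<and> avoiding T C \<and> card C = max_code_size TYPE('n) s T"

section \<open>The Leech lattice\<close>

definition is_lattice :: "(real^'n) set \<Rightarrow> bool" where
  "is_lattice \<Lambda> \<longleftrightarrow>
     (\<exists>B. independent B \<and> span B = UNIV \<and>
          \<Lambda> = {\<Sum>b\<in>B. of_int (c b) *\<^sub>R b | c :: real^'n \<Rightarrow> int. True})"

definition dual_lattice :: "(real^'n) set \<Rightarrow> (real^'n) set" where
  "dual_lattice \<Lambda> = {y. \<forall>x\<in>\<Lambda>. x \<bullet> y \<in> \<int>}"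

definition unimodular :: "(real^'n) set \<Rightarrow> bool" where
  "unimodular \<Lambda> \<longleftrightarrow> dual_lattice \<Lambda> = \<Lambda>"

definition even_lattice :: "(real^'n) set \<Rightarrow> bool" where
  "even_lattice \<Lambda> \<longleftrightarrow> (\<forall>x\<in>\<Lambda>. \<exists>k::int. x \<bullet> x = 2 * of_int k)"

text \<open>In lattice terminology the norm of \<open>x\<close> is \<open>x \<bullet> x\<close>, the square of its length.\<close>

definition has_minimum_norm :: "(real^'n) set \<Rightarrow> real \<Rightarrow> bool" where
  "has_minimum_norm \<Lambda> m \<longleftrightarrow>
     (\<exists>x\<in>\<Lambda> - {0}. x \<bullet> x = m) \<and> (\<forall>x\<in>\<Lambda> - {0}. m \<le> x \<bullet> x)"

text \<open>These properties determine \<open>\<Lambda>\<close> up to an orthogonal transformation of \<open>\<real>\<^sup>2\<^sup>4\<close>.\<close>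

definition leech_lattice :: "(real^24) set \<Rightarrow> bool" where
  "leech_lattice \<Lambda> \<longleftrightarrow>
     is_lattice \<Lambda> \<and> even_lattice \<Lambda> \<and> unimodular \<Lambda> \<and> has_minimum_norm \<Lambda> 4"

definition unit_minimal_vectors :: "(real^24) set \<Rightarrow> (real^24) set" where
  "unit_minimal_vectors \<Lambda> = (\<lambda>x. x /\<^sub>R 2) ` {x \<in> \<Lambda>. norm x = 2}"

text \<open>The code \<open>C\<close> with parameter \<open>\<alpha> = \<surd>6/6\<close>, as a subset of the orthogonal complement of \<open>W\<close>
  in the ambient space; \<open>W\<close> is meant to be a lattice vector of length \<open>\<surd>6\<close>.\<close>

definition leech_slice_code :: "(real^24) set \<Rightarrow> real^24 \<Rightarrow> (real^24) set" where
  "leech_slice_code \<Lambda> W =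
     (let w = W /\<^sub>R sqrt 6; \<alpha> = sqrt 6 / 6
      in {(y - \<alpha> *\<^sub>R w) /\<^sub>R sqrt (1 - \<alpha>\<^sup>2) | y. y \<in> unit_minimal_vectors \<Lambda> \<and> y \<bullet> w = \<alpha>})"

text \<open>A linear isometric identification of \<open>W\<^sup>\<bottom>\<close> with \<open>\<real>\<^sup>2\<^sup>3\<close>, given by a linear map on the whole
  space of which only the restriction to \<open>W\<^sup>\<bottom>\<close> matters. For \<open>W \<noteq> 0\<close> the restriction is
  automatically onto by dimension.\<close>

definition hyperplane_isometry :: "real^24 \<Rightarrow> (real^24 \<Rightarrow> real^23) \<Rightarrow> bool" where
  "hyperplane_isometry W \<phi> \<longleftrightarrow> linear \<phi> \<and> (\<forall>x. x \<bullet> W = 0 \<longrightarrow> norm (\<phi> x) = norm x)"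

end

theory Submission
  imports Defs "HOL-Probability.Probability" "HOL-Complex_Analysis.Complex_Analysis"
begin

no_notation fps_nth (infixl "$" 75)

text \<open>The upper bounds are Delsarte's linear programming bound with the polynomials
  \<open>(t + 1/2)(t + 1/5)(t - 1/10)\<^sup>2(t - 2/5)\<close> and \<open>(t + 1/2)\<^sup>2(t + 1/5)(t - 1/10)(t - 2/5)\<close>, whose
  Gegenbauer coefficients are positive and which are nonpositive off the forbidden interval.

  The size of the slice is forced by the lattice axioms. For isotropic \<open>a \<in> \<complex>\<^sup>2\<^sup>4\<close> and \<open>d = 2, 4, 6\<close> the
  series \<open>\<Sum> (a \<bullet> x)\<^sup>d q\<^bsup>|x|\<^sup>2/2\<^esup>\<close> is, by Poisson summation, a cusp form of weight \<open>12 + d\<close>; it starts at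
  \<open>q\<^sup>2\<close> because there are no roots, so it vanishes and the minimal vectors form a design. The moments
  of orders \<open>2, 4, 6\<close> of \<open>x \<bullet> v\<close> for a minimal vector \<open>v\<close> then give \<open>196560\<close> minimal vectors, and those of
  \<open>x \<bullet> W\<close> give \<open>11178\<close> points in the slice. An explicit basis shows that the Leech lattice exists.\<close>

section \<open>Positive definite kernels and the linear programming bound\<close>

text \<open>The roots of the two polynomials are the four inner products of the slice, so the slice
  meets the linear programming bound with equality and the bound equals its size. Both values of
  \<open>max_code_size\<close> are asserted without any lattice, so the lower bound needs a concrete
  Leech lattice; the claims about an arbitrary one rest on counts derived from the axioms.

  Moments up to order 6 are what the counts require: an even polynomial of degree 6 in
  \<open>x \<bullet> v\<close> or \<open>x \<bullet> W\<close> can vanish at all but one pair of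
  opposite values. The resulting weight, at most 18, is also the most the vanishing argument can
  take, since it needs k < 6 pi.

  Poisson summation is proved for Gaussians only. Polynomial factors enter by translating the
  Gaussian by \<open>u\<close> and continuing analytically to isotropic \<open>u\<close>, where the
  term quadratic in \<open>u\<close> disappears; the moments are then Taylor coefficients.\<close>

definition pos_def_kernel :: "('a \<Rightarrow> 'a \<Rightarrow> real) \<Rightarrow> bool" where
  "pos_def_kernel \<kappa> \<longleftrightarrow>
     (\<forall>C w. finite C \<longrightarrow> 0 \<le> (\<Sum>x\<in>C. \<Sum>y\<in>C. w x * w y * \<kappa> x y))"

lemma pos_def_kernel_add:
  assumes "pos_def_kernel \<kappa>" "pos_def_kernel \<mu>"
  shows "pos_def_kernel (\<lambda>x y. \<kappa> x y + \<mu> x y)"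
  using assms unfolding pos_def_kernel_def
  by (simp add: distrib_left sum.distrib)

lemma pos_def_kernel_scale:
  assumes "pos_def_kernel \<kappa>" "0 \<le> c"
  shows "pos_def_kernel (\<lambda>x y. c * \<kappa> x y)"
proof -
  have "(\<Sum>x\<in>C. \<Sum>y\<in>C. w x * w y * (c * \<kappa> x y)) = c * (\<Sum>x\<in>C. \<Sum>y\<in>C. w x * w y * \<kappa> x y)"
    for C and w :: "'a \<Rightarrow> real"
    by (simp add: sum_distrib_left mult_ac)
  then show ?thesis
    using assms unfolding pos_def_kernel_def by simp
qed

text \<open>The rank-one factor is absorbed into the weights. This is why positivity is demanded for
  arbitrary weights, although the bound itself takes them equal to 1.\<close>

lemma pos_def_kernel_weight:
  assumes "pos_def_kernel \<kappa>"
  shows "pos_def_kernel (\<lambda>x y. q x * q y * \<kappa> x y)"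
  unfolding pos_def_kernel_def
proof (intro allI impI)
  fix C :: "'a set" and w :: "'a \<Rightarrow> real" assume "finite C"
  then have "0 \<le> (\<Sum>x\<in>C. \<Sum>y\<in>C. (w x * q x) * (w y * q y) * \<kappa> x y)"
    using assms[unfolded pos_def_kernel_def, rule_format, of C "\<lambda>x. w x * q x"] by simp
  then show "0 \<le> (\<Sum>x\<in>C. \<Sum>y\<in>C. w x * w y * (q x * q y * \<kappa> x y))"
    by (simp add: mult_ac)
qed

lemma pos_def_kernel_1: "pos_def_kernel (\<lambda>x y. 1)"
  by (simp add: pos_def_kernel_def flip: sum_distrib_left sum_distrib_right)

text \<open>The monic Gegenbauer polynomials for the sphere in \<open>\<real>\<^sup>n\<close>, homogenised: \<open>s\<close> stands for
  \<open>x \<bullet> y\<close> and \<open>q\<close> for \<open>|x|\<^sup>2 |y|\<^sup>2\<close>.\<close>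

definition gegenbauer :: "nat \<Rightarrow> real \<Rightarrow> real \<Rightarrow> real \<Rightarrow> real" where
  "gegenbauer k n s q =
     (if k = 0 then 1
      else if k = 1 then s
      else if k = 2 then s^2 - q / n
      else if k = 3 then s^3 - 3 * s * q / (n + 2)
      else if k = 4 then s^4 - 6 * s^2 * q / (n + 4) + 3 * q^2 / ((n + 2) * (n + 4))
      else s^5 - 10 * s^3 * q / (n + 6) + 15 * s * q^2 / ((n + 4) * (n + 6)))"

lemma gegenbauer_simps:
  "gegenbauer 0 n s q = 1"
  "gegenbauer 1 n s q = s"
  "gegenbauer (Suc 0) n s q = s"
  "gegenbauer 2 n s q = s^2 - q / n"
  "gegenbauer 3 n s q = s^3 - 3 * s * q / (n + 2)"
  "gegenbauer 4 n s q = s^4 - 6 * s^2 * q / (n + 4) + 3 * q^2 / ((n + 2) * (n + 4))"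
  "gegenbauer 5 n s q = s^5 - 10 * s^3 * q / (n + 6) + 15 * s * q^2 / ((n + 4) * (n + 6))"
  by (simp_all add: gegenbauer_def)

text \<open>Degree 2 of the addition formulas. Here \<open>a\<close>, \<open>b\<close> are one
  coordinate of the two vectors, \<open>s\<close> is the inner product of the remaining parts and
  \<open>X\<close>, \<open>Y\<close> are their squared norms. In degree \<open>k\<close>, the
  polynomial in dimension \<open>n + 1\<close> is a sum over \<open>j\<close> of positive multiples
  of the degree \<open>j\<close> polynomial in dimension \<open>n\<close>, weighted by one factor in
  \<open>a\<close>, \<open>X\<close> and the same factor in \<open>b\<close>, \<open>Y\<close>. That
  factor is a Gegenbauer polynomial of degree \<open>k - j\<close> in the shifted dimension
  \<open>n + 1 + 2 * j\<close>.\<close>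

lemma gegenbauer_addition2:
  fixes n a b s X Y :: real assumes "n > 0"
  shows "gegenbauer 2 (n + 1) (a * b + s) ((a^2 + X) * (b^2 + Y)) =
     gegenbauer 2 n s (X * Y) + 2 * (a * b * s) +
     (n + 1) / n * (gegenbauer 2 (n + 1) a (a^2 + X) * gegenbauer 2 (n + 1) b (b^2 + Y))"
proof -
  have *: "n \<noteq> 0" "n + 1 \<noteq> 0" using assms by auto
  show ?thesis unfolding gegenbauer_simps
    by (simp add: * divide_simps) algebra
qed

lemma gegenbauer_addition3:
  fixes n a b s X Y :: real assumes "n > 0"
  shows "gegenbauer 3 (n + 1) (a * b + s) ((a^2 + X) * (b^2 + Y)) =
     gegenbauer 3 n s (X * Y) + 3 * (a * b * gegenbauer 2 n s (X * Y)) +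
     3 * (n + 3) / (n + 2) * (gegenbauer 2 (n + 3) a (a^2 + X) * gegenbauer 2 (n + 3) b (b^2 + Y) * s) +
     (n + 3) / n * (gegenbauer 3 (n + 1) a (a^2 + X) * gegenbauer 3 (n + 1) b (b^2 + Y))"
proof -
  have *: "n \<noteq> 0" "n + 1 \<noteq> 0" "n + 2 \<noteq> 0" "n + 3 \<noteq> 0" "3 + n \<noteq> 0" using assms by auto
  show ?thesis unfolding gegenbauer_simps
    by (simp add: * divide_simps) algebra
qed

lemma gegenbauer_addition4:
  fixes n a b s X Y :: real assumes "n > 0"
  shows "gegenbauer 4 (n + 1) (a * b + s) ((a^2 + X) * (b^2 + Y)) =
     gegenbauer 4 n s (X * Y) + 4 * (a * b * gegenbauer 3 n s (X * Y)) +
     6 * (n + 5) / (n + 4) * (gegenbauer 2 (n + 5) a (a^2 + X) * gegenbauer 2 (n + 5) b (b^2 + Y) * gegenbauer 2 n s (X * Y)) +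
     4 * (n + 5) / (n + 2) * (gegenbauer 3 (n + 3) a (a^2 + X) * gegenbauer 3 (n + 3) b (b^2 + Y) * s) +
     (n + 3) * (n + 5) / (n * (n + 2)) *
       (gegenbauer 4 (n + 1) a (a^2 + X) * gegenbauer 4 (n + 1) b (b^2 + Y))"
proof -
  have *: "n \<noteq> 0" "n + 1 \<noteq> 0" "n + 2 \<noteq> 0" "n + 3 \<noteq> 0" "3 + n \<noteq> 0" "n + 4 \<noteq> 0" "n + 5 \<noteq> 0"
    "5 + n \<noteq> 0" using assms by auto
  show ?thesis unfolding gegenbauer_simps
    by (simp add: * divide_simps) algebra
qed
lemma gegenbauer_addition5:
  fixes n a b s X Y :: real assumes "n > 0"
  shows "gegenbauer 5 (n + 1) (a * b + s) ((a^2 + X) * (b^2 + Y)) =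
     gegenbauer 5 n s (X * Y) + 5 * (a * b * gegenbauer 4 n s (X * Y)) +
     10 * (n + 7) / (n + 6) * (gegenbauer 2 (n + 7) a (a^2 + X) * gegenbauer 2 (n + 7) b (b^2 + Y) * gegenbauer 3 n s (X * Y)) +
     10 * (n + 7) / (n + 4) * (gegenbauer 3 (n + 5) a (a^2 + X) * gegenbauer 3 (n + 5) b (b^2 + Y) * gegenbauer 2 n s (X * Y)) +
     5 * (n + 5) * (n + 7) / ((n + 2) * (n + 4)) *
       (gegenbauer 4 (n + 3) a (a^2 + X) * gegenbauer 4 (n + 3) b (b^2 + Y) * s) +
     (n + 5) * (n + 7) / (n * (n + 2)) *
       (gegenbauer 5 (n + 1) a (a^2 + X) * gegenbauer 5 (n + 1) b (b^2 + Y))"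
proof -
  have *: "n \<noteq> 0" "n + 1 \<noteq> 0" "n + 2 \<noteq> 0" "n + 3 \<noteq> 0" "n + 4 \<noteq> 0" "n + 5 \<noteq> 0" "n + 6 \<noteq> 0" "n + 7 \<noteq> 0"
    "5 + n \<noteq> 0" "7 + n \<noteq> 0" using assms by auto
  show ?thesis unfolding gegenbauer_simps
    by (simp add: * divide_simps) algebra
qed

text \<open>Induction on the set of coordinates: by the addition formulas the new kernel is a
  nonnegative combination of rank-one weights times kernels of the smaller set. The restricted
  vectors have varying norms, hence the homogeneous form in \<open>q\<close>.\<close>

lemma pos_def_kernel_gegenbauer:
  assumes "finite I" "I \<noteq> {}" "k \<le> 5"
  shows "pos_def_kernel (\<lambda>x y. gegenbauer k (card I) (\<Sum>i\<in>I. f i x * f i y)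
           ((\<Sum>i\<in>I. (f i x)\<^sup>2) * (\<Sum>i\<in>I. (f i y)\<^sup>2)))"
  using assms(1-3)
proof (induction arbitrary: k rule: finite_ne_induct)
  case (singleton i)
  have zero: "pos_def_kernel (\<lambda>x y. 0)" by (simp add: pos_def_kernel_def)
  have one: "pos_def_kernel (\<lambda>x y. f i x * f i y)"
    using pos_def_kernel_weight[OF pos_def_kernel_1, of "f i"] by simp
  from singleton have "k = 0 \<or> k = 1 \<or> k = 2 \<or> k = 3 \<or> k = 4 \<or> k = 5" by auto
  \<comment> \<open>On a line s^2 = q, so the kernels of degrees 2 to 5 vanish identically.\<close>
  moreover have "gegenbauer 2 1 (a * b) (a^2 * b^2) = 0" "gegenbauer 3 1 (a * b) (a^2 * b^2) = 0"
    "gegenbauer 4 1 (a * b) (a^2 * b^2) = 0" "gegenbauer 5 1 (a * b) (a^2 * b^2) = 0" for a b :: real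
    unfolding gegenbauer_simps by (simp_all add: field_simps power2_eq_square power3_eq_cube) algebra+
  ultimately show ?case
    by (elim disjE) (simp_all add: gegenbauer_simps(1-3) pos_def_kernel_1 zero one)
next
  case (insert i I)
  define n where "n = real (card I)"
  have n: "n > 0" using insert by (simp add: n_def card_gt_0_iff)
  have card: "real (card (insert i I)) = n + 1" using insert by (simp add: n_def)
  define s where "s = (\<lambda>x y. \<Sum>i\<in>I. f i x * f i y)"
  define X where "X = (\<lambda>x. \<Sum>i\<in>I. (f i x)\<^sup>2)"
  have IH: "pos_def_kernel (\<lambda>x y. gegenbauer k n (s x y) (X x * X y))" if "k \<le> 5" for k
    using insert.IH[OF that] by (simp add: n_def s_def X_def)
  have IH1: "pos_def_kernel s" using IH[of 1] by (simp add: gegenbauer_simps)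
  note w = pos_def_kernel_weight[OF pos_def_kernel_1, simplified]
  from insert.prems have "k = 0 \<or> k = 1 \<or> k = 2 \<or> k = 3 \<or> k = 4 \<or> k = 5" by auto
  then have "pos_def_kernel (\<lambda>x y. gegenbauer k (n + 1) (f i x * f i y + s x y)
      (((f i x)\<^sup>2 + X x) * ((f i y)\<^sup>2 + X y)))"
  proof (elim disjE; hypsubst)
    show "pos_def_kernel (\<lambda>x y. gegenbauer 0 (n + 1) (f i x * f i y + s x y)
      (((f i x)\<^sup>2 + X x) * ((f i y)\<^sup>2 + X y)))"
      by (simp add: gegenbauer_simps pos_def_kernel_1)
    show "pos_def_kernel (\<lambda>x y. gegenbauer 1 (n + 1) (f i x * f i y + s x y)
      (((f i x)\<^sup>2 + X x) * ((f i y)\<^sup>2 + X y)))"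
      unfolding gegenbauer_simps by (intro pos_def_kernel_add w IH1)
    show "pos_def_kernel (\<lambda>x y. gegenbauer 2 (n + 1) (f i x * f i y + s x y)
      (((f i x)\<^sup>2 + X x) * ((f i y)\<^sup>2 + X y)))"
      unfolding gegenbauer_addition2[OF n]
      by (intro pos_def_kernel_add pos_def_kernel_scale pos_def_kernel_weight w IH IH1)
        (use n in auto)
    show "pos_def_kernel (\<lambda>x y. gegenbauer 3 (n + 1) (f i x * f i y + s x y)
      (((f i x)\<^sup>2 + X x) * ((f i y)\<^sup>2 + X y)))"
      unfolding gegenbauer_addition3[OF n]
      by (intro pos_def_kernel_add pos_def_kernel_scale pos_def_kernel_weight w IH IH1)
        (use n in auto)
    show "pos_def_kernel (\<lambda>x y. gegenbauer 4 (n + 1) (f i x * f i y + s x y)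
      (((f i x)\<^sup>2 + X x) * ((f i y)\<^sup>2 + X y)))"
      unfolding gegenbauer_addition4[OF n]
      by (intro pos_def_kernel_add pos_def_kernel_scale pos_def_kernel_weight w IH IH1)
        (use n in auto)
    show "pos_def_kernel (\<lambda>x y. gegenbauer 5 (n + 1) (f i x * f i y + s x y)
      (((f i x)\<^sup>2 + X x) * ((f i y)\<^sup>2 + X y)))"
      unfolding gegenbauer_addition5[OF n]
      by (intro pos_def_kernel_add pos_def_kernel_scale pos_def_kernel_weight w IH IH1)
        (use n in auto)
  qed
  then show ?case
    unfolding card using insert.hyps by (simp add: s_def X_def)
qed

section \<open>Delsarte's bound and its two instances in dimension 23\<close>

text \<open>Two estimates of the sum of \<open>F (x \<bullet> y)\<close> over all pairs. It is at
  least \<open>c 0\<close> times the squared cardinality, because every Gegenbauer term of positive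
  degree contributes a nonnegative amount; it is at most the diagonal part, because the other terms
  are nonpositive.\<close>

lemma delsarte_bound:
  fixes C :: "(real^'n) set" and c :: "nat \<Rightarrow> real"
  assumes C: "spherical_code C" "C \<noteq> {}"
    and c: "\<And>k. k \<in> {1..5} \<Longrightarrow> 0 \<le> c k"
    and F: "\<And>t. F t = (\<Sum>k\<le>5. c k * gegenbauer k CARD('n) t 1)"
    and neg: "\<And>t. t \<in> inner_products C \<Longrightarrow> F t \<le> 0"
  shows "c 0 * card C \<le> F 1"
proof -
  have fin: "finite C" and unit: "\<And>x. x \<in> C \<Longrightarrow> norm x = 1"
    using C by (auto simp: spherical_code_def)
  have sq: "(\<Sum>i\<in>UNIV. (x $ i)\<^sup>2) = 1" if "x \<in> C" for x :: "real^'n"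
    using unit[OF that] by (simp add: norm_vec_def L2_set_def)
  have pos: "0 \<le> (\<Sum>x\<in>C. \<Sum>y\<in>C. gegenbauer k CARD('n) (x \<bullet> y) 1)" if "k \<le> 5" for k
  proof -
    have "(\<Sum>x\<in>C. \<Sum>y\<in>C. gegenbauer k CARD('n) (x \<bullet> y) 1) =
      (\<Sum>x\<in>C. \<Sum>y\<in>C. gegenbauer k CARD('n) (\<Sum>i\<in>UNIV. x $ i * y $ i)
           ((\<Sum>i\<in>UNIV. (x $ i)\<^sup>2) * (\<Sum>i\<in>UNIV. (y $ i)\<^sup>2)))"
      by (intro sum.cong refl) (simp add: sq inner_vec_def)
    also have "\<dots> \<ge> 0"
      using pos_def_kernel_gegenbauer[of "UNIV::'n set" k "\<lambda>i (x::real^'n). x $ i", unfolded pos_def_kernel_def, rule_format, OF _ _ _ fin, of "\<lambda>_. 1"] that by simp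
    finally show ?thesis .
  qed
  have "c 0 * card C * card C \<le> (\<Sum>k\<le>5. c k * (\<Sum>x\<in>C. \<Sum>y\<in>C. gegenbauer k CARD('n) (x \<bullet> y) 1))"
  proof -
    have "{..5::nat} = insert 0 {1..5}" by auto
    then have "(\<Sum>k\<le>5. c k * (\<Sum>x\<in>C. \<Sum>y\<in>C. gegenbauer k CARD('n) (x \<bullet> y) 1)) =
        c 0 * (card C * card C) + (\<Sum>k=1..5. c k * (\<Sum>x\<in>C. \<Sum>y\<in>C. gegenbauer k CARD('n) (x \<bullet> y) 1))"
      by (simp add: gegenbauer_simps)
    moreover have "0 \<le> (\<Sum>k=1..5. c k * (\<Sum>x\<in>C. \<Sum>y\<in>C. gegenbauer k CARD('n) (x \<bullet> y) 1))"
      by (intro sum_nonneg mult_nonneg_nonneg c pos) auto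
    ultimately show ?thesis by simp
  qed
  also have "\<dots> = (\<Sum>x\<in>C. \<Sum>y\<in>C. F (x \<bullet> y))"
    unfolding F sum_distrib_left
    by (subst sum.swap, rule sum.cong[OF refl], subst sum.swap, rule refl)
  also have "\<dots> \<le> (\<Sum>x\<in>C. \<Sum>y\<in>C. if x = y then F 1 else 0)"
  proof (intro sum_mono)
    fix x y assume "x \<in> C" "y \<in> C"
    then show "F (x \<bullet> y) \<le> (if x = y then F 1 else 0)"
      using neg unit[of x] by (auto simp: inner_products_def simp flip: power2_norm_eq_inner)
  qed
  also have "\<dots> = card C * F 1"
    by (simp add: fin)
  finally show ?thesis
    using C fin by (simp add: mult_ac card_gt_0_iff)
qed

lemma inner_products_le:
  fixes C :: "(real^'n) set"
  assumes "spherical_code C" "max_inner_product_le C s" "t \<in> inner_products C"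
  shows "t \<le> s"
proof -
  have "inner_products C \<subseteq> (\<lambda>(x, y). x \<bullet> y) ` (C \<times> C)"
    by (auto simp: inner_products_def)
  then have "finite (inner_products C)"
    using assms(1) by (auto simp: spherical_code_def intro: finite_subset)
  then have "t \<le> Max (inner_products C)"
    using assms(3) by (rule Max_ge)
  also have "\<dots> \<le> s"
    using assms(2,3) by (auto simp: max_inner_product_le_def max_inner_product_def)
  finally show ?thesis .
qed

text \<open>Padding the list with \<open>0\<close> lets the statement cover polynomials of degree
  below 5, such as the cubic that shows that 2/5 occurs.\<close>

lemma delsarte_bound_list:
  fixes C :: "(real^23) set" and c :: "real list"
  assumes C: "spherical_code C"
    and c: "list_all (\<lambda>x. 0 \<le> x) c" "c ! 0 > 0" "c \<noteq> []"
    and F: "\<And>t. F t = (\<Sum>k\<le>5. nth_default 0 c k * gegenbauer k 23 t 1)"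
    and neg: "\<And>t. t \<in> inner_products C \<Longrightarrow> F t \<le> 0"
  shows "c ! 0 * card C \<le> F 1 \<or> C = {}"
proof (rule disjCI)
  assume "C \<noteq> {}"
  have "nth_default 0 c k \<ge> 0" for k
    using c(1) by (auto simp: nth_default_def list_all_length)
  then have "nth_default 0 c 0 * card C \<le> F 1"
    using F neg by (intro delsarte_bound[OF C \<open>C \<noteq> {}\<close>]) auto
  then show "c ! 0 * card C \<le> F 1" using c(3) by (simp add: nth_default_nth)
qed

lemma card_code_le_1:
  fixes C :: "(real^23) set"
  assumes C: "spherical_code C" "max_inner_product_le C (2/5)" "avoiding {-1/2<..<-1/5} C"
  shows "card C \<le> 11178"
proof -
  \<comment> \<open>The simple roots -1/2 and -1/5 bound the gap, the only interval below 2/5 where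
    \<open>F\<close> may be positive. The double root at 1/10 avoids a sign change there.\<close>
  define F :: "real \<Rightarrow> real" where "F = (\<lambda>t. (t + 1/2) * (t + 1/5) * (t - 1/10)^2 * (t - 2/5))"
  have "F t \<le> 0" if t: "t \<in> inner_products C" for t
  proof -
    have "t \<le> 2/5" by (rule inner_products_le[OF C(1,2) t])
    moreover have "t \<le> -1/2 \<or> -1/5 \<le> t" using C(3) t by (fastforce simp: avoiding_def)
    ultimately have "0 \<le> (t + 1/2) * (t + 1/5)" "t - 2/5 \<le> 0"
      by (auto simp: zero_le_mult_iff)
    then show ?thesis
      unfolding F_def by (intro mult_nonneg_nonpos[OF mult_nonneg_nonneg[OF _ zero_le_power2]])
  qed
  \<comment> \<open>The coefficients of \<open>F\<close> in the monic Gegenbauer basis of dimension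
    23; \<open>F 1\<close> divided by the first of them is exactly 11178.\<close>
  moreover have "F t = (\<Sum>k\<le>5. nth_default 0 [9/115000, 37/45000, 191/9000, 333/2900, 1/10, 1] k * gegenbauer k 23 t 1)" for t
    by (simp add: F_def nth_default_def gegenbauer_def eval_nat_numeral) (simp add: field_simps)
  ultimately have "9/115000 * card C \<le> F 1 \<or> C = {}"
    using delsarte_bound_list[OF C(1), of "[9/115000, 37/45000, 191/9000, 333/2900, 1/10, 1]" F] by simp
  then show ?thesis by (auto simp: F_def power2_eq_square)
qed

lemma card_code_le_2:
  fixes C :: "(real^23) set"
  assumes C: "spherical_code C" "max_inner_product_le C (2/5)" "avoiding {-1/5<..<1/10} C"
  shows "card C \<le> 11178"
proof -
  \<comment> \<open>The gap now lies between -1/5 and 1/10, so these are the simple roots and the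
    double root moves to -1/2. The quotient of \<open>F 1\<close> by the constant coefficient is
    again 11178.\<close>
  define F :: "real \<Rightarrow> real" where "F = (\<lambda>t. (t + 1/5) * (t - 1/10) * (t + 1/2)^2 * (t - 2/5))"
  have "F t \<le> 0" if t: "t \<in> inner_products C" for t
  proof -
    have "t \<le> 2/5" by (rule inner_products_le[OF C(1,2) t])
    moreover have "t \<le> -1/5 \<or> 1/10 \<le> t" using C(3) t by (fastforce simp: avoiding_def)
    ultimately have "0 \<le> (t + 1/5) * (t - 1/10)" "t - 2/5 \<le> 0"
      by (auto simp: zero_le_mult_iff)
    then show ?thesis
      unfolding F_def by (intro mult_nonneg_nonpos[OF mult_nonneg_nonneg[OF _ zero_le_power2]])
  qed
  moreover have "F t = (\<Sum>k\<le>5. nth_default 0 [3/23000, 91/45000, 257/9000, 681/2900, 7/10, 1] k * gegenbauer k 23 t 1)" for t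
    by (simp add: F_def nth_default_def gegenbauer_def eval_nat_numeral) (simp add: field_simps)
  ultimately have "3/23000 * card C \<le> F 1 \<or> C = {}"
    using delsarte_bound_list[OF C(1), of "[3/23000, 91/45000, 257/9000, 681/2900, 7/10, 1]" F] by simp
  then show ?thesis by (auto simp: F_def power2_eq_square)
qed

section \<open>Poisson summation for self-dual lattices\<close>

text \<open>Dominated convergence along an enumeration of \<open>A\<close>. The bound on finite sums
  of norms also makes the integrals absolutely summable, so the limit along the enumeration is the
  unordered sum.\<close>

lemma integral_infsum_dominated:
  fixes f :: "'i \<Rightarrow> 'a \<Rightarrow> complex"
  assumes "countable A"
    and meas: "\<And>i. i \<in> A \<Longrightarrow> f i \<in> borel_measurable M"
    and G: "integrable M G"
    and bound: "\<And>I x. finite I \<Longrightarrow> I \<subseteq> A \<Longrightarrow> (\<Sum>i\<in>I. norm (f i x)) \<le> G x"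
  shows "((\<lambda>i. integral\<^sup>L M (f i)) has_sum (LINT x|M. (\<Sum>\<^sub>\<infinity>i\<in>A. f i x))) A"
proof -
  have int: "integrable M (f i)" if "i \<in> A" for i
    by (rule Bochner_Integration.integrable_bound[OF G meas[OF that]])
       (use bound[of "{i}"] that in \<open>auto intro!: always_eventually order_trans[OF _ abs_ge_self]\<close>)
  have summable: "(\<lambda>i. norm (f i x)) summable_on A" for x
    by (rule nonneg_bounded_partial_sums_imp_summable_on[where C = "G x"])
       (auto simp: eventually_finite_subsets_at_top_weakI bound)
  have isum: "(\<lambda>i. norm (integral\<^sup>L M (f i))) summable_on A"
  proof (rule nonneg_bounded_partial_sums_imp_summable_on[where C = "integral\<^sup>L M G"])
    have "(\<Sum>i\<in>I. norm (integral\<^sup>L M (f i))) \<le> integral\<^sup>L M G" if I: "finite I" "I \<subseteq> A" for I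
    proof -
      have "(\<Sum>i\<in>I. norm (integral\<^sup>L M (f i))) \<le> (\<Sum>i\<in>I. LINT x|M. norm (f i x))"
        by (intro sum_mono integral_norm_bound)
      also have "\<dots> = (LINT x|M. (\<Sum>i\<in>I. norm (f i x)))"
        using I int by (intro Bochner_Integration.integral_sum[symmetric] integrable_norm) auto
      also have "\<dots> \<le> integral\<^sup>L M G"
        using I int G bound by (intro integral_mono) (auto intro!: Bochner_Integration.integrable_sum)
      finally show ?thesis .
    qed
    then show "\<forall>\<^sub>F I in finite_subsets_at_top A. (\<Sum>i\<in>I. norm (integral\<^sup>L M (f i))) \<le> integral\<^sup>L M G"
      by (auto intro: eventually_finite_subsets_at_top_weakI)
  qed auto
  show ?thesis
  proof (cases "finite A")
    case True
    then show ?thesis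
      using int by (auto simp: has_sum_finite_iff infsum_finite Bochner_Integration.integral_sum)
  next
    case False
    define e where "e = from_nat_into A"
    have e: "bij_betw e UNIV A"
      unfolding e_def using assms(1) False by (rule bij_betw_from_nat_into)
    have ek: "e k \<in> A" for k using e by (auto simp: bij_betw_def)
    have img: "e ` J \<subseteq> A" for J using e by (auto simp: bij_betw_def)
    have inj: "inj_on e J" for J using e by (auto simp: bij_betw_def inj_on_def)
    have sums: "(\<lambda>k. f (e k) x) sums (\<Sum>\<^sub>\<infinity>i\<in>A. f i x)" for x
    proof -
      have "((\<lambda>i. f i x) has_sum (\<Sum>\<^sub>\<infinity>i\<in>A. f i x)) A"
        using abs_summable_summable[OF summable[of x]] by simp
      then have "((\<lambda>k. f (e k) x) has_sum (\<Sum>\<^sub>\<infinity>i\<in>A. f i x)) UNIV"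
        using has_sum_reindex_bij_betw[OF e, of "\<lambda>i. f i x"] by simp
      then show ?thesis by (rule has_sum_imp_sums)
    qed
    have "(\<lambda>n. LINT x|M. (\<Sum>k<n. f (e k) x)) \<longlonglongrightarrow> (LINT x|M. (\<Sum>\<^sub>\<infinity>i\<in>A. f i x))"
    proof (rule integral_dominated_convergence[where w = G])
      show "(\<lambda>x. \<Sum>\<^sub>\<infinity>i\<in>A. f i x) \<in> borel_measurable M"
        by (rule borel_measurable_LIMSEQ_metric[where f = "\<lambda>n x. \<Sum>k<n. f (e k) x"])
           (use sums meas ek in \<open>auto simp: sums_def intro!: borel_measurable_sum\<close>)
      show "AE x in M. (\<lambda>n. \<Sum>k<n. f (e k) x) \<longlonglongrightarrow> (\<Sum>\<^sub>\<infinity>i\<in>A. f i x)"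
        using sums by (auto simp: sums_def)
      show "AE x in M. norm (\<Sum>k<n. f (e k) x) \<le> G x" for n
      proof (rule AE_I2)
        fix x
        have "norm (\<Sum>k<n. f (e k) x) \<le> (\<Sum>k<n. norm (f (e k) x))" by (rule norm_sum)
        also have "\<dots> = (\<Sum>i\<in>e ` {..<n}. norm (f i x))" by (simp add: sum.reindex inj)
        also have "\<dots> \<le> G x" by (rule bound) (auto simp: img)
        finally show "norm (\<Sum>k<n. f (e k) x) \<le> G x" .
      qed
    qed (use G meas ek in \<open>auto intro!: borel_measurable_sum\<close>)
    also have "(\<lambda>n. LINT x|M. (\<Sum>k<n. f (e k) x)) = (\<lambda>n. \<Sum>k<n. integral\<^sup>L M (f (e k)))"
      using int ek by (intro ext Bochner_Integration.integral_sum) auto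
    finally have 1: "(\<lambda>k. integral\<^sup>L M (f (e k))) sums (LINT x|M. (\<Sum>\<^sub>\<infinity>i\<in>A. f i x))"
      by (simp add: sums_def)
    obtain S where S: "((\<lambda>i. integral\<^sup>L M (f i)) has_sum S) A"
      using abs_summable_summable[OF isum] by (auto simp: summable_on_def)
    then have "((\<lambda>k. integral\<^sup>L M (f (e k))) has_sum S) UNIV"
      using has_sum_reindex_bij_betw[OF e, of "\<lambda>i. integral\<^sup>L M (f i)"] by simp
    then have "S = (LINT x|M. (\<Sum>\<^sub>\<infinity>i\<in>A. f i x))"
      using 1 sums_unique2 has_sum_imp_sums by blast
    then show ?thesis using S by simp
  qed
qed

lemma integral_gaussian_cis:
  fixes t w :: real assumes t: "t > 0"
  shows "integrable lborel (\<lambda>x. exp (- pi * x\<^sup>2 / t) *\<^sub>R cis (- 2 * pi * w * x))"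
    and "(LINT x|lborel. exp (- pi * x\<^sup>2 / t) *\<^sub>R cis (- 2 * pi * w * x)) = of_real (sqrt t * exp (- pi * t * w\<^sup>2))"
proof -
  \<comment> \<open>Chosen so that (x / \<sigma>)^2 / 2 = pi x^2 / t; the integral becomes the
    characteristic function of the standard normal distribution.\<close>
  define \<sigma> where "\<sigma> = sqrt (t / (2 * pi))"
  have \<sigma>: "\<sigma> > 0" "\<sigma>\<^sup>2 = t / (2 * pi)" using t by (simp_all add: \<sigma>_def)
  define g where "g = (\<lambda>x. std_normal_density x *\<^sub>R iexp ((- 2 * pi * w * \<sigma>) * x))"
  have "char std_normal_distribution (- 2 * pi * w * \<sigma>) = of_real (exp (- (- 2 * pi * w * \<sigma>)\<^sup>2 / 2))"
    by (simp add: char_std_normal_distribution)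
  then have "(LINT x|lborel. g x) = of_real (exp (- (- 2 * pi * w * \<sigma>)\<^sup>2 / 2))"
    unfolding char_def g_def by (subst (asm) integral_density) (auto intro!: borel_measurable_continuous_onI continuous_intros)
  also have "(- (- 2 * pi * w * \<sigma>)\<^sup>2 / 2) = - pi * t * w\<^sup>2"
    using \<sigma>(2) by (simp add: power_mult_distrib power2_eq_square)
  finally have g: "(LINT x|lborel. g x) = of_real (exp (- pi * t * w\<^sup>2))" .
  have ig: "integrable lborel g"
  proof (rule Bochner_Integration.integrable_bound[of _ std_normal_density])
    show "g \<in> borel_measurable lborel"
      unfolding g_def std_normal_density_def
      by (intro borel_measurable_continuous_onI continuous_intros | simp)+
  qed (auto simp: g_def)
  have eq: "exp (- pi * x\<^sup>2 / t) *\<^sub>R cis (- 2 * pi * w * x) = sqrt (2 * pi) *\<^sub>R g (0 + (1 / \<sigma>) * x)" for x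
  proof -
    have "(x / \<sigma>)\<^sup>2 / 2 = pi * x\<^sup>2 / t"
      using \<sigma> t by (simp add: power_divide)
    then show ?thesis
      using \<sigma>(1) by (simp add: g_def std_normal_density_def cis_conv_exp scaleR_conv_of_real mult.assoc)
  qed
  have ig': "integrable lborel (\<lambda>x. g (0 + (1 / \<sigma>) * x))"
    using lborel_integrable_real_affine[OF ig, of "1 / \<sigma>" 0] \<sigma>(1) by simp
  then show "integrable lborel (\<lambda>x. exp (- pi * x\<^sup>2 / t) *\<^sub>R cis (- 2 * pi * w * x))"
    unfolding eq by (rule integrable_scaleR_right)
  have "(LINT x|lborel. g x) = \<bar>1 / \<sigma>\<bar> *\<^sub>R (LINT x|lborel. g (0 + (1 / \<sigma>) * x))"
    using \<sigma>(1) by (intro lborel_integral_real_affine) auto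
  then have "(LINT x|lborel. g (0 + (1 / \<sigma>) * x)) = \<sigma> *\<^sub>R of_real (exp (- pi * t * w\<^sup>2))"
    using g \<sigma>(1) by (simp add: field_simps scaleR_conv_of_real)
  moreover have "sqrt (2 * pi) * \<sigma> = sqrt t" using t by (simp add: \<sigma>_def flip: real_sqrt_mult)
  ultimately show "(LINT x|lborel. exp (- pi * x\<^sup>2 / t) *\<^sub>R cis (- 2 * pi * w * x)) = of_real (sqrt t * exp (- pi * t * w\<^sup>2))"
    unfolding eq integral_scaleR_right
    by (metis of_real_mult scaleR_conv_of_real scaleR_scaleR)
qed

lemma lborel_integral_prod_Basis:
  fixes f :: "'a::euclidean_space \<Rightarrow> real \<Rightarrow> complex"
  assumes "\<And>b. b \<in> Basis \<Longrightarrow> integrable lborel (f b)"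
  shows "integrable lborel (\<lambda>x::'a. \<Prod>b\<in>Basis. f b (x \<bullet> b))"
    and "(LINT x|lborel. (\<Prod>b\<in>Basis. f b (x \<bullet> b))) = (\<Prod>b\<in>Basis. LINT x|lborel. f b x)"
proof -
  interpret product_sigma_finite "\<lambda>_::'a. lborel :: real measure" ..
  have [measurable]: "\<And>b. b \<in> Basis \<Longrightarrow> f b \<in> borel_measurable borel"
    using borel_measurable_integrable[OF assms] by simp
  have eq: "(\<Prod>b\<in>Basis. f b ((\<Sum>c\<in>Basis. y c *\<^sub>R c) \<bullet> b)) = (\<Prod>b\<in>Basis. f b (y b))" for y :: "'a \<Rightarrow> real"
    by (intro prod.cong refl) (simp add: inner_sum_left inner_Basis if_distrib cong: if_cong)
  have m: "(\<lambda>f. \<Sum>b\<in>Basis. f b *\<^sub>R b :: 'a) \<in> measurable (\<Pi>\<^sub>M b\<in>Basis. lborel) borel"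
    by measurable
  have m2: "(\<lambda>x::'a. \<Prod>b\<in>Basis. f b (x \<bullet> b)) \<in> borel_measurable borel"
    by (intro borel_measurable_prod) (auto intro!: measurable_compose[OF _ \<open>\<And>b. b \<in> Basis \<Longrightarrow> f b \<in> borel_measurable borel\<close>])
  show "integrable lborel (\<lambda>x::'a. \<Prod>b\<in>Basis. f b (x \<bullet> b))"
    unfolding lborel_eq[where 'a='a] integrable_distr_eq[OF m m2] eq
    using assms by (intro product_integrable_prod) auto
  show "(LINT x|lborel. (\<Prod>b\<in>Basis. f b (x \<bullet> b))) = (\<Prod>b\<in>Basis. LINT x|lborel. f b x)"
    unfolding lborel_eq[where 'a='a] integral_distr[OF m m2] eq
    using assms by (intro product_integral_prod) auto
qed

lemma integral_gaussian_character:
  fixes y :: "'a::euclidean_space" and t :: real assumes t: "t > 0"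
  shows "integrable lborel (\<lambda>u. exp (- pi * (norm u)\<^sup>2 / t) *\<^sub>R cis (- 2 * pi * (y \<bullet> u)))" (is ?A)
    and "(LINT u|lborel. exp (- pi * (norm u)\<^sup>2 / t) *\<^sub>R cis (- 2 * pi * (y \<bullet> u))) =
           of_real (sqrt t ^ DIM('a) * exp (- pi * t * (norm y)\<^sup>2))" (is ?B)
proof -
  define f where "f = (\<lambda>(b::'a) x. exp (- pi * x\<^sup>2 / t) *\<^sub>R cis (- 2 * pi * (y \<bullet> b) * x))"
  have norm_sq: "(norm u)\<^sup>2 = (\<Sum>b\<in>Basis. (u \<bullet> b)\<^sup>2)" for u :: 'a
    by (simp add: norm_eq_sqrt_inner euclidean_inner[of u u] power2_eq_square sum_nonneg)
  have eq: "(\<lambda>u. exp (- pi * (norm u)\<^sup>2 / t) *\<^sub>R cis (- 2 * pi * (y \<bullet> u))) = (\<lambda>u. \<Prod>b\<in>Basis. f b (u \<bullet> b))"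
  proof
    fix u :: 'a
    have "cis (- 2 * pi * (y \<bullet> u)) = (\<Prod>b\<in>Basis. cis (- 2 * pi * (y \<bullet> b) * (u \<bullet> b)))"
      unfolding cis_conv_exp exp_sum[OF finite_Basis, symmetric]
      by (subst euclidean_inner) (simp add: sum_distrib_left sum_distrib_right mult_ac)
    moreover have "exp (- pi * (norm u)\<^sup>2 / t) = (\<Prod>b\<in>Basis. exp (- pi * (u \<bullet> b)\<^sup>2 / t))"
      unfolding norm_sq exp_sum[OF finite_Basis, symmetric]
      by (simp add: sum_distrib_left sum_divide_distrib sum_negf)
    ultimately show "exp (- pi * (norm u)\<^sup>2 / t) *\<^sub>R cis (- 2 * pi * (y \<bullet> u)) = (\<Prod>b\<in>Basis. f b (u \<bullet> b))"
      by (simp add: f_def scaleR_conv_of_real prod.distrib)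
  qed
  have i: "integrable lborel (f b)" "(LINT x|lborel. f b x) = of_real (sqrt t * exp (- pi * t * (y \<bullet> b)\<^sup>2))" for b
    unfolding f_def using integral_gaussian_cis[OF t] by auto
  show ?A unfolding eq by (rule lborel_integral_prod_Basis(1)[OF i(1)])
  have "(\<Prod>b\<in>Basis. exp (- pi * t * (y \<bullet> b)\<^sup>2)) = exp (- pi * t * (norm y)\<^sup>2)"
    unfolding norm_sq exp_sum[OF finite_Basis, symmetric]
    by (simp add: sum_distrib_left sum_negf)
  then show ?B unfolding eq
    by (subst lborel_integral_prod_Basis) (use i in \<open>simp_all add: prod.distrib flip: of_real_prod of_real_power of_real_mult\<close>)
qed

text \<open>The M-test gives uniform convergence on each ball, with a majorant that may depend on
  the radius, as it does for Gaussian sums. Continuity is local, so this suffices.\<close>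

lemma continuous_on_infsum:
  fixes f :: "'i \<Rightarrow> 'a::euclidean_space \<Rightarrow> 'b::banach"
  assumes "\<And>i. i \<in> A \<Longrightarrow> continuous_on UNIV (f i)"
    and "\<And>r. r > 0 \<Longrightarrow> \<exists>M. M summable_on A \<and> (\<forall>i\<in>A. \<forall>u. norm u < r \<longrightarrow> norm (f i u) \<le> M i)"
  shows "continuous_on UNIV (\<lambda>u. \<Sum>\<^sub>\<infinity>i\<in>A. f i u)"
proof -
  have "continuous_on (ball 0 r) (\<lambda>u. \<Sum>\<^sub>\<infinity>i\<in>A. f i u)" if "r > 0" for r
  proof -
    from assms(2)[OF that] obtain M where M: "M summable_on A"
      "\<And>i u. i \<in> A \<Longrightarrow> norm u < r \<Longrightarrow> norm (f i u) \<le> M i" by blast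
    show ?thesis
    proof (rule uniform_limit_theorem)
      show "uniform_limit (ball 0 r) (\<lambda>I u. \<Sum>i\<in>I. f i u) (\<lambda>u. \<Sum>\<^sub>\<infinity>i\<in>A. f i u) (finite_subsets_at_top A)"
        by (rule Weierstrass_m_test_general[OF _ M(1)]) (use M(2) in auto)
      show "\<forall>\<^sub>F I in finite_subsets_at_top A. continuous_on (ball 0 r) (\<lambda>u. \<Sum>i\<in>I. f i u)"
        by (rule eventually_finite_subsets_at_top_weakI)
           (auto intro!: continuous_on_sum continuous_on_subset[OF assms(1)])
    qed auto
  qed
  then have "continuous_on (ball 0 (norm u + 1)) (\<lambda>u. \<Sum>\<^sub>\<infinity>i\<in>A. f i u)" for u :: 'a
    by (simp add: add_nonneg_pos)
  then have "isCont (\<lambda>u. \<Sum>\<^sub>\<infinity>i\<in>A. f i u) u" for u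
    using continuous_on_eq_continuous_at[of "ball 0 (norm u + 1)" "\<lambda>u. \<Sum>\<^sub>\<infinity>i\<in>A. f i u"]
    by auto
  then show ?thesis by (simp add: continuous_at_imp_continuous_on)
qed

text \<open>Since k^2 \<ge> |k|, each of the halves k \<ge> 0 and k \<le> 0 is dominated by a
  geometric series; the term k = 0 is counted in both.\<close>

lemma sum_exp_int_square_le:
  fixes a :: real assumes "a > 0"
  shows "(\<Sum>k\<in>{-K..K::int}. exp (- a * (of_int k)\<^sup>2)) \<le> 2 / (1 - exp (- a))"
proof -
  define r where "r = exp (- a)"
  have r: "0 < r" "r < 1" using assms by (simp_all add: r_def)
  have le: "exp (- a * (of_int k)\<^sup>2) \<le> r ^ nat \<bar>k\<bar>" for k :: int
  proof -
    have "\<bar>k\<bar> \<le> k\<^sup>2"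
      by (metis abs_ge_self abs_le_square_iff abs_of_nonneg zero_le_power2 int_one_le_iff_zero_less
          linorder_not_less mult_left_mono mult.right_neutral abs_zero abs_mult_self_eq power2_eq_square abs_ge_zero nle_le)
    then have "real_of_int \<bar>k\<bar> \<le> (of_int k)\<^sup>2"
      by (metis of_int_le_iff of_int_power)
    then have "- a * (of_int k)\<^sup>2 \<le> of_nat (nat \<bar>k\<bar>) * (- a)"
      using assms by (simp add: mult.commute)
    then show ?thesis
      by (simp add: r_def flip: exp_of_nat_mult)
  qed
  define N where "N = nat K"
  have half: "(\<Sum>k\<in>f ` {..N}. r ^ nat \<bar>k\<bar>) \<le> 1 / (1 - r)" if "f = int \<or> f = (\<lambda>n. - int n)" for f
  proof -
    have "(\<Sum>k\<in>f ` {..N}. r ^ nat \<bar>k\<bar>) = (\<Sum>n\<le>N. r ^ n)"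
      using that by (subst sum.reindex) (auto simp: inj_on_def intro!: sum.cong)
    also have "\<dots> \<le> (\<Sum>n. r ^ n)"
      using r by (intro sum_le_suminf summable_geometric) auto
    also have "\<dots> = 1 / (1 - r)" using r by (intro suminf_geometric) auto
    finally show ?thesis .
  qed
  have "(\<Sum>k\<in>{-K..K}. exp (- a * (of_int k)\<^sup>2)) \<le> (\<Sum>k\<in>{-K..K}. r ^ nat \<bar>k\<bar>)"
    by (intro sum_mono le)
  also have "\<dots> \<le> (\<Sum>k\<in>int ` {..N} \<union> (\<lambda>n. - int n) ` {..N}. r ^ nat \<bar>k\<bar>)"
  proof (rule sum_mono2)
    show "{- K..K} \<subseteq> int ` {..N} \<union> (\<lambda>n. - int n) ` {..N}"
    proof
      fix k assume "k \<in> {-K..K}"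
      then have "k = int (nat k) \<and> nat k \<le> N \<or> k = - int (nat (- k)) \<and> nat (- k) \<le> N"
        by (auto simp: N_def)
      then show "k \<in> int ` {..N} \<union> (\<lambda>n. - int n) ` {..N}" by blast
    qed
  qed (use r in auto)
  also have "\<dots> \<le> (\<Sum>k\<in>int ` {..N}. r ^ nat \<bar>k\<bar>) + (\<Sum>k\<in>(\<lambda>n. - int n) ` {..N}. r ^ nat \<bar>k\<bar>)"
    using r by (subst sum.union_inter[symmetric]) (auto intro!: sum_nonneg)
  also have "\<dots> \<le> 2 / (1 - r)" using half[of int] half[of "\<lambda>n. - int n"] by simp
  finally show ?thesis by (simp add: r_def)
qed

section \<open>Self-dual lattices: dual basis, covering radius, convergence of Gaussian sums\<close>

locale self_dual_lattice =
  fixes L :: "(real^'n) set"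
  assumes lattice: "is_lattice L" and dual: "dual_lattice L = L"
begin

lemma inner_int: "x \<in> L \<Longrightarrow> y \<in> L \<Longrightarrow> x \<bullet> y \<in> \<int>"
  using dual by (auto simp: dual_lattice_def)

text \<open>Membership is tested by integrality of inner products, so the closure properties below
  come from self-duality without reference to a basis.\<close>

lemma memI: "(\<And>x. x \<in> L \<Longrightarrow> x \<bullet> y \<in> \<int>) \<Longrightarrow> y \<in> L"
  using dual by (auto simp: dual_lattice_def)

lemma zero_mem [simp]: "0 \<in> L"
  by (rule memI) auto

lemma add_mem: "x \<in> L \<Longrightarrow> y \<in> L \<Longrightarrow> x + y \<in> L"
  by (rule memI) (auto simp: inner_add_right inner_int)

lemma uminus_mem: "x \<in> L \<Longrightarrow> - x \<in> L"
  by (rule memI) (auto simp: inner_int)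

lemma diff_mem: "x \<in> L \<Longrightarrow> y \<in> L \<Longrightarrow> x - y \<in> L"
  by (rule memI) (auto simp: inner_diff_right inner_int)

lemma int_scale_mem: "c \<in> \<int> \<Longrightarrow> x \<in> L \<Longrightarrow> c *\<^sub>R x \<in> L"
  by (rule memI) (auto simp: inner_int)

lemma sum_mem: "(\<And>i. i \<in> I \<Longrightarrow> f i \<in> L) \<Longrightarrow> sum f I \<in> L"
  by (rule memI) (auto simp: inner_sum_right inner_int)

lemma translate_image: "y \<in> L \<Longrightarrow> bij_betw (\<lambda>x. x + y) L L"
  by (rule bij_betwI[where g = "\<lambda>x. x - y"]) (auto simp: add_mem diff_mem)

text \<open>\<open>\<beta>\<close> is the basis dual to \<open>B\<close>. It lies in the lattice
  because lattice vectors have integer coordinates and the lattice is its own dual. Hence the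
  coordinate functionals are pairings with lattice vectors, and their characters are
  periodic.\<close>

lemma coordinates:
  obtains B \<beta> where "finite B" "B \<subseteq> L" "\<forall>b\<in>B. \<beta> b \<in> L"
    "\<forall>u. (\<Sum>b\<in>B. (\<beta> b \<bullet> u) *\<^sub>R b) = u"
proof -
  from lattice obtain B where B: "independent B" "span B = UNIV"
    and L: "L = {\<Sum>b\<in>B. of_int (c b) *\<^sub>R b | c :: real^'n \<Rightarrow> int. True}"
    unfolding is_lattice_def by blast
  have fin: "finite B" using B(1) by (rule finiteI_independent)
  define \<beta> where "\<beta> = (\<lambda>b. \<Sum>e\<in>Basis. representation B e b *\<^sub>R e)"
  have rep: "\<beta> b \<bullet> u = representation B u b" for b u
  proof -
    have "representation B (\<Sum>e\<in>Basis. (u \<bullet> e) *\<^sub>R e) b = (\<Sum>e\<in>Basis. (u \<bullet> e) * representation B e b)"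
      using B by (subst representation_sum) (auto simp: representation_scale)
    moreover have "\<beta> b \<bullet> u = (\<Sum>e\<in>Basis. (u \<bullet> e) * representation B e b)"
      by (simp add: \<beta>_def inner_sum_left inner_commute[of u] mult.commute)
    ultimately show ?thesis by (simp add: euclidean_representation)
  qed
  show ?thesis
  proof
    show "finite B" by (rule fin)
    show "B \<subseteq> L"
    proof
      fix b assume "b \<in> B"
      then have "b = (\<Sum>b'\<in>B. of_int (if b' = b then 1 else 0) *\<^sub>R b')"
      proof -
        have "(\<Sum>b'\<in>B. of_int (if b' = b then 1 else 0) *\<^sub>R b') = (\<Sum>b'\<in>B. if b' = b then b' else 0)"
          by (intro sum.cong) auto
        then show ?thesis using \<open>b \<in> B\<close> fin by simp
      qed
      then have "\<exists>c :: real^'n \<Rightarrow> int. b = (\<Sum>b'\<in>B. of_int (c b') *\<^sub>R b')" by (intro exI[of _ "\<lambda>b'. if b' = b then 1 else 0"])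
      then show "b \<in> L" unfolding L by simp
    qed
    show "\<forall>b\<in>B. \<beta> b \<in> L"
    proof (intro ballI memI)
      fix b x assume that: "b \<in> B" and "x \<in> L"
      then obtain c :: "real^'n \<Rightarrow> int" where x: "x = (\<Sum>b\<in>B. of_int (c b) *\<^sub>R b)" unfolding L by blast
      have "\<beta> b \<bullet> x = representation B (\<Sum>b\<in>B. of_int (c b) *\<^sub>R b) b"
        by (simp add: rep x)
      also have "\<dots> = (\<Sum>b'\<in>B. of_int (c b') * representation B b' b)"
        using B by (subst representation_sum) (auto simp: representation_scale)
      also have "\<dots> = (\<Sum>b'\<in>B. if b' = b then of_int (c b') else 0)"
        using B that by (intro sum.cong) (auto simp: representation_basis)
      also have "\<dots> = of_int (c b)" using fin that by simp
      finally show "x \<bullet> \<beta> b \<in> \<int>" by (simp add: inner_commute)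
    qed
    show "\<forall>u. (\<Sum>b\<in>B. (\<beta> b \<bullet> u) *\<^sub>R b) = u"
      unfolding rep using B fin by (intro allI sum_representation_eq) auto
  qed
qed

lemma countable_lattice: "countable L"
proof -
  obtain B \<beta> where B: "finite B" "B \<subseteq> L" "\<forall>b\<in>B. \<beta> b \<in> L"
    "\<forall>u. (\<Sum>b\<in>B. (\<beta> b \<bullet> u) *\<^sub>R b) = u" by (rule coordinates)
  have "L \<subseteq> (\<lambda>c. \<Sum>b\<in>B. c b *\<^sub>R b) ` (B \<rightarrow>\<^sub>E \<int>)"
  proof
    fix x assume x: "x \<in> L"
    have "x = (\<Sum>b\<in>B. (restrict (\<lambda>b. \<beta> b \<bullet> x) B) b *\<^sub>R b)" using B(4)[rule_format, of x] by simp
    moreover have "restrict (\<lambda>b. \<beta> b \<bullet> x) B \<in> B \<rightarrow>\<^sub>E \<int>" using x B(3) inner_int by auto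
    ultimately show "x \<in> (\<lambda>c. \<Sum>b\<in>B. c b *\<^sub>R b) ` (B \<rightarrow>\<^sub>E \<int>)" by blast
  qed
  moreover have "countable (B \<rightarrow>\<^sub>E (\<int>::real set))"
    using B(1) by (intro countable_PiE) (auto simp: Ints_def)
  ultimately show ?thesis by (meson countable_image countable_subset)
qed

text \<open>Rounding the coordinates down leaves a remainder no longer than the basis vectors
  together. It plays the part of compactness of the torus: a periodic function takes all its values
  on one ball.\<close>

lemma covering_radius:
  obtains R where "R > 0" "\<forall>u. \<exists>x\<in>L. norm (u - x) \<le> R"
proof -
  obtain B \<beta> where B: "finite B" "B \<subseteq> L" "\<forall>b\<in>B. \<beta> b \<in> L"
    "\<forall>u. (\<Sum>b\<in>B. (\<beta> b \<bullet> u) *\<^sub>R b) = u" by (rule coordinates)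
  show ?thesis
  proof
    show "(\<Sum>b\<in>B. norm b) + 1 > 0" by (simp add: add_nonneg_pos sum_nonneg)
    show "\<forall>u. \<exists>x\<in>L. norm (u - x) \<le> (\<Sum>b\<in>B. norm b) + 1"
    proof
    fix u :: "real^'n"
    define x where "x = (\<Sum>b\<in>B. of_int \<lfloor>\<beta> b \<bullet> u\<rfloor> *\<^sub>R b)"
    have xL: "x \<in> L" unfolding x_def using B(2) by (intro sum_mem int_scale_mem) auto
    have "u - x = (\<Sum>b\<in>B. frac (\<beta> b \<bullet> u) *\<^sub>R b)"
      using B(4)[rule_format, of u] by (simp add: x_def frac_def scaleR_left_diff_distrib sum_subtractf)
    then have "norm (u - x) \<le> (\<Sum>b\<in>B. norm (frac (\<beta> b \<bullet> u) *\<^sub>R b))"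
      by (simp only: norm_sum)
    also have "\<dots> \<le> (\<Sum>b\<in>B. norm b)"
      by (intro sum_mono) (auto simp: mult_left_le_one_le less_imp_le[OF frac_lt_1])
    finally have "norm (u - x) \<le> (\<Sum>b\<in>B. norm b) + 1" by simp
    then show "\<exists>x\<in>L. norm (u - x) \<le> (\<Sum>b\<in>B. norm b) + 1" using xL by blast
    qed
  qed
qed

text \<open>By Cauchy-Schwarz the squares of the integer coordinates of \<open>x\<close> add up to
  at most \<open>Q\<close> times the squared length. So the Gaussian is dominated by a product of
  one-dimensional Gaussians, and each finite sum by a product of one-dimensional sums.\<close>

lemma gaussian_summable:
  fixes c :: real assumes c: "c > 0"
  shows "(\<lambda>x. exp (- c * (norm x)\<^sup>2)) summable_on L"
proof -
  obtain B \<beta> where B: "finite B" "B \<subseteq> L" "\<forall>b\<in>B. \<beta> b \<in> L"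
    "\<forall>u. (\<Sum>b\<in>B. (\<beta> b \<bullet> u) *\<^sub>R b) = u" by (rule coordinates)
  define Q where "Q = (\<Sum>b\<in>B. (norm (\<beta> b))\<^sup>2) + 1"
  have Q: "Q > 0" unfolding Q_def by (simp add: add_nonneg_pos sum_nonneg)
  define a where "a = c / Q"
  have a: "a > 0" using c Q by (simp add: a_def)
  define m where "m = (\<lambda>x. \<lambda>b\<in>B. \<lfloor>\<beta> b \<bullet> x\<rfloor>)"
  have m: "of_int (m x b) = \<beta> b \<bullet> x" if "x \<in> L" "b \<in> B" for x b
    using that B(3) inner_int by (auto simp: m_def)
  have inj: "inj_on m L"
  proof (rule inj_onI)
    fix x y assume xy: "x \<in> L" "y \<in> L" "m x = m y"
    then have "\<beta> b \<bullet> x = \<beta> b \<bullet> y" if "b \<in> B" for b using m that by metis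
    then show "x = y" using B(4)[rule_format, of x] B(4)[rule_format, of y] by (metis (no_types, lifting) sum.cong)
  qed
  define S where "S = 2 / (1 - exp (- a))"
  have le: "exp (- c * (norm x)\<^sup>2) \<le> (\<Prod>b\<in>B. exp (- a * (of_int (m x b))\<^sup>2))" if "x \<in> L" for x
  proof -
    have "(\<Sum>b\<in>B. (\<beta> b \<bullet> x)\<^sup>2) \<le> (\<Sum>b\<in>B. (norm (\<beta> b))\<^sup>2 * (norm x)\<^sup>2)"
      by (intro sum_mono) (metis Cauchy_Schwarz_ineq2 power_mult_distrib abs_ge_zero power2_abs power_mono)
    also have "\<dots> \<le> Q * (norm x)\<^sup>2"
      by (simp add: Q_def algebra_simps flip: sum_distrib_left)
    finally have "a * (\<Sum>b\<in>B. (\<beta> b \<bullet> x)\<^sup>2) \<le> c * (norm x)\<^sup>2"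
      using a Q by (simp add: a_def field_simps)
    then show ?thesis
      using m that by (simp add: exp_sum[OF B(1), symmetric] sum_negf flip: sum_distrib_left)
  qed
  have "(\<Sum>x\<in>F. exp (- c * (norm x)\<^sup>2)) \<le> S ^ card B" if F: "finite F" "F \<subseteq> L" for F
  proof -
    define K where "K = (\<Sum>x\<in>F. \<Sum>b\<in>B. \<bar>m x b\<bar>)"
    have K: "m x b \<in> {-K..K}" if "x \<in> F" "b \<in> B" for x b
    proof -
      have "\<bar>m x b\<bar> \<le> (\<Sum>b\<in>B. \<bar>m x b\<bar>)" using that B(1) by (intro member_le_sum) auto
      also have "\<dots> \<le> K" unfolding K_def using that F(1)
        by (intro member_le_sum[of x F "\<lambda>x. \<Sum>b\<in>B. \<bar>m x b\<bar>"]) (auto intro: sum_nonneg)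
      finally show ?thesis by (auto simp: abs_le_iff)
    qed
    have "(\<Sum>x\<in>F. exp (- c * (norm x)\<^sup>2)) \<le> (\<Sum>x\<in>F. \<Prod>b\<in>B. exp (- a * (of_int (m x b))\<^sup>2))"
      using F le by (intro sum_mono) auto
    also have "\<dots> = (\<Sum>\<mu>\<in>m ` F. \<Prod>b\<in>B. exp (- a * (of_int (\<mu> b))\<^sup>2))"
      using F inj by (subst sum.reindex) (auto intro: inj_on_subset)
    also have "\<dots> \<le> (\<Sum>\<mu>\<in>B \<rightarrow>\<^sub>E {-K..K}. \<Prod>b\<in>B. exp (- a * (of_int (\<mu> b))\<^sup>2))"
    proof (rule sum_mono2)
      show "finite (B \<rightarrow>\<^sub>E {-K..K})" using B(1) by (intro finite_PiE) auto
      show "m ` F \<subseteq> B \<rightarrow>\<^sub>E {-K..K}" using K by (auto simp: m_def)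
    qed (auto intro: prod_nonneg)
    also have "\<dots> = (\<Prod>b\<in>B. \<Sum>k\<in>{-K..K}. exp (- a * (of_int k)\<^sup>2))"
      using B(1) by (subst prod_sum_PiE) auto
    also have "\<dots> \<le> (\<Prod>b\<in>B. S)"
      unfolding S_def using sum_exp_int_square_le[OF a]
      by (intro prod_mono) (auto intro: sum_nonneg)
    also have "\<dots> = S ^ card B" by simp
    finally show ?thesis .
  qed
  then show ?thesis
    by (intro nonneg_bounded_partial_sums_imp_summable_on[where C = "S ^ card B"])
       (auto intro!: eventually_finite_subsets_at_top_weakI)
qed

end

lemma gaussian_shift_le:
  fixes x u :: "'a::real_inner"
  assumes "c \<ge> 0"
  shows "exp (- c * (norm (x + u))\<^sup>2) \<le> exp (c * (norm u)\<^sup>2) * exp (- (c / 2) * (norm x)\<^sup>2)"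
proof -
  have "(norm x)\<^sup>2 \<le> 2 * (norm (x + u))\<^sup>2 + 2 * (norm u)\<^sup>2"
  proof -
    \<comment> \<open>Expanded, this square is exactly the right side minus the left side of the
      claim.\<close>
    have "0 \<le> (norm (x + 2 *\<^sub>R u))\<^sup>2" by simp
    then show ?thesis
      by (simp add: power2_norm_eq_inner inner_add_left inner_add_right inner_commute algebra_simps)
  qed
  then have "c * (norm x)\<^sup>2 \<le> c * (2 * (norm (x + u))\<^sup>2 + 2 * (norm u)\<^sup>2)"
    using assms by (rule mult_left_mono)
  then show ?thesis
    by (simp add: algebra_simps flip: exp_add)
qed

lemma lborel_integral_translate:
  fixes f :: "'a::euclidean_space \<Rightarrow> 'b::{banach, second_countable_topology}"
  assumes "f \<in> borel_measurable borel"
  shows "(LINT u|lborel. f (c + u)) = (LINT u|lborel. f u)"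
proof -
  have "(LINT u|lborel. f u) = (LINT u|distr lborel borel ((+) c). f u)"
    by (simp only: lborel_distr_plus)
  also have "\<dots> = (LINT u|lborel. f (c + u))"
    using assms by (subst integral_distr) auto
  finally show ?thesis ..
qed

section \<open>Characters, and integration over the torus by a partition of unity\<close>

definition character :: "'a::real_inner \<Rightarrow> 'a \<Rightarrow> complex" where
  "character y u = cis (2 * pi * (y \<bullet> u))"

lemma character_add_left: "character (y + z) u = character y u * character z u"
  by (simp add: character_def inner_add_left distrib_left cis_mult)

lemma character_add_right: "character y (u + v) = character y u * character y v"
  by (simp add: character_def inner_add_right distrib_left cis_mult)

lemma character_0 [simp]: "character 0 u = 1" "character y 0 = 1"
  by (simp_all add: character_def)

lemma character_uminus: "character (- y) u = cnj (character y u)" "character y (- u) = cnj (character y u)"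
  by (simp_all add: character_def cis_cnj)

lemma norm_character [simp]: "norm (character y u) = 1"
  by (simp add: character_def)

lemma continuous_on_character [continuous_intros]:
  "continuous_on A f \<Longrightarrow> continuous_on A (\<lambda>u. character y (f u))"
  unfolding character_def cis_conv_exp by (intro continuous_intros)

context self_dual_lattice
begin

lemma character_eq_1: "x \<in> L \<Longrightarrow> y \<in> L \<Longrightarrow> character y x = 1"
  using inner_int[of y x] by (simp add: character_def)

lemma character_shift: "x \<in> L \<Longrightarrow> y \<in> L \<Longrightarrow> character y (x + u) = character y u"
  by (simp add: character_add_right character_eq_1)

definition gaussian_sum :: "real \<Rightarrow> real^'n \<Rightarrow> real" where
  "gaussian_sum c u = (\<Sum>\<^sub>\<infinity>x\<in>L. exp (- c * (norm (x + u))\<^sup>2))"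

lemma gaussian_shift_summable:
  assumes "c > 0" shows "(\<lambda>x. exp (- c * (norm (x + u))\<^sup>2)) summable_on L"
proof (rule summable_on_comparison_test)
  show "(\<lambda>x. exp (c * (norm u)\<^sup>2) * exp (- (c / 2) * (norm x)\<^sup>2)) summable_on L"
    using assms by (intro summable_on_cmult_right gaussian_summable) simp
qed (use assms gaussian_shift_le[of c _ u] in auto)

lemma gaussian_sum_cont:
  assumes "c > 0" shows "continuous_on UNIV (gaussian_sum c)"
  unfolding gaussian_sum_def[abs_def]
proof (rule continuous_on_infsum)
  fix r :: real assume r: "r > 0"
  have "norm (exp (- c * (norm (x + u))\<^sup>2)) \<le> exp (c * r\<^sup>2) * exp (- (c / 2) * (norm x)\<^sup>2)" if "norm u < r" for x u :: "real^'n"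
  proof -
    have "exp (c * (norm u)\<^sup>2) \<le> exp (c * r\<^sup>2)"
      using that assms r by (simp add: power_mono)
    then show ?thesis
      using assms gaussian_shift_le[of c x u]
      by (smt (verit) exp_ge_zero mult_right_mono real_norm_def abs_exp_cancel)
  qed
  moreover have "(\<lambda>x. exp (c * r\<^sup>2) * exp (- (c / 2) * (norm x)\<^sup>2)) summable_on L"
    using assms by (intro summable_on_cmult_right gaussian_summable) simp
  ultimately show "\<exists>M. M summable_on L \<and> (\<forall>x\<in>L. \<forall>u. norm u < r \<longrightarrow> norm (exp (- c * (norm (x + u))\<^sup>2)) \<le> M x)"
    by blast
qed (intro continuous_intros)

lemma gaussian_sum_periodic: "y \<in> L \<Longrightarrow> gaussian_sum c (y + u) = gaussian_sum c u"
  unfolding gaussian_sum_def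
  using infsum_reindex_bij_betw[OF translate_image, of y "\<lambda>x. exp (- c * (norm (x + u))\<^sup>2)"]
  by (simp add: add.assoc)

lemma gaussian_sum_ge:
  assumes "c > 0" shows "exp (- c * (norm u)\<^sup>2) \<le> gaussian_sum c u"
  using finite_sum_le_infsum[OF gaussian_shift_summable[OF assms, of u], of "{0}"]
  by (simp add: gaussian_sum_def)

lemma gaussian_sum_pos: "c > 0 \<Longrightarrow> gaussian_sum c u > 0"
  using gaussian_sum_ge[of c u] by (meson exp_gt_zero less_le_trans)

lemma periodic_bounded:
  fixes f :: "real^'n \<Rightarrow> 'a::real_normed_vector"
  assumes cont: "continuous_on UNIV f" and per: "\<And>x u. x \<in> L \<Longrightarrow> f (x + u) = f u"
  obtains u0 v0 where "\<And>u. norm (f u) \<le> norm (f u0)" "\<And>u. norm (f u) \<ge> norm (f v0)"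
proof -
  obtain R where R: "R > 0" "\<forall>u. \<exists>x\<in>L. norm (u - x) \<le> R" by (rule covering_radius)
  have c: "compact (cball (0::real^'n) R)" "cball (0::real^'n) R \<noteq> {}" using R by auto
  have cn: "continuous_on (cball 0 R) (\<lambda>u. norm (f u))"
    by (intro continuous_intros continuous_on_subset[OF cont]) auto
  obtain u0 v0 where u0: "\<And>u. u \<in> cball 0 R \<Longrightarrow> norm (f u) \<le> norm (f u0)"
    and v0: "\<And>u. u \<in> cball 0 R \<Longrightarrow> norm (f u) \<ge> norm (f v0)"
    using continuous_attains_sup[OF c cn] continuous_attains_inf[OF c cn] by blast
  have *: "\<exists>v\<in>cball 0 R. f u = f v" for u
  proof -
    from R(2)[rule_format, of u] obtain x where x: "x \<in> L" "norm (u - x) \<le> R" by blast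
    then show ?thesis using per[OF x(1), of "u - x"] by (intro bexI[of _ "u - x"]) auto
  qed
  show ?thesis
    using u0 v0 * that[of u0 v0] by metis
qed

text \<open>A smooth substitute for the indicator function of a fundamental domain: its lattice
  translates add up to 1. Integrating a periodic function against it over the whole space is
  integration over the torus.\<close>

definition weight :: "real \<Rightarrow> real^'n \<Rightarrow> real" where
  "weight c u = exp (- c * (norm u)\<^sup>2) / gaussian_sum c u"

lemma weight_pos: "c > 0 \<Longrightarrow> weight c u > 0"
  by (simp add: weight_def gaussian_sum_pos)

lemma weight_cont: "c > 0 \<Longrightarrow> continuous_on UNIV (weight c)"
  unfolding weight_def[abs_def] using gaussian_sum_pos[of c]
  by (intro continuous_intros gaussian_sum_cont) (auto simp: less_imp_neq[symmetric])

lemma weight_has_sum: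
  assumes "c > 0"
  shows "((\<lambda>x. weight c (x + u)) has_sum 1) L" "((\<lambda>x. weight c (u - x)) has_sum 1) L"
proof -
  have 1: "((\<lambda>x. weight c (x + u)) has_sum 1) L" for u
  proof -
    have "((\<lambda>x. exp (- c * (norm (x + u))\<^sup>2)) has_sum gaussian_sum c u) L"
      unfolding gaussian_sum_def using gaussian_shift_summable[OF assms] by simp
    then have "((\<lambda>x. exp (- c * (norm (x + u))\<^sup>2) * (1 / gaussian_sum c u)) has_sum (gaussian_sum c u * (1 / gaussian_sum c u))) L"
      by (rule has_sum_cmult_left)
    also have "gaussian_sum c u * (1 / gaussian_sum c u) = 1"
      using gaussian_sum_pos[OF assms, of u] by simp
    finally show ?thesis
      by (rule has_sum_cong[THEN iffD1, rotated]) (simp add: weight_def gaussian_sum_periodic)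
  qed
  then show "((\<lambda>x. weight c (x + u)) has_sum 1) L" .
  have "bij_betw uminus L L"
    by (rule bij_betwI[where g = uminus]) (auto simp: uminus_mem)
  from has_sum_reindex_bij_betw[OF this, of "\<lambda>x. weight c (x + u)"] 1
  show "((\<lambda>x. weight c (u - x)) has_sum 1) L" by simp
qed

lemma weight_sum_le:
  assumes "c > 0" "finite I" "I \<subseteq> L"
  shows "(\<Sum>x\<in>I. weight c (x + u)) \<le> 1" "(\<Sum>x\<in>I. weight c (u - x)) \<le> 1"
  by (rule finite_sum_le_has_sum[OF weight_has_sum(1)[OF assms(1)] assms(2,3)] finite_sum_le_has_sum[OF weight_has_sum(2)[OF assms(1)] assms(2,3)];
      intro less_imp_le weight_pos assms(1))+

lemma weight_integrable:
  assumes c: "c > 0" shows "integrable lborel (weight c)"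
proof -
  obtain v0 where v0: "\<And>u. norm (gaussian_sum c u) \<ge> norm (gaussian_sum c v0)"
    using periodic_bounded[OF gaussian_sum_cont[OF c] gaussian_sum_periodic] by metis
  have v: "gaussian_sum c u \<ge> gaussian_sum c v0" for u
    using v0[of u] gaussian_sum_pos[OF c] by (simp add: abs_of_pos)
  have "integrable lborel (\<lambda>u::real^'n. norm (exp (- pi * (norm u)\<^sup>2 / (pi / c)) *\<^sub>R cis (- 2 * pi * (0 \<bullet> u))))"
    using c by (intro integrable_norm integral_gaussian_character) simp
  then have i: "integrable lborel (\<lambda>u::real^'n. exp (- c * (norm u)\<^sup>2) / gaussian_sum c v0)"
    using c by (simp add: mult.commute)
  show ?thesis
  proof (rule Bochner_Integration.integrable_bound[OF i])
    show "weight c \<in> borel_measurable lborel"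
      using weight_cont[OF c] by (simp add: borel_measurable_continuous_onI)
    show "AE u in lborel. norm (weight c u) \<le> norm (exp (- c * (norm u)\<^sup>2) / gaussian_sum c v0)"
      using v gaussian_sum_pos[OF c]
      by (intro AE_I2) (auto simp: weight_def abs_of_pos intro!: divide_left_mono)
  qed
qed

lemma weight_integrable_mult:
  fixes f :: "real^'n \<Rightarrow> complex"
  assumes c: "c > 0" and f: "continuous_on UNIV f" "\<And>u. norm (f u) \<le> K"
  shows "integrable lborel (\<lambda>u. weight c u *\<^sub>R f u)"
proof (rule Bochner_Integration.integrable_bound[of _ "\<lambda>u. K * weight c u"])
  show "integrable lborel (\<lambda>u. K * weight c u)"
    using weight_integrable[OF c] by simp
  show "(\<lambda>u. weight c u *\<^sub>R f u) \<in> borel_measurable lborel"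
    using f weight_cont[OF c] by (auto intro!: borel_measurable_continuous_onI continuous_intros)
  have "K \<ge> 0" using f(2)[of 0] norm_ge_zero order_trans by blast
  then show "AE u in lborel. norm (weight c u *\<^sub>R f u) \<le> norm (K * weight c u)"
  proof (intro AE_I2)
    fix u
    have "norm (f u) * weight c u \<le> K * weight c u"
      by (intro mult_right_mono f less_imp_le weight_pos c)
    also have "\<dots> \<le> \<bar>K * weight c u\<bar>" by simp
    finally show "norm (weight c u *\<^sub>R f u) \<le> norm (K * weight c u)"
      using weight_pos[OF c, of u] by (simp add: mult.commute)
  qed
qed

text \<open>Unfolding: the torus integral of a character is the same for any two partitions of
  unity. The sum over translates of the second weight is inserted as a factor 1, each term is
  translated back by its lattice vector, which the character does not notice, and then the
  translates of the first weight are summed. The cases used are a shift by \<tau> and a change of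
  \<open>c\<close>.\<close>

lemma integral_weight_translate:
  assumes c: "c > 0" and c': "c' > 0" and v: "v \<in> L"
  shows "(LINT u|lborel. weight c (u - \<tau>) *\<^sub>R character v u) = (LINT u|lborel. weight c' u *\<^sub>R character v u)"
proof -
  note [continuous_intros] = continuous_on_compose2[OF weight_cont[OF c] _ subset_UNIV]
    continuous_on_compose2[OF weight_cont[OF c'] _ subset_UNIV]
  have meas: "g \<in> borel_measurable lborel" if "continuous_on UNIV g" for g :: "real^'n \<Rightarrow> complex"
    using that by (simp add: borel_measurable_continuous_onI)
  define f where "f = (\<lambda>x u. (weight c (u - \<tau>) * weight c' (x + u)) *\<^sub>R character v u)"
  define h where "h = (\<lambda>x u. (weight c' u * weight c (u - \<tau> - x)) *\<^sub>R character v u)"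
  have int_shift: "integrable lborel (\<lambda>u. weight c (u - \<tau>))"
    using integrable_distr[of "(+) (- \<tau>)" lborel borel "weight c"] weight_integrable[OF c]
    by (simp add: lborel_distr_plus)
  have fs: "((\<lambda>x. LINT u|lborel. f x u) has_sum (LINT u|lborel. (\<Sum>\<^sub>\<infinity>x\<in>L. f x u))) L"
  proof (rule integral_infsum_dominated[OF countable_lattice _ int_shift])
    show "f x \<in> borel_measurable lborel" for x
      unfolding f_def by (intro meas continuous_intros)
    show "(\<Sum>x\<in>J. norm (f x u)) \<le> weight c (u - \<tau>)" if "finite J" "J \<subseteq> L" for J u
      using weight_sum_le(1)[OF c' that, of u] weight_pos[OF c] weight_pos[OF c']
      by (simp add: f_def abs_mult abs_of_pos mult_left_le less_imp_le flip: sum_distrib_left)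
  qed
  have fs': "(\<Sum>\<^sub>\<infinity>x\<in>L. f x u) = weight c (u - \<tau>) *\<^sub>R character v u" for u
  proof -
    have "((\<lambda>x. (weight c (u - \<tau>) * weight c' (x + u)) *\<^sub>R character v u) has_sum (weight c (u - \<tau>) * 1) *\<^sub>R character v u) L"
      by (intro has_sum_bounded_linear[OF bounded_linear_scaleR_left] has_sum_cmult_right weight_has_sum c')
    then show ?thesis by (simp add: f_def infsumI)
  qed
  have "(\<lambda>x. LINT u|lborel. f x u) = (\<lambda>x. LINT u|lborel. f x (- x + u))"
    by (intro ext lborel_integral_translate[symmetric])
       (auto simp: f_def intro!: borel_measurable_continuous_onI continuous_intros)
  with fs[unfolded fs'] have 1: "((\<lambda>x. LINT u|lborel. f x (- x + u)) has_sum
      (LINT u|lborel. weight c (u - \<tau>) *\<^sub>R character v u)) L" by simp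
  have "f x (- x + u) = h x u" if "x \<in> L" for x u
    using character_shift[OF uminus_mem[OF that] v, of u]
    by (simp add: f_def h_def algebra_simps)
  then have 2: "((\<lambda>x. LINT u|lborel. h x u) has_sum (LINT u|lborel. weight c (u - \<tau>) *\<^sub>R character v u)) L"
    using 1 by (subst has_sum_cong[where g = "\<lambda>x. LINT u|lborel. f x (- x + u)"]) auto
  have hs: "((\<lambda>x. LINT u|lborel. h x u) has_sum (LINT u|lborel. (\<Sum>\<^sub>\<infinity>x\<in>L. h x u))) L"
  proof (rule integral_infsum_dominated[OF countable_lattice _ weight_integrable[OF c']])
    show "h x \<in> borel_measurable lborel" for x
      unfolding h_def by (intro meas continuous_intros)
    show "(\<Sum>x\<in>J. norm (h x u)) \<le> weight c' u" if "finite J" "J \<subseteq> L" for J u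
      using weight_sum_le(2)[OF c that, of "u - \<tau>"] weight_pos[OF c] weight_pos[OF c']
      by (simp add: h_def abs_mult abs_of_pos mult_left_le less_imp_le flip: sum_distrib_left)
  qed
  have hs': "(\<Sum>\<^sub>\<infinity>x\<in>L. h x u) = weight c' u *\<^sub>R character v u" for u
  proof -
    have "((\<lambda>x. (weight c' u * weight c (u - \<tau> - x)) *\<^sub>R character v u) has_sum (weight c' u * 1) *\<^sub>R character v u) L"
      by (intro has_sum_bounded_linear[OF bounded_linear_scaleR_left] has_sum_cmult_right weight_has_sum c)
    then show ?thesis by (simp add: h_def infsumI)
  qed
  from hs[unfolded hs'] 2 show ?thesis by (rule has_sum_unique[rotated])
qed

lemma integral_weight_character:
  assumes c: "c > 0" and v: "v \<in> L" "v \<noteq> 0"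
  shows "(LINT u|lborel. weight c u *\<^sub>R character v u) = 0"
proof -
  \<comment> \<open>Half a period in direction \<open>v\<close>: here
    \<open>v \<bullet> \<tau> = 1/2\<close>, so the shift changes the sign of the character.\<close>
  define \<tau> where "\<tau> = (1 / (2 * (norm v)\<^sup>2)) *\<^sub>R v"
  have e\<tau>: "character v \<tau> = -1"
    using v(2) by (simp add: character_def \<tau>_def power2_norm_eq_inner)
  note [continuous_intros] = continuous_on_compose2[OF weight_cont[OF c] _ subset_UNIV]
  have "(LINT u|lborel. weight c (u - \<tau>) *\<^sub>R character v u) = (LINT u|lborel. weight c u *\<^sub>R character v (\<tau> + u))"
    using lborel_integral_translate[of "\<lambda>u. weight c (u - \<tau>) *\<^sub>R character v u" \<tau>]
    by (simp add: borel_measurable_continuous_onI continuous_intros)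
  also have "\<dots> = - (LINT u|lborel. weight c u *\<^sub>R character v u)"
    by (simp add: character_add_right e\<tau>)
  finally show ?thesis
    using integral_weight_translate[OF c c v(1), of \<tau>] by simp
qed

lemma integral_weight_indep:
  assumes "c > 0" "c' > 0"
  shows "(LINT u|lborel. weight c u) = (LINT u|lborel. weight c' u)"
  using integral_weight_translate[OF assms zero_mem, of 0]
  by (simp add: scaleR_conv_of_real)

end

section \<open>Uniqueness of Fourier coefficients on the torus\<close>

lemma one_minus_cos_small_imp_near_int:
  fixes r \<eta> :: real
  assumes "0 < \<eta>" "\<eta> \<le> 1/2" "1 - cos (2 * pi * r) < 1 - cos (2 * pi * \<eta>)"
  shows "\<bar>r - of_int (round r)\<bar> < \<eta>"
proof (rule ccontr)
  define d where "d = \<bar>r - of_int (round r)\<bar>"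
  assume "\<not> ?thesis"
  then have "\<eta> \<le> d" by (simp add: d_def)
  moreover have "d \<le> 1/2" using of_int_round_abs_le[of r] by (simp add: d_def abs_minus_commute)
  ultimately have "cos (2 * pi * d) \<le> cos (2 * pi * \<eta>)"
    using assms by (intro cos_monotone_0_pi_le) auto
  moreover have "cos (2 * pi * d) = cos (2 * pi * (r - of_int (round r)))"
    using cos_abs_real[of "2 * pi * (r - of_int (round r))"] by (simp add: d_def abs_mult)
  moreover have "\<dots> = cos (2 * pi * r)"
    by (simp add: right_diff_distrib cos_diff)
  ultimately show False using assms(3) by simp
qed

context self_dual_lattice
begin

text \<open>A trigonometric polynomial \<open>T\<close> is built that exceeds 1 only near the
  lattice translates of \<open>u0\<close>, with its peak there. If all Fourier coefficients of
  \<open>D\<close> vanish, then \<open>D\<close> is orthogonal to every power of \<open>T\<close>;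
  but if \<open>D u0\<close> is nonzero, the peak makes these integrals grow geometrically while the
  remaining part stays bounded.\<close>

lemma periodic_eq_0:
  fixes D :: "real^'n \<Rightarrow> complex"
  assumes c: "c > 0" and cont: "continuous_on UNIV D" and per: "\<And>x u. x \<in> L \<Longrightarrow> D (x + u) = D u"
    and orth: "\<And>y. y \<in> L \<Longrightarrow> (LINT u|lborel. weight c u *\<^sub>R (D u * character y u)) = 0"
  shows "D u0 = 0"
proof (rule ccontr)
  assume D0: "D u0 \<noteq> 0"
  define D' where "D' = (\<lambda>u. D u / D u0)"
  have cont': "continuous_on UNIV D'" unfolding D'_def by (intro continuous_intros cont) (simp add: D0)
  have per': "D' (x + u) = D' u" if "x \<in> L" for x u using per[OF that] by (simp add: D'_def)
  obtain u1 where u1: "\<And>u. norm (D' u) \<le> norm (D' u1)"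
    using periodic_bounded[OF cont' per'] by metis
  define K where "K = norm (D' u1)"
  have K: "norm (D' u) \<le> K" for u using u1 by (simp add: K_def)
  obtain \<delta> where \<delta>: "\<delta> > 0" "\<And>u. norm (u - u0) < \<delta> \<Longrightarrow> norm (D' u - 1) < 1/2"
  proof -
    have "isCont D' u0" using cont' by (simp add: continuous_on_eq_continuous_at)
    then obtain \<delta> where "\<delta> > 0" "\<forall>u. dist u u0 < \<delta> \<longrightarrow> dist (D' u) (D' u0) < 1/2"
      unfolding continuous_at_eps_delta by (metis half_gt_zero zero_less_one)
    with D0 show ?thesis by (intro that[of \<delta>]) (auto simp: dist_norm D'_def)
  qed
  obtain B \<beta> where B: "finite B" "B \<subseteq> L" "\<forall>b\<in>B. \<beta> b \<in> L"
    "\<forall>u. (\<Sum>b\<in>B. (\<beta> b \<bullet> u) *\<^sub>R b) = u" by (rule coordinates)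
  define Q where "Q = (\<Sum>b\<in>B. norm b) + 1"
  have Q: "Q > 0" unfolding Q_def by (simp add: add_nonneg_pos sum_nonneg)
  define \<eta> where "\<eta> = min (1/2) (\<delta> / Q)"
  have \<eta>: "\<eta> > 0" "\<eta> \<le> 1/2" "\<eta> * Q \<le> \<delta>"
    using \<delta> Q by (auto simp: \<eta>_def field_simps min_def)
  define N where "N = real (card B) + 1"
  have N: "N > 0" by (simp add: N_def)
  \<comment> \<open>With this value \<open>T u > 1\<close> forces the sum of all
    \<open>1 - cos\<close> terms below \<open>1 - cos (2 * pi * \<eta>)\<close>, so every coordinate
    of \<open>u - u0\<close> lies within \<eta> of an integer. The choice of \<eta> then puts
    \<open>u\<close> within \<delta> of a lattice translate of \<open>u0\<close>.\<close>
  define \<epsilon> where "\<epsilon> = (1 - cos (2 * pi * \<eta>)) / N"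
  have "cos (2 * pi * \<eta>) < cos 0"
    using \<eta> by (intro cos_monotone_0_pi) auto
  then have \<epsilon>: "\<epsilon> > 0" using N by (simp add: \<epsilon>_def)
  define T where "T = (\<lambda>u. 1 + \<epsilon> - (1 / N) * (\<Sum>b\<in>B. 1 - cos (2 * pi * (\<beta> b \<bullet> (u - u0)))))"
  have T_cont: "continuous_on UNIV T"
    unfolding T_def by (intro continuous_intros)
  have T_le: "T u \<le> 1 + \<epsilon>" for u
    using N by (simp add: T_def sum_nonneg)
  have T_ge: "-1 \<le> T u" for u
  proof -
    have "(\<Sum>b\<in>B. 1 - cos (2 * pi * (\<beta> b \<bullet> (u - u0)))) \<le> (\<Sum>b\<in>B. 2)"
      by (intro sum_mono) (smt (verit) cos_ge_minus_one)
    then have "(1 / N) * (\<Sum>b\<in>B. 1 - cos (2 * pi * (\<beta> b \<bullet> (u - u0)))) \<le> 2"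
      using N by (simp add: field_simps N_def)
    then show ?thesis using \<epsilon> by (simp add: T_def)
  qed
  have far: "T u \<le> 1 \<or> Re (D' u) > 1/2" for u
  proof (rule disjCI)
    assume "\<not> Re (D' u) > 1/2"
    show "T u \<le> 1"
    proof (rule ccontr)
      assume "\<not> T u \<le> 1"
      then have lt: "(\<Sum>b\<in>B. 1 - cos (2 * pi * (\<beta> b \<bullet> (u - u0)))) < 1 - cos (2 * pi * \<eta>)"
      proof -
        have "(1 / N) * (\<Sum>b\<in>B. 1 - cos (2 * pi * (\<beta> b \<bullet> (u - u0)))) < (1 / N) * (1 - cos (2 * pi * \<eta>))"
          using \<open>\<not> T u \<le> 1\<close> by (simp add: T_def \<epsilon>_def)
        then show ?thesis using N by (subst (asm) mult_less_cancel_left_pos) auto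
      qed
      define r where "r = (\<lambda>b. \<beta> b \<bullet> (u - u0))"
      have near: "\<bar>r b - of_int (round (r b))\<bar> < \<eta>" if "b \<in> B" for b
      proof (rule one_minus_cos_small_imp_near_int[OF \<eta>(1,2)])
        have "1 - cos (2 * pi * r b) \<le> (\<Sum>b\<in>B. 1 - cos (2 * pi * r b))"
          using that B(1) by (intro member_le_sum) auto
        then show "1 - cos (2 * pi * r b) < 1 - cos (2 * pi * \<eta>)" using lt by (simp add: r_def)
      qed
      define x where "x = (\<Sum>b\<in>B. of_int (round (r b)) *\<^sub>R b)"
      have x: "x \<in> L" unfolding x_def using B(2) by (intro sum_mem int_scale_mem) auto
      have "u - u0 - x = (\<Sum>b\<in>B. (r b - of_int (round (r b))) *\<^sub>R b)"
        using B(4)[rule_format, of "u - u0"] by (simp add: x_def r_def scaleR_left_diff_distrib sum_subtractf)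
      then have "norm (u - u0 - x) \<le> (\<Sum>b\<in>B. norm ((r b - of_int (round (r b))) *\<^sub>R b))"
        by (simp only: norm_sum)
      also have "\<dots> \<le> (\<Sum>b\<in>B. \<eta> * norm b)"
        using near[THEN less_imp_le] by (intro sum_mono) (auto intro!: mult_right_mono)
      also have "\<dots> < \<eta> * Q" using \<eta>(1) by (simp add: Q_def distrib_left sum_distrib_left)
      finally have "norm ((- x + u) - u0) < \<delta>" using \<eta>(3) by (simp add: algebra_simps)
      then have "norm (D' (- x + u) - 1) < 1/2" by (rule \<delta>(2))
      then have "norm (D' u - 1) < 1/2" using per'[OF uminus_mem[OF x]] by simp
      then have "\<bar>Re (D' u) - 1\<bar> < 1/2" using abs_Re_le_cmod[of "D' u - 1"] by simp
      with \<open>\<not> Re (D' u) > 1/2\<close> show False by linarith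
    qed
  qed
  have Tk: "\<bar>T u\<bar> ^ k \<le> (1 + \<epsilon>) ^ k" for u k
    using T_le[of u] T_ge[of u] \<epsilon> by (intro power_mono) auto
  \<comment> \<open>Multiplying a character by \<open>T\<close> gives a combination of characters
    shifted by plus or minus \<open>\<beta> b\<close>, which stay in the lattice, so the induction
    runs over all characters at once.\<close>
  have orthT: "(LINT u|lborel. weight c u *\<^sub>R (D' u * of_real (T u) ^ k * character y u)) = 0"
    if "y \<in> L" for k y
    using that
  proof (induction k arbitrary: y)
    case 0
    have "(\<lambda>u. weight c u *\<^sub>R (D' u * character y u)) = (\<lambda>u. (weight c u *\<^sub>R (D u * character y u)) / D u0)"
      by (simp add: D'_def scaleR_conv_of_real)
    then show ?case using orth[OF 0] by simp
  next
    case (Suc k)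
    define g where "g = (\<lambda>z u. weight c u *\<^sub>R (D' u * of_real (T u) ^ k * character z u))"
    have gi: "integrable lborel (g z)" for z
      unfolding g_def
    proof (rule weight_integrable_mult[OF c, where K = "K * (1 + \<epsilon>) ^ k"])
      show "continuous_on UNIV (\<lambda>u. D' u * of_real (T u) ^ k * character z u)"
        by (intro continuous_intros cont' T_cont)
      show "norm (D' u * of_real (T u) ^ k * character z u) \<le> K * (1 + \<epsilon>) ^ k" for u
        using K Tk[of u k] order_trans[OF norm_ge_zero K]
        by (simp add: norm_mult norm_power mult_mono)
    qed
    have g0: "(LINT u|lborel. g z u) = 0" if "z \<in> L" for z
      using Suc.IH[OF that] by (simp add: g_def)
    have T: "of_real (T u) * character y u = of_real (1 + \<epsilon> - card B / N) * character y u +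
       of_real (1 / (2 * N)) * (\<Sum>b\<in>B. cnj (character (\<beta> b) u0) * character (y + \<beta> b) u +
           character (\<beta> b) u0 * character (y - \<beta> b) u)" for u
    proof -
      have cc: "complex_of_real (cos (2 * pi * (\<beta> b \<bullet> (u - u0)))) =
          (cnj (character (\<beta> b) u0) * character (\<beta> b) u + character (\<beta> b) u0 * cnj (character (\<beta> b) u)) / 2" for b
      proof -
        have "complex_of_real (cos x) = (cis x + cnj (cis x)) / 2" for x
          by (simp add: complex_eq_iff)
        moreover have "cis (2 * pi * (\<beta> b \<bullet> (u - u0))) = cnj (character (\<beta> b) u0) * character (\<beta> b) u"
          by (simp add: character_def cis_cnj inner_diff_right right_diff_distrib cis_mult)
        ultimately show ?thesis by simp
      qed
      have "of_real (T u) = of_real (1 + \<epsilon> - card B / N) +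
        of_real (1 / N) * (\<Sum>b\<in>B. complex_of_real (cos (2 * pi * (\<beta> b \<bullet> (u - u0)))))"
        by (simp add: T_def sum_subtractf right_diff_distrib)
      also have "\<dots> = of_real (1 + \<epsilon> - card B / N) +
        of_real (1 / (2 * N)) * (\<Sum>b\<in>B. cnj (character (\<beta> b) u0) * character (\<beta> b) u + character (\<beta> b) u0 * cnj (character (\<beta> b) u))"
        unfolding cc by (simp add: sum_distrib_left mult.commute)
      finally have "of_real (T u) * character y u = (of_real (1 + \<epsilon> - card B / N) +
        of_real (1 / (2 * N)) * (\<Sum>b\<in>B. cnj (character (\<beta> b) u0) * character (\<beta> b) u + character (\<beta> b) u0 * cnj (character (\<beta> b) u))) * character y u"
        by simp
      then show ?thesis
        unfolding diff_conv_add_uminus[of y] character_add_left character_uminus distrib_right mult.assoc sum_distrib_right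
        by (simp add: distrib_right mult_ac)
    qed
    have "weight c u *\<^sub>R (D' u * of_real (T u) ^ Suc k * character y u) =
       of_real (1 + \<epsilon> - card B / N) * g y u +
       of_real (1 / (2 * N)) * (\<Sum>b\<in>B. cnj (character (\<beta> b) u0) * g (y + \<beta> b) u +
           character (\<beta> b) u0 * g (y - \<beta> b) u)" for u
    proof -
      have "weight c u *\<^sub>R (D' u * of_real (T u) ^ Suc k * character y u) =
         (of_real (weight c u) * D' u * of_real (T u) ^ k) * (of_real (T u) * character y u)"
        by (simp add: scaleR_conv_of_real mult_ac)
      then show ?thesis unfolding T
        by (simp add: g_def scaleR_conv_of_real distrib_left sum_distrib_left mult_ac)
    qed
    then have "(LINT u|lborel. weight c u *\<^sub>R (D' u * of_real (T u) ^ Suc k * character y u)) =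
       (LINT u|lborel. of_real (1 + \<epsilon> - card B / N) * g y u +
       of_real (1 / (2 * N)) * (\<Sum>b\<in>B. cnj (character (\<beta> b) u0) * g (y + \<beta> b) u +
           character (\<beta> b) u0 * g (y - \<beta> b) u))" by simp
    also have "\<dots> = of_real (1 + \<epsilon> - card B / N) * (LINT u|lborel. g y u) +
       of_real (1 / (2 * N)) * (\<Sum>b\<in>B. cnj (character (\<beta> b) u0) * (LINT u|lborel. g (y + \<beta> b) u) +
           character (\<beta> b) u0 * (LINT u|lborel. g (y - \<beta> b) u))"
      using gi by (simp add: Bochner_Integration.integral_sum)
    also have "\<dots> = 0"
      using g0 Suc.prems B(3) by (simp add: add_mem diff_mem)
    finally show ?case .
  qed
  define W where "W = (LINT u|lborel. weight c u)"
  \<comment> \<open>Even powers are used so that \<open>T\<close> contributes with positive sign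
    also where it is negative.\<close>
  have int2: "integrable lborel (\<lambda>u. weight c u *\<^sub>R (D' u * of_real (T u) ^ (2 * k)))" for k
  proof (rule weight_integrable_mult[OF c, where K = "K * (1 + \<epsilon>) ^ (2 * k)"])
    show "continuous_on UNIV (\<lambda>u. D' u * of_real (T u) ^ (2 * k))"
      by (intro continuous_intros cont' T_cont)
    show "norm (D' u * of_real (T u) ^ (2 * k)) \<le> K * (1 + \<epsilon>) ^ (2 * k)" for u
      using K Tk[of u "2 * k"] order_trans[OF norm_ge_zero K]
      unfolding norm_mult norm_power norm_of_real by (intro mult_mono) auto
  qed
  have Re0: "(LINT u|lborel. weight c u * (Re (D' u) * T u ^ (2 * k))) = 0" for k
  proof -
    have "(LINT u|lborel. Re (weight c u *\<^sub>R (D' u * of_real (T u) ^ (2 * k)))) = Re (LINT u|lborel. weight c u *\<^sub>R (D' u * of_real (T u) ^ (2 * k)))"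
      by (rule integral_Re[OF int2])
    also have "\<dots> = 0" using orthT[OF zero_mem, of "2 * k"] by simp
    finally show ?thesis by (simp flip: of_real_power)
  qed
  obtain \<rho> where \<rho>: "\<rho> > 0" "\<And>u. norm (u - u0) < \<rho> \<Longrightarrow> T u \<ge> 1 + \<epsilon> / 2"
  proof -
    have T0: "T u0 = 1 + \<epsilon>" by (simp add: T_def)
    have "isCont T u0" using T_cont by (simp add: continuous_on_eq_continuous_at)
    then obtain \<rho> where "\<rho> > 0" "\<forall>u. dist u u0 < \<rho> \<longrightarrow> dist (T u) (T u0) < \<epsilon> / 2"
      unfolding continuous_at_eps_delta using \<epsilon> by (metis half_gt_zero)
    then show ?thesis
      by (intro that[of \<rho>]) (auto simp: dist_norm T0 abs_if split: if_splits)
  qed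
  have "compact (cball u0 \<rho>)" "cball u0 \<rho> \<noteq> {}" "continuous_on (cball u0 \<rho>) (weight c)"
    using \<rho>(1) continuous_on_subset[OF weight_cont[OF c]] by auto
  from continuous_attains_inf[OF this]
  obtain w where w: "\<And>u. u \<in> cball u0 \<rho> \<Longrightarrow> weight c w \<le> weight c u" by blast
  define p where "p = weight c w * measure lborel (ball u0 \<rho>)"
  have p: "p > 0" using weight_pos[OF c] content_ball_pos[OF \<rho>(1)] by (simp add: p_def)
  have bound: "p * (1 + \<epsilon> / 2) ^ (2 * k) \<le> (2 * K + 1) * W" for k
  proof -
    \<comment> \<open>A lower bound for the integrand: on the ball around \<open>u0\<close> the peak
      counts with at least half its size, and wherever the real part of \<open>D'\<close> is not
      above 1/2 the polynomial is at most 1 in modulus, which costs at most \<open>K + 1/2\<close>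
      times the weight.\<close>
    define G where "G = (\<lambda>u. (1/2) * (weight c w * (1 + \<epsilon> / 2) ^ (2 * k)) * indicator (ball u0 \<rho>) u - (K + 1/2) * weight c u)"
    have iG: "integrable lborel G"
      unfolding G_def using emeasure_lborel_ball_finite[of u0 \<rho>] weight_integrable[OF c]
      by (intro Bochner_Integration.integrable_diff) (auto simp: top_unique)
    have iH: "integrable lborel (\<lambda>u. weight c u * (Re (D' u) * T u ^ (2 * k)))"
      using integrable_Re[OF int2] by (simp flip: of_real_power)
    have "G u \<le> weight c u * (Re (D' u) * T u ^ (2 * k))" for u
    proof -
      have T0: "T u ^ (2 * k) \<ge> 0" by simp
      have "(1/2) * T u ^ (2 * k) - (K + 1/2) \<le> Re (D' u) * T u ^ (2 * k)"
      proof (cases "Re (D' u) > 1/2")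
        case True
        then have "(1/2) * T u ^ (2 * k) \<le> Re (D' u) * T u ^ (2 * k)"
          using T0 by (intro mult_right_mono) auto
        moreover have "K \<ge> 0" using order_trans[OF norm_ge_zero K] .
        ultimately show ?thesis by linarith
      next
        case False
        then have "T u \<le> 1" using far by blast
        then have "\<bar>T u\<bar> ^ (2 * k) \<le> 1" using T_ge[of u] by (intro power_le_one) auto
        then have t1: "T u ^ (2 * k) \<le> 1" by (simp add: power_even_abs)
        have "\<bar>Re (D' u) * T u ^ (2 * k)\<bar> \<le> K * 1"
          unfolding abs_mult using T0 t1 order_trans[OF abs_Re_le_cmod K] order_trans[OF norm_ge_zero K]
          by (intro mult_mono) auto
        then show ?thesis using t1 by linarith
      qed
      then have "weight c u * ((1/2) * T u ^ (2 * k) - (K + 1/2)) \<le> weight c u * (Re (D' u) * T u ^ (2 * k))"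
        by (rule mult_left_mono[OF _ less_imp_le[OF weight_pos[OF c]]])
      moreover have "weight c w * (1 + \<epsilon> / 2) ^ (2 * k) * indicator (ball u0 \<rho>) u \<le> weight c u * T u ^ (2 * k)"
      proof (cases "u \<in> ball u0 \<rho>")
        case True
        then have "weight c w \<le> weight c u" "1 + \<epsilon> / 2 \<le> T u"
          using w \<rho>(2) by (auto simp: dist_norm norm_minus_commute)
        then show ?thesis using True \<epsilon> weight_pos[OF c]
          by (simp add: mult_mono power_mono less_imp_le)
      next
        case False
        then show ?thesis using T0 weight_pos[OF c] by (simp add: less_imp_le)
      qed
      ultimately show ?thesis by (simp add: G_def algebra_simps)
    qed
    then have "integral\<^sup>L lborel G \<le> (LINT u|lborel. weight c u * (Re (D' u) * T u ^ (2 * k)))"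
      by (intro integral_mono iG iH)
    then have "integral\<^sup>L lborel G \<le> 0" by (simp add: Re0)
    moreover have "integral\<^sup>L lborel G = (1/2) * (weight c w * (1 + \<epsilon> / 2) ^ (2 * k)) * measure lborel (ball u0 \<rho>) - (K + 1/2) * W"
      unfolding G_def W_def using emeasure_lborel_ball_finite[of u0 \<rho>] weight_integrable[OF c]
      by (subst Bochner_Integration.integral_diff) (auto simp: top_unique)
    ultimately show ?thesis by (simp add: p_def algebra_simps)
  qed
  have "(1 + \<epsilon> / 2)\<^sup>2 > 1" using \<epsilon> by (intro one_less_power) auto
  from real_arch_pow[OF this, of "(2 * K + 1) * W / p"] obtain k where "(2 * K + 1) * W / p < (1 + \<epsilon> / 2) ^ (2 * k)"
    by (auto simp: power_mult)
  then have "(2 * K + 1) * W < p * (1 + \<epsilon> / 2) ^ (2 * k)" using p by (simp add: field_simps)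
  with bound[of k] show False by simp
qed

end

section \<open>Poisson summation for Gaussians\<close>

context self_dual_lattice
begin

lemma theta_coeff_summable:
  assumes "t > 0"
  shows "(\<lambda>y. exp (- pi * t * (norm y)\<^sup>2)) summable_on L"
  using gaussian_summable[of "pi * t"] assms by simp

text \<open>Both sides are continuous and periodic, so it is enough to compare Fourier coefficients.
  \<open>W\<close> is the volume of the torus, here still unknown; fixing the parameter 1 in its
  definition makes it visibly independent of \<open>t\<close>.\<close>

lemma poisson_gaussian_aux:
  assumes t: "t > 0"
  defines "W \<equiv> (LINT u|lborel. weight 1 u)"
  shows "W > 0"
    and "of_real (gaussian_sum (pi / t) u) =
     of_real (sqrt t ^ CARD('n) / W) * (\<Sum>\<^sub>\<infinity>y\<in>L. exp (- pi * t * (norm y)\<^sup>2) *\<^sub>R character y u)"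
proof -
  define c where "c = pi / t"
  have c: "c > 0" using t by (simp add: c_def)
  have W: "W = (LINT u|lborel. weight c u)" unfolding W_def using c by (intro integral_weight_indep) auto
  show Wpos: "W > 0"
  proof -
    have "W \<noteq> 0"
    proof
      assume "W = 0"
      then have "AE u in lborel. weight c u = 0"
        unfolding W using weight_integrable[OF c] weight_pos[OF c]
        by (subst (asm) integral_nonneg_eq_0_iff_AE) (auto intro: less_imp_le)
      then have "AE u in (lborel :: (real^'n) measure). False"
        by eventually_elim (use weight_pos[OF c] in \<open>metis less_irrefl\<close>)
      then show False by (simp add: ae_filter_eq_bot_iff flip: trivial_limit_def)
    qed
    moreover have "W \<ge> 0" unfolding W using weight_pos[OF c] by (intro Bochner_Integration.integral_nonneg) (simp add: less_imp_le)
    ultimately show ?thesis by simp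
  qed
  define a where "a = (\<lambda>y::real^'n. sqrt t ^ CARD('n) / W * exp (- pi * t * (norm y)\<^sup>2))"
  have a_nonneg: "a y \<ge> 0" for y using t Wpos by (simp add: a_def)
  have a_sum: "a summable_on L"
    unfolding a_def by (intro summable_on_cmult_right theta_coeff_summable t)
  define H where "H = (\<lambda>u. \<Sum>\<^sub>\<infinity>y\<in>L. a y *\<^sub>R character y u)"
  have H_cont: "continuous_on UNIV H"
    unfolding H_def using a_sum a_nonneg
    by (intro continuous_on_infsum continuous_intros) auto
  have H_per: "H (x + u) = H u" if "x \<in> L" for x u
    unfolding H_def using that by (intro infsum_cong) (simp add: character_shift)
  define D where "D = (\<lambda>u. of_real (gaussian_sum c u) - H u)"
  note [continuous_intros] = continuous_on_compose2[OF weight_cont[OF c] _ subset_UNIV]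
  have "D u = 0"
  proof (rule periodic_eq_0[OF c])
    show D_cont: "continuous_on UNIV D"
      unfolding D_def by (intro continuous_intros H_cont gaussian_sum_cont c)
    show "D (x + u) = D u" if "x \<in> L" for x u
      using that by (simp add: D_def H_per gaussian_sum_periodic)
    fix z assume z: "z \<in> L"
    define y where "y = - z"
    have y: "y \<in> L" "z = - y" using z by (auto simp: y_def uminus_mem)
    \<comment> \<open>The weight has the same parameter as the Gaussian sum, so the sum cancels
      against its denominator and leaves one Gaussian on the whole space, whose Fourier integral is
      known.\<close>
    have eF: "weight c u *\<^sub>R (of_real (gaussian_sum c u) * character z u) =
       exp (- pi * (norm u)\<^sup>2 / t) *\<^sub>R cis (- 2 * pi * (y \<bullet> u))" for u
      using gaussian_sum_pos[OF c, of u]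
      by (simp add: weight_def y(2) character_def scaleR_conv_of_real) (simp add: c_def mult.commute)
    have iF: "integrable lborel (\<lambda>u. weight c u *\<^sub>R (of_real (gaussian_sum c u) * character z u))"
      "(LINT u|lborel. weight c u *\<^sub>R (of_real (gaussian_sum c u) * character z u)) = of_real (W * a y)"
      unfolding eF using integral_gaussian_character[OF t, of y] Wpos by (simp_all add: a_def)
    define f where "f = (\<lambda>x u. weight c u *\<^sub>R (a x *\<^sub>R (character x u * character z u)))"
    define S where "S = (\<Sum>\<^sub>\<infinity>y\<in>L. a y)"
    have S: "(a has_sum S) L" using a_sum by (simp add: S_def)
    have fs: "((\<lambda>x. LINT u|lborel. f x u) has_sum (LINT u|lborel. (\<Sum>\<^sub>\<infinity>x\<in>L. f x u))) L"
    proof (rule integral_infsum_dominated[OF countable_lattice])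
      show "integrable lborel (\<lambda>u. S * weight c u)" using weight_integrable[OF c] by simp
      show "f x \<in> borel_measurable lborel" for x
        unfolding f_def by (auto intro!: borel_measurable_continuous_onI continuous_intros)
      show "(\<Sum>x\<in>J. norm (f x u)) \<le> S * weight c u" if "finite J" "J \<subseteq> L" for J u
      proof -
        have "(\<Sum>x\<in>J. a x) \<le> S" using that a_nonneg by (intro finite_sum_le_has_sum[OF S]) auto
        then have "weight c u * (\<Sum>x\<in>J. a x) \<le> weight c u * S"
          by (rule mult_left_mono[OF _ less_imp_le[OF weight_pos[OF c]]])
        moreover have "(\<Sum>x\<in>J. norm (f x u)) = weight c u * (\<Sum>x\<in>J. a x)"
          unfolding sum_distrib_left using a_nonneg weight_pos[OF c, of u]
          by (intro sum.cong) (simp_all add: f_def norm_mult)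
        ultimately show ?thesis by (simp only: mult.commute[of S])
      qed
    qed
    have Hs: "((\<lambda>x. a x *\<^sub>R character x u) has_sum H u) L" for u
    proof -
      have "(\<lambda>x. a x *\<^sub>R character x u) summable_on L"
        by (rule abs_summable_summable, rule summable_on_comparison_test[OF a_sum]) (use a_nonneg in auto)
      then show ?thesis by (simp add: H_def)
    qed
    have fs': "(\<Sum>\<^sub>\<infinity>x\<in>L. f x u) = weight c u *\<^sub>R (H u * character z u)" for u
    proof -
      have "((\<lambda>x. weight c u *\<^sub>R (a x *\<^sub>R character x u * character z u)) has_sum weight c u *\<^sub>R (H u * character z u)) L"
        by (intro has_sum_scaleR has_sum_cmult_left Hs)
      then show ?thesis by (simp add: f_def infsumI)
    qed
    have "(LINT u|lborel. f x u) = (if x = y then of_real (W * a y) else 0)" if x: "x \<in> L" for x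
    proof -
      have "(LINT u|lborel. f x u) = a x *\<^sub>R (LINT u|lborel. weight c u *\<^sub>R character (x - y) u)"
        unfolding integral_scaleR_right[symmetric]
        by (rule arg_cong[where f = "integral\<^sup>L lborel"])
           (auto simp: f_def y(2) diff_conv_add_uminus character_add_left simp del: add_uminus_conv_diff)
      also have "\<dots> = (if x = y then of_real (W * a y) else 0)"
        using integral_weight_character[OF c diff_mem[OF x y(1)]]
        by (auto simp: W scaleR_conv_of_real)
      finally show ?thesis .
    qed
    then have "((\<lambda>x. LINT u|lborel. f x u) has_sum of_real (W * a y)) L"
      using has_sum_finite_neutralI[of "{y}" L "\<lambda>x. LINT u|lborel. f x u" "of_real (W * a y)"] y(1) by auto
    with fs[unfolded fs'] have iH: "(LINT u|lborel. weight c u *\<^sub>R (H u * character z u)) = of_real (W * a y)"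
      by (rule has_sum_unique)
    have H_bound: "norm (H u) \<le> S" for u
      by (rule norm_infsum_le[OF Hs S]) (use a_nonneg in auto)
    have "integrable lborel (\<lambda>u. weight c u *\<^sub>R (H u * character z u))"
      by (rule weight_integrable_mult[OF c, where K = S])
         (use H_bound in \<open>auto simp: norm_mult intro!: continuous_intros H_cont\<close>)
    then show "(LINT u|lborel. weight c u *\<^sub>R (D u * character z u)) = 0"
      using iF iH by (simp add: D_def left_diff_distrib scaleR_right_diff_distrib)
  qed
  moreover have "H u = of_real (sqrt t ^ CARD('n) / W) * (\<Sum>\<^sub>\<infinity>y\<in>L. exp (- pi * t * (norm y)\<^sup>2) *\<^sub>R character y u)"
    unfolding H_def a_def infsum_cmult_right'[symmetric]
    by (intro infsum_cong) (simp add: scaleR_conv_of_real)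
  ultimately show "of_real (gaussian_sum (pi / t) u) =
     of_real (sqrt t ^ CARD('n) / W) * (\<Sum>\<^sub>\<infinity>y\<in>L. exp (- pi * t * (norm y)\<^sup>2) *\<^sub>R character y u)"
    by (simp add: D_def c_def)
qed

text \<open>The volume comes without determinants: at \<open>t = 1\<close>, \<open>u = 0\<close>
  both sides are the same positive theta value up to the factor 1 / W, so W = 1.\<close>

theorem poisson_gaussian:
  assumes t: "t > 0"
  shows "of_real (gaussian_sum (pi / t) u) =
     of_real (sqrt t ^ CARD('n)) * (\<Sum>\<^sub>\<infinity>y\<in>L. exp (- pi * t * (norm y)\<^sup>2) *\<^sub>R character y u)"
proof -
  define W where "W = (LINT u|lborel. weight 1 u)"
  have 1: "(\<Sum>\<^sub>\<infinity>y\<in>L. exp (- pi * 1 * (norm y)\<^sup>2) *\<^sub>R character y 0) = of_real (gaussian_sum (pi / 1) 0)"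
    using has_sum_bounded_linear[OF bounded_linear_of_real[where 'a = complex] has_sum_infsum[OF theta_coeff_summable[of 1]]]
    by (simp add: gaussian_sum_def scaleR_conv_of_real infsumI)
  have "complex_of_real (gaussian_sum (pi / 1) 0) =
      of_real (1 / W) * (\<Sum>\<^sub>\<infinity>y\<in>L. exp (- pi * 1 * (norm y)\<^sup>2) *\<^sub>R character y 0)"
    using poisson_gaussian_aux(2)[of 1 0, folded W_def] by simp
  then have "complex_of_real (gaussian_sum (pi / 1) 0) = of_real (1 / W * gaussian_sum (pi / 1) 0)"
    unfolding 1 of_real_mult .
  then have "gaussian_sum (pi / 1) 0 = 1 / W * gaussian_sum (pi / 1) 0"
    by (simp only: of_real_eq_iff)
  moreover have "gaussian_sum (pi / 1) 0 > 0" by (intro gaussian_sum_pos) simp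
  ultimately have "W = 1" by (cases "W = 0") (auto simp: field_simps)
  then show ?thesis using poisson_gaussian_aux(2)[OF t, of u] by (simp add: W_def)
qed

end

section \<open>Cusp forms vanishing to second order\<close>

lemma powser_eq_0_imp_coeff_eq_0:
  fixes a :: "nat \<Rightarrow> complex"
  assumes "r > 0" "\<And>z. norm z < r \<Longrightarrow> (\<lambda>n. a n * z ^ n) sums 0"
  shows "a m = 0"
proof (cases "m = 0")
  case True
  have "(\<lambda>n. a n * 0 ^ n) sums 0" using assms(1) by (intro assms(2)) simp
  then show ?thesis using True sums_unique2 powser_sums_zero by blast
next
  case False
  show ?thesis
  proof (rule ccontr)
    assume "a m \<noteq> 0"
    from powser_0_nonzero[of r 0 a "\<lambda>_. 0" m] this False assms
    obtain s where s: "s > 0" "\<And>z. z \<in> cball 0 s - {0::complex} \<Longrightarrow> (0::complex) \<noteq> 0" by auto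
    from s(2)[of "of_real s"] s(1) show False by simp
  qed
qed

lemma exp_2pi_i_Im: "norm (exp (2 * pi * \<i> * z)) = exp (- 2 * pi * Im z)"
  by simp

lemma exp_2pi_i_shift: "exp (2 * pi * \<i> * (z - of_int n)) = exp (2 * pi * \<i> * z)"
proof -
  have "exp (2 * pi * \<i> * (z - of_int n)) = exp (2 * pi * \<i> * z) / exp (2 * of_int n * pi * \<i>)"
    by (simp add: right_diff_distrib exp_diff mult_ac)
  then show ?thesis using exp_integer_2pi[of "of_int n"] by simp
qed

text \<open>Siegel's argument: every point of the upper half plane is equivalent under \<open>z \<mapsto> z + 1\<close>
  and \<open>z \<mapsto> -1/z\<close> to one of height at least \<open>4/5\<close>, and for weight at most \<open>18\<close> the maximum
  principle for \<open>f / q\<^sup>2\<close> on the horocycle of height \<open>3/4\<close> gains a factor less than \<open>1\<close>.\<close>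

lemma modular_vanishing:
  fixes A :: "nat \<Rightarrow> complex" and P :: "complex \<Rightarrow> complex"
  assumes ser: "\<And>w. norm w < 1 \<Longrightarrow> (\<lambda>n. A n * w ^ n) sums P w"
    and A01: "A 0 = 0" "A 1 = 0" and k: "k \<le> 18"
    and S: "\<And>z. Im z > 0 \<Longrightarrow>
      P (exp (2 * pi * \<i> * (- 1 / z))) = z ^ k * P (exp (2 * pi * \<i> * z))"
  shows "A m = 0"
proof -
  \<comment> \<open>The squared Petersson norm of the form, invariant under both generators; the
    square keeps the exponent of \<open>Im z\<close> an integer.\<close>
  define h where "h = (\<lambda>z. (norm (P (exp (2 * pi * \<i> * z))))\<^sup>2 * Im z ^ k)"
  have h_shift: "h (z - of_int n) = h z" for z n
    unfolding h_def exp_2pi_i_shift by simp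
  have Im_S: "Im (- 1 / z) = Im z / (norm z)\<^sup>2" for z
    by (simp add: Im_divide cmod_def)
  have h_S: "h (- 1 / z) = h z" if "Im z > 0" for z
  proof -
    have "norm z \<noteq> 0" using that by auto
    then show ?thesis
      unfolding h_def S[OF that] Im_S
      by (simp add: norm_mult norm_power power_mult_distrib power_divide flip: power_mult)
         (simp add: mult.commute)
  qed
  have red: "\<exists>z'. Im z' \<ge> 4/5 \<and> h z' = h z" if "Im z \<ge> 4/5 * (9/10) ^ j" for z j
    using that
  proof (induction j arbitrary: z)
    case 0
    then show ?case by auto
  next
    case (Suc j)
    show ?case
    proof (cases "Im z \<ge> 4/5")
      case False
      define z1 where "z1 = z - of_int (round (Re z))"
      have Im1: "Im z1 = Im z" by (simp add: z1_def)
      have pos: "Im z > 0" using Suc.prems by (smt (verit) zero_less_power mult_pos_pos divide_pos_pos)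
      have "\<bar>Re z1\<bar> \<le> 1/2" using of_int_round_abs_le[of "Re z"] by (simp add: z1_def abs_minus_commute)
      then have "(Re z1)\<^sup>2 \<le> (1/2)\<^sup>2" by (metis abs_le_square_iff abs_of_nonneg zero_le_divide_1_iff zero_le_numeral)
      moreover have "(Im z1)\<^sup>2 \<le> (4/5)\<^sup>2" using False pos Im1 by (intro power_mono) auto
      \<comment> \<open>Since 1/4 + 16/25 < 9/10, the inversion multiplies the height by at least
        10/9 as long as it is below 4/5.\<close>
      ultimately have n: "(norm z1)\<^sup>2 \<le> 9/10" by (simp add: cmod_power2 power_divide)
      have n0: "(norm z1)\<^sup>2 > 0" using pos Im1 by auto
      have "(norm z1)\<^sup>2 * (4/5 * (9/10) ^ j) \<le> 9/10 * (4/5 * (9/10) ^ j)"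
        using n by (intro mult_right_mono) auto
      also have "\<dots> \<le> Im z1" using Suc.prems Im1 by simp
      finally have "Im (- 1 / z1) \<ge> 4/5 * (9/10) ^ j"
        unfolding Im_S using n0 by (simp add: pos_le_divide_eq mult.commute)
      from Suc.IH[OF this] obtain z' where "Im z' \<ge> 4/5" "h z' = h (- 1 / z1)" by blast
      then show ?thesis
        using h_S[of z1] h_shift[of z] pos Im1 by (auto simp: z1_def)
    qed auto
  qed
  have reduce: "\<exists>z'. Im z' \<ge> 4/5 \<and> h z' = h z" if "Im z > 0" for z
  proof -
    have "Im z * (5/4) > 0" "(9/10::real) < 1" using that by simp_all
    from real_arch_pow_inv[OF this] obtain j where "(9/10::real) ^ j < Im z * (5/4)" by blast
    then show ?thesis by (intro red[of j]) simp
  qed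
  define R where "R = (\<lambda>w. \<Sum>n. A (n + 2) * w ^ n)"
  have R: "(\<lambda>n. A (n + 2) * w ^ n) sums R w" "P w = w\<^sup>2 * R w" if w: "norm w < 1" for w
  proof -
    have "(\<lambda>n. A (n + 2) * w ^ (n + 2)) sums P w"
      using sums_split_initial_segment[OF ser[OF w], of 2] A01 by (simp add: eval_nat_numeral)
    then have s: "(\<lambda>n. w\<^sup>2 * (A (n + 2) * w ^ n)) sums P w" by (simp add: power_add mult_ac power2_eq_square)
    show 1: "(\<lambda>n. A (n + 2) * w ^ n) sums R w"
    proof (cases "w = 0")
      case True
      then show ?thesis
        using powser_sums_zero[of "\<lambda>n. A (n + 2)"] by (simp add: R_def sums_iff)
    next
      case False
      then have "summable (\<lambda>n. A (n + 2) * w ^ n)"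
        using sums_summable[OF s] by (subst (asm) summable_cmult_iff) auto
      then show ?thesis unfolding R_def by (rule summable_sums)
    qed
    show "P w = w\<^sup>2 * R w"
      using sums_unique2[OF s sums_mult[OF 1, of "w\<^sup>2"]] by simp
  qed
  have R_holo: "R holomorphic_on ball 0 1"
    by (rule power_series_holomorphic[where a = "\<lambda>n. A (n + 2)"]) (use R(1) in auto)
  \<comment> \<open>The modulus of \<open>q\<close> on the horocycle of height 3/4.\<close>
  define r where "r = exp (- 2 * pi * (3/4))"
  have r: "0 < r" "r < 1" by (simp_all add: r_def)
  have "compact (sphere 0 r :: complex set)" "sphere 0 r \<noteq> ({} :: complex set)"
    "continuous_on (sphere 0 r) (\<lambda>w. norm (R w))"
    using r by (auto intro!: continuous_intros continuous_on_subset[OF holomorphic_on_imp_continuous_on[OF R_holo]])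
  from continuous_attains_sup[OF this] obtain w1 where
    w1: "norm w1 = r" "\<And>w. norm w = r \<Longrightarrow> norm (R w) \<le> norm (R w1)" by (auto simp: dist_norm)
  have max: "norm (R w) \<le> norm (R w1)" if "norm w \<le> r" for w
  proof (rule maximum_modulus_frontier[of R "cball 0 r"])
    show "R holomorphic_on interior (cball 0 r)"
      using r by (intro holomorphic_on_subset[OF R_holo]) auto
    show "continuous_on (closure (cball 0 r)) R"
      using r by (intro continuous_on_subset[OF holomorphic_on_imp_continuous_on[OF R_holo]]) auto
  qed (use that w1 in \<open>auto simp: frontier_cball sphere_def\<close>)
  define z1 where "z1 = - \<i> / (2 * pi) * Ln w1"
  have "w1 \<noteq> 0" using w1(1) r by auto
  then have ez1: "exp (2 * pi * \<i> * z1) = w1" by (simp add: z1_def)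
  have Im1: "Im z1 = 3/4"
  proof -
    have "exp (- 2 * pi * Im z1) = exp (- 2 * pi * (3/4))"
      using w1(1) exp_2pi_i_Im[of z1] unfolding ez1 r_def by simp
    then show ?thesis by simp
  qed
  \<comment> \<open>From height 3/4 up to \<open>y\<close>, the factor |q^2|^2 contributes exp (- 8
    pi (y - 3/4)), and \<open>y ^ k\<close> grows by at most exp (24 (y - 3/4)) because 18 * 4/3 =
    24. The net exponent is negative since pi > 3, and y - 3/4 \<ge> 1/20.\<close>
  have decay: "h z \<le> exp (- (8 * pi - 24) / 20) * h z1" if z: "Im z \<ge> 4/5" for z
  proof -
    define w where "w = exp (2 * pi * \<i> * z)"
    define y where "y = Im z"
    have nw: "norm w = exp (- 2 * pi * y)" unfolding w_def y_def by (rule exp_2pi_i_Im)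
    have y: "y \<ge> 4/5" using z by (simp add: y_def)
    have wr: "norm w \<le> r" unfolding nw r_def using y by simp
    have "norm (P w) = (norm w)\<^sup>2 * norm (R w)"
      using R(2)[of w] wr r by (simp add: norm_mult norm_power)
    also have "\<dots> \<le> (norm w)\<^sup>2 * norm (R w1)"
      using max[OF wr] by (intro mult_left_mono) auto
    also have "\<dots> = ((norm w)\<^sup>2 / r\<^sup>2) * norm (P w1)"
      using R(2)[of w1] w1(1) r by (simp add: norm_mult norm_power)
    finally have "(norm (P w))\<^sup>2 \<le> (((norm w)\<^sup>2 / r\<^sup>2) * norm (P w1))\<^sup>2"
      by (intro power_mono) auto
    also have "\<dots> = exp (- 8 * pi * (y - 3/4)) * (norm (P w1))\<^sup>2"
    proof -
      have "((norm w)\<^sup>2 / r\<^sup>2)\<^sup>2 = exp (- 8 * pi * (y - 3/4))"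
        unfolding nw r_def by (simp add: power_divide exp_diff[symmetric] algebra_simps flip: exp_of_nat_mult)
      then show ?thesis by (simp only: power_mult_distrib)
    qed
    finally have P: "(norm (P w))\<^sup>2 \<le> exp (- 8 * pi * (y - 3/4)) * (norm (P w1))\<^sup>2" .
    have "y / (3/4) \<le> exp ((y - 3/4) / (3/4))"
    proof -
      have "y / (3/4) = 1 + (y - 3/4) / (3/4)" by (simp add: field_simps)
      then show ?thesis by (simp only: exp_ge_add_one_self)
    qed
    then have "(y / (3/4)) ^ k \<le> exp ((y - 3/4) / (3/4)) ^ k"
      using y by (intro power_mono) auto
    also have "\<dots> = exp (k * ((y - 3/4) / (3/4)))" by (simp only: exp_of_nat_mult)
    also have "\<dots> \<le> exp (24 * (y - 3/4))"
    proof -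
      have "real k * ((y - 3/4) / (3/4)) \<le> 18 * ((y - 3/4) / (3/4))"
        using k y by (intro mult_right_mono) auto
      then show ?thesis by simp
    qed
    finally have "y ^ k \<le> exp (24 * (y - 3/4)) * (3/4) ^ k"
      by (simp add: power_divide field_simps)
    then have "(norm (P w))\<^sup>2 * y ^ k \<le> (exp (- 8 * pi * (y - 3/4)) * (norm (P w1))\<^sup>2) * (exp (24 * (y - 3/4)) * (3/4) ^ k)"
      using P y by (intro mult_mono) auto
    also have "\<dots> = exp (- (8 * pi - 24) * (y - 3/4)) * h z1"
      unfolding h_def ez1 Im1 by (simp add: algebra_simps flip: exp_add)
    also have "\<dots> \<le> exp (- (8 * pi - 24) / 20) * h z1"
    proof (rule mult_right_mono)
      have "(8 * pi - 24) * (1 / 20) \<le> (8 * pi - 24) * (y - 3/4)"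
        using y pi_gt3 by (intro mult_left_mono) auto
      then show "exp (- (8 * pi - 24) * (y - 3/4)) \<le> exp (- (8 * pi - 24) / 20)"
        unfolding exp_le_cancel_iff by linarith
    qed (simp add: h_def Im1)
    finally show ?thesis by (simp add: h_def w_def y_def)
  qed
  \<comment> \<open>The maximum point \<open>z1\<close> is itself equivalent to a point of height at
    least 4/5, so \<open>decay\<close> bounds \<open>h z1\<close> by a proper fraction of
    itself.\<close>
  obtain z' where z': "Im z' \<ge> 4/5" "h z' = h z1" using reduce[of z1] Im1 by auto
  have "exp (- (8 * pi - 24) / 20) < 1" using pi_gt3 by simp
  moreover have "h z1 \<ge> 0" by (simp add: h_def Im1)
  ultimately have "h z1 = 0" using decay[OF z'(1)] z'(2)
    by (smt (verit) mult_less_cancel_right2)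
  then have "R w1 = 0" using R(2)[of w1] w1 r ez1 Im1 \<open>w1 \<noteq> 0\<close> by (simp add: h_def)
  then have "R w = 0" if "norm w < r" for w using max[of w] that by simp
  then have "A (n + 2) = 0" for n
    using powser_eq_0_imp_coeff_eq_0[OF r(1), of "\<lambda>n. A (n + 2)"] R(1) r by (metis order_less_trans)
  moreover have "m = 0 \<or> m = 1 \<or> m = (m - 2) + 2" by arith
  ultimately show ?thesis using A01 by metis
qed

section \<open>Theta series with isotropic coefficients\<close>

lemma power_le_fact_exp:
  fixes r :: real assumes "r \<ge> 0"
  shows "r ^ k \<le> fact k * exp r"
proof -
  have "r ^ k /\<^sub>R fact k \<le> (\<Sum>n. r ^ n /\<^sub>R fact n)"
    using sum_le_suminf[OF summable_exp_generic[of r], of "{k}"] assms by simp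
  then show ?thesis
    by (simp add: exp_def divide_simps divide_inverse[symmetric] mult.commute)
qed

lemma norm_Complex_inner_le:
  fixes p q x :: "'a::real_inner"
  shows "norm (Complex (p \<bullet> x) (q \<bullet> x)) \<le> (norm p + norm q) * norm x"
proof -
  have "norm (Complex (p \<bullet> x) (q \<bullet> x)) \<le> \<bar>p \<bullet> x\<bar> + \<bar>q \<bullet> x\<bar>"
    using cmod_le[of "Complex (p \<bullet> x) (q \<bullet> x)"] by simp
  also have "\<dots> \<le> norm p * norm x + norm q * norm x" by (intro add_mono Cauchy_Schwarz_ineq2)
  finally show ?thesis by (simp add: distrib_right)
qed

lemma moment_summable:
  fixes c l :: "'i \<Rightarrow> complex"
  assumes "\<And>R::real. (\<lambda>i. norm (c i) * exp (R * norm (l i))) summable_on A"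
  shows "(\<lambda>i. c i * l i ^ k) summable_on A"
proof (rule abs_summable_summable, rule summable_on_comparison_test)
  show "(\<lambda>i. (norm (c i) * exp (1 * norm (l i))) * fact k) summable_on A"
    by (intro summable_on_cmult_left assms)
  show "norm (c i * l i ^ k) \<le> (norm (c i) * exp (1 * norm (l i))) * fact k" for i
  proof -
    have "norm (l i) ^ k \<le> exp (norm (l i)) * fact k"
      using power_le_fact_exp[of "norm (l i)" k] by (simp add: mult.commute)
    then show ?thesis
      by (simp add: norm_mult norm_power mult.assoc mult_left_mono)
  qed
qed auto

lemma exp_sum_summable:
  fixes c l :: "'i \<Rightarrow> complex"
  assumes "\<And>R::real. (\<lambda>i. norm (c i) * exp (R * norm (l i))) summable_on A"
  shows "(\<lambda>i. c i * exp (z * l i)) summable_on A"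
proof (rule abs_summable_summable, rule summable_on_comparison_test)
  show "(\<lambda>i. norm (c i) * exp (norm z * norm (l i))) summable_on A" by (rule assms)
  show "norm (c i * exp (z * l i)) \<le> norm (c i) * exp (norm z * norm (l i))" for i
    using complex_Re_le_cmod[of "z * l i"] by (simp add: norm_mult mult_left_mono)
qed auto

text \<open>Expanding each exponential and interchanging the sums, which converge absolutely
  together because all exponential moments do.\<close>

lemma exp_moment_sums:
  fixes c l :: "'i \<Rightarrow> complex"
  assumes summ: "\<And>R::real. (\<lambda>i. norm (c i) * exp (R * norm (l i))) summable_on A"
  shows "(\<lambda>k. (\<Sum>\<^sub>\<infinity>i\<in>A. c i * l i ^ k) / fact k * z ^ k) sums (\<Sum>\<^sub>\<infinity>i\<in>A. c i * exp (z * l i))"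
proof -
  define F where "F = (\<lambda>(i, k). c i * ((z * l i) ^ k /\<^sub>R fact k))"
  have "(\<lambda>p. norm (F p)) summable_on (A \<times> UNIV)"
  proof (rule summable_on_SigmaI)
    show "((\<lambda>k. norm (F (i, k))) has_sum norm (c i) * exp (norm z * norm (l i))) UNIV" for i
    proof -
      have "(\<lambda>k. norm (c i) * ((norm z * norm (l i)) ^ k /\<^sub>R fact k)) sums (norm (c i) * exp (norm z * norm (l i)))"
        by (intro sums_mult exp_converges)
      then show ?thesis
        by (intro sums_nonneg_imp_has_sum) (simp_all add: F_def norm_mult norm_power mult_ac)
    qed
    show "(\<lambda>i. norm (c i) * exp (norm z * norm (l i))) summable_on A" by (rule summ)
  qed auto
  then have abs: "F summable_on (A \<times> UNIV)" by (rule abs_summable_summable)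
  then obtain S where S: "(F has_sum S) (A \<times> UNIV)" by (auto simp: summable_on_def)
  have inner: "((\<lambda>k. F (i, k)) has_sum c i * exp (z * l i)) UNIV" for i
  proof (rule norm_summable_imp_has_sum)
    have "(\<lambda>k. c i * ((z * l i) ^ k /\<^sub>R fact k)) sums (c i * exp (z * l i))"
      by (intro sums_mult exp_converges)
    then show "(\<lambda>k. F (i, k)) sums (c i * exp (z * l i))" by (simp add: F_def)
    have "summable (\<lambda>k. norm (c i) * norm ((z * l i) ^ k /\<^sub>R fact k))"
      by (intro summable_mult summable_norm_exp)
    then show "summable (\<lambda>k. norm (F (i, k)))" by (simp only: F_def prod.case norm_mult)
  qed
  have "((\<lambda>i. c i * exp (z * l i)) has_sum S) A"
    by (rule has_sum_SigmaD[OF S]) (use inner in auto)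
  then have S_eq: "S = (\<Sum>\<^sub>\<infinity>i\<in>A. c i * exp (z * l i))" by (simp add: infsumI)
  have "((\<lambda>(k, i). F (i, k)) has_sum S) (UNIV \<times> A)"
    using S by (subst (asm) has_sum_swap)
  then have "((\<lambda>k. (\<Sum>\<^sub>\<infinity>i\<in>A. c i * l i ^ k) / fact k * z ^ k) has_sum S) UNIV"
  proof (rule has_sum_SigmaD)
    fix k
    have "((\<lambda>i. c i * l i ^ k * (z ^ k / fact k)) has_sum (\<Sum>\<^sub>\<infinity>i\<in>A. c i * l i ^ k) * (z ^ k / fact k)) A"
      using moment_summable[OF summ] by (intro has_sum_cmult_left has_sum_infsum)
    then show "((\<lambda>i. (\<lambda>(k, i). F (i, k)) (k, i)) has_sum (\<Sum>\<^sub>\<infinity>i\<in>A. c i * l i ^ k) / fact k * z ^ k) A"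
      by (simp add: F_def power_mult_distrib scaleR_conv_of_real field_simps)
  qed
  then show ?thesis unfolding S_eq by (rule has_sum_imp_sums)
qed

lemma exp_sum_holomorphic:
  fixes c l :: "'i \<Rightarrow> complex"
  assumes summ: "\<And>R::real. (\<lambda>i. norm (c i) * exp (R * norm (l i))) summable_on A"
  shows "(\<lambda>z. \<Sum>\<^sub>\<infinity>i\<in>A. c i * exp (z * l i)) holomorphic_on UNIV"
proof -
  define f where "f = (\<lambda>z. \<Sum>\<^sub>\<infinity>i\<in>A. c i * exp (z * l i))"
  have "f holomorphic_on ball 0 r" for r
    unfolding f_def
    by (rule power_series_holomorphic[where a = "\<lambda>k. (\<Sum>\<^sub>\<infinity>i\<in>A. c i * l i ^ k) / fact k"])
       (use exp_moment_sums[OF summ] in simp)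
  then have "f field_differentiable at z" for z
    by (rule holomorphic_on_imp_differentiable_at[of _ "ball 0 (norm z + 1)"]) auto
  then show ?thesis
    unfolding f_def[symmetric] by (simp add: holomorphic_on_def field_differentiable_at_within)
qed

lemma entire_eq_0_on_reals:
  assumes "f holomorphic_on UNIV" "\<And>x::real. f (of_real x) = 0"
  shows "f z = 0"
proof (rule analytic_continuation[OF assms(1), of "range of_real" 0])
  show "(0::complex) islimpt range of_real"
    unfolding islimpt_approachable
  proof (intro allI impI)
    fix e :: real assume "e > 0"
    then show "\<exists>x'\<in>range of_real. x' \<noteq> (0::complex) \<and> dist x' 0 < e"
      by (intro bexI[of _ "of_real (e/2)"] rangeI) (auto simp: norm_divide)
  qed
qed (use assms in auto)

text \<open>This takes the place of differentiating \<open>k\<close> times under the sum: both sides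
  are entire, they agree on the real line, hence their Taylor coefficients agree.\<close>

lemma exp_sum_eq_imp_moments_eq:
  fixes c l c' l' :: "'i \<Rightarrow> complex"
  assumes summ: "\<And>R::real. (\<lambda>i. norm (c i) * exp (R * norm (l i))) summable_on A"
    and summ': "\<And>R::real. (\<lambda>i. norm (c' i) * exp (R * norm (l' i))) summable_on A"
    and eq: "\<And>x::real. (\<Sum>\<^sub>\<infinity>i\<in>A. c i * exp (x * l i)) = (\<Sum>\<^sub>\<infinity>i\<in>A. c' i * exp (x * l' i))"
  shows "(\<Sum>\<^sub>\<infinity>i\<in>A. c i * l i ^ k) = (\<Sum>\<^sub>\<infinity>i\<in>A. c' i * l' i ^ k)"
proof -
  have "(\<Sum>\<^sub>\<infinity>i\<in>A. c i * exp (z * l i)) - (\<Sum>\<^sub>\<infinity>i\<in>A. c' i * exp (z * l' i)) = 0" for z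
    by (rule entire_eq_0_on_reals[where f = "\<lambda>z. (\<Sum>\<^sub>\<infinity>i\<in>A. c i * exp (z * l i)) - (\<Sum>\<^sub>\<infinity>i\<in>A. c' i * exp (z * l' i))"])
       (use eq in \<open>auto intro!: holomorphic_intros exp_sum_holomorphic summ summ'\<close>)
  then have "(\<lambda>k. ((\<Sum>\<^sub>\<infinity>i\<in>A. c i * l i ^ k) / fact k - (\<Sum>\<^sub>\<infinity>i\<in>A. c' i * l' i ^ k) / fact k) * z ^ k) sums 0" for z
    using sums_diff[OF exp_moment_sums[OF summ, of z] exp_moment_sums[OF summ', of z]]
    by (simp add: left_diff_distrib)
  from powser_eq_0_imp_coeff_eq_0[OF zero_less_one this, of k] show ?thesis by simp
qed

section \<open>Isotropic Poisson summation and the design property of the minimal vectors\<close>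

locale leech =
  fixes L :: "(real^24) set"
  assumes leech: "leech_lattice L"
begin

sublocale self_dual_lattice L
  using leech by unfold_locales (auto simp: leech_lattice_def unimodular_def)

lemma gaussian_exp_summable:
  assumes "c > 0"
  shows "(\<lambda>x. exp (- c * (norm x)\<^sup>2) * exp (R * norm x)) summable_on L"
proof (rule summable_on_comparison_test)
  show "(\<lambda>x. exp (R\<^sup>2 / (2 * c)) * exp (- (c / 2) * (norm x)\<^sup>2)) summable_on L"
    using assms by (intro summable_on_cmult_right gaussian_summable) simp
  show "exp (- c * (norm x)\<^sup>2) * exp (R * norm x) \<le> exp (R\<^sup>2 / (2 * c)) * exp (- (c / 2) * (norm x)\<^sup>2)" for x :: "real^24"
  proof -
    \<comment> \<open>Completing the square absorbs the linear exponent into half of the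
      Gaussian.\<close>
    have "0 \<le> (c * norm x - R)\<^sup>2 / (2 * c)" using assms by simp
    also have "\<dots> = R\<^sup>2 / (2 * c) + (c / 2) * (norm x)\<^sup>2 - R * norm x"
      using assms by (simp add: power2_diff field_simps power2_eq_square)
    finally show ?thesis by (simp flip: exp_add)
  qed
qed auto

text \<open>Poisson summation is applied at \<open>u = \<alpha> *\<^sub>R p + s *\<^sub>R q\<close>.
  Both sides are entire in \<open>s\<close>, and at \<open>s = \<i> * \<alpha>\<close> the vector
  \<open>u\<close> becomes \<alpha> times the isotropic vector p + iq. No term in \<alpha>^2
  survives there, so both sides are pure exponential generating functions in \<alpha> and their
  moments of order \<open>d\<close> agree.\<close>

lemma isotropic_poisson:
  fixes p q :: "real^24" and a :: "real^24 \<Rightarrow> complex"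
  assumes pq: "p \<bullet> q = 0" "norm p = norm q" and t: "t > 0"
  defines "a \<equiv> (\<lambda>x. Complex (p \<bullet> x) (q \<bullet> x))"
  shows "of_real (t ^ 12) * (\<Sum>\<^sub>\<infinity>x\<in>L. of_real (exp (- pi * t * (norm x)\<^sup>2)) * (2 * pi * \<i> * a x) ^ d) =
    (\<Sum>\<^sub>\<infinity>x\<in>L. of_real (exp (- pi / t * (norm x)\<^sup>2)) * (- (2 * pi / t) * a x) ^ d)"
proof -
  define c1 where "c1 = (\<lambda>\<alpha> x. of_real (exp (- pi * t * (norm x)\<^sup>2)) * exp (of_real \<alpha> * (2 * pi * \<i> * of_real (p \<bullet> x))))"
  define c2 where "c2 = (\<lambda>\<alpha> x. complex_of_real (exp (- pi / t * (norm (x + \<alpha> *\<^sub>R p))\<^sup>2)))"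
  define l1 where "l1 = (\<lambda>x. 2 * pi * \<i> * of_real (q \<bullet> x))"
  define l2 where "l2 = (\<lambda>x. - (2 * pi / t) * complex_of_real (q \<bullet> x))"
  have s1: "(\<lambda>x. norm (c1 \<alpha> x) * exp (R * norm (l1 x))) summable_on L" for R \<alpha> :: real
  proof (rule summable_on_comparison_test)
    show "(\<lambda>x. exp (- (pi * t) * (norm x)\<^sup>2) * exp ((\<bar>R\<bar> * 2 * pi * norm q) * norm x)) summable_on L"
      using t by (intro gaussian_exp_summable) simp
    show "norm (c1 \<alpha> x) * exp (R * norm (l1 x)) \<le> exp (- (pi * t) * (norm x)\<^sup>2) * exp ((\<bar>R\<bar> * 2 * pi * norm q) * norm x)" for x
    proof -
      have "R * norm (l1 x) \<le> \<bar>R\<bar> * (2 * pi * (norm q * norm x))"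
        using Cauchy_Schwarz_ineq2[of q x] by (intro mult_mono) (auto simp: l1_def norm_mult)
      then show ?thesis by (simp add: c1_def norm_mult mult.assoc)
    qed
  qed auto
  have s2: "(\<lambda>x. norm (c2 \<alpha> x) * exp (R * norm (l2 x))) summable_on L" for R \<alpha> :: real
  proof (rule summable_on_comparison_test)
    show "(\<lambda>x. exp (pi / t * (norm (\<alpha> *\<^sub>R p))\<^sup>2) * (exp (- (pi / t / 2) * (norm x)\<^sup>2) * exp ((\<bar>R\<bar> * (2 * pi / t) * norm q) * norm x))) summable_on L"
      using t by (intro summable_on_cmult_right gaussian_exp_summable) simp
    show "norm (c2 \<alpha> x) * exp (R * norm (l2 x)) \<le> exp (pi / t * (norm (\<alpha> *\<^sub>R p))\<^sup>2) * (exp (- (pi / t / 2) * (norm x)\<^sup>2) * exp ((\<bar>R\<bar> * (2 * pi / t) * norm q) * norm x))" for x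
    proof -
      have "norm (c2 \<alpha> x) \<le> exp (pi / t * (norm (\<alpha> *\<^sub>R p))\<^sup>2) * exp (- (pi / t / 2) * (norm x)\<^sup>2)"
        using gaussian_shift_le[of "pi / t" x "\<alpha> *\<^sub>R p"] t by (simp add: c2_def)
      moreover have "R * norm (l2 x) \<le> \<bar>R\<bar> * (2 * pi / t * (norm q * norm x))"
        using Cauchy_Schwarz_ineq2[of q x] t
        by (intro mult_mono) (auto simp: l2_def norm_mult norm_divide intro!: mult_left_mono divide_right_mono)
      then have "exp (R * norm (l2 x)) \<le> exp ((\<bar>R\<bar> * (2 * pi / t) * norm q) * norm x)"
        by (simp add: mult.assoc)
      ultimately have "norm (c2 \<alpha> x) * exp (R * norm (l2 x)) \<le>
         (exp (pi / t * (norm (\<alpha> *\<^sub>R p))\<^sup>2) * exp (- (pi / t / 2) * (norm x)\<^sup>2)) * exp ((\<bar>R\<bar> * (2 * pi / t) * norm q) * norm x)"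
        by (intro mult_mono) auto
      then show ?thesis by (simp only: mult.assoc)
    qed
  qed auto
  define \<Theta>1 where "\<Theta>1 = (\<lambda>\<alpha> z. \<Sum>\<^sub>\<infinity>x\<in>L. c1 \<alpha> x * exp (z * l1 x))"
  define \<Theta>2 where "\<Theta>2 = (\<lambda>\<alpha> z. \<Sum>\<^sub>\<infinity>x\<in>L. c2 \<alpha> x * exp (z * l2 x))"
  have hol: "\<Theta>1 \<alpha> holomorphic_on UNIV" "\<Theta>2 \<alpha> holomorphic_on UNIV" for \<alpha>
    unfolding \<Theta>1_def \<Theta>2_def by (rule exp_sum_holomorphic, rule s1, rule exp_sum_holomorphic, rule s2)
  have "of_real (t ^ 12) * \<Theta>1 \<alpha> z - exp (- of_real (pi / t * (norm q)\<^sup>2) * z\<^sup>2) * \<Theta>2 \<alpha> z = 0" for \<alpha> z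
  proof (rule entire_eq_0_on_reals[where f = "\<lambda>z. of_real (t ^ 12) * \<Theta>1 \<alpha> z - exp (- of_real (pi / t * (norm q)\<^sup>2) * z\<^sup>2) * \<Theta>2 \<alpha> z"])
    show "(\<lambda>z. of_real (t ^ 12) * \<Theta>1 \<alpha> z - exp (- of_real (pi / t * (norm q)\<^sup>2) * z\<^sup>2) * \<Theta>2 \<alpha> z) holomorphic_on UNIV"
      by (intro holomorphic_intros hol)
    fix s :: real
    define u where "u = \<alpha> *\<^sub>R p + s *\<^sub>R q"
    have nu: "(norm (x + u))\<^sup>2 = (norm (x + \<alpha> *\<^sub>R p))\<^sup>2 + 2 * s * (q \<bullet> x) + s\<^sup>2 * (norm q)\<^sup>2" for x
      unfolding power2_norm_eq_inner u_def using pq(1)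
      by (simp add: inner_add_left inner_add_right inner_commute algebra_simps power2_eq_square)
    have "of_real (gaussian_sum (pi / t) u) = exp (- of_real (pi / t * (norm q)\<^sup>2) * (of_real s)\<^sup>2) * \<Theta>2 \<alpha> (of_real s)"
    proof -
      have "complex_of_real (exp (- (pi / t) * (norm (x + u))\<^sup>2)) =
         exp (- of_real (pi / t * (norm q)\<^sup>2) * (of_real s)\<^sup>2) * (c2 \<alpha> x * exp (of_real s * l2 x))" for x
        unfolding nu c2_def l2_def
        by (simp add: exp_of_real[symmetric] distrib_left exp_add[symmetric] algebra_simps)
      then have "((\<lambda>x. complex_of_real (exp (- (pi / t) * (norm (x + u))\<^sup>2))) has_sum
          exp (- of_real (pi / t * (norm q)\<^sup>2) * (of_real s)\<^sup>2) * \<Theta>2 \<alpha> (of_real s)) L"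
        unfolding \<Theta>2_def
        by (simp only:) (intro has_sum_cmult_right has_sum_infsum exp_sum_summable s2)
      moreover have "((\<lambda>x. complex_of_real (exp (- (pi / t) * (norm (x + u))\<^sup>2))) has_sum of_real (gaussian_sum (pi / t) u)) L"
        unfolding gaussian_sum_def using gaussian_shift_summable[of "pi / t"] t
        by (intro has_sum_of_real has_sum_infsum) simp
      ultimately show ?thesis by (metis has_sum_unique)
    qed
    moreover have "of_real (gaussian_sum (pi / t) u) = of_real (t ^ 12) * \<Theta>1 \<alpha> (of_real s)"
    proof -
      have "sqrt t ^ CARD(24) = (sqrt t ^ 2) ^ 12" by (simp flip: power_mult)
      then have "sqrt t ^ CARD(24) = t ^ 12" using t by simp
      moreover have "exp (- pi * t * (norm x)\<^sup>2) *\<^sub>R character x u = c1 \<alpha> x * exp (of_real s * l1 x)" for x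
      proof -
        have "x \<bullet> u = \<alpha> * (p \<bullet> x) + s * (q \<bullet> x)"
          by (simp add: u_def inner_add_right inner_commute)
        then show ?thesis
          by (simp add: c1_def l1_def character_def cis_conv_exp scaleR_conv_of_real exp_add[symmetric] algebra_simps)
      qed
      ultimately show ?thesis unfolding poisson_gaussian[OF t] \<Theta>1_def by simp
    qed
    ultimately show "of_real (t ^ 12) * \<Theta>1 \<alpha> (of_real s) - exp (- of_real (pi / t * (norm q)\<^sup>2) * (of_real s)\<^sup>2) * \<Theta>2 \<alpha> (of_real s) = 0"
      by simp
  qed
  \<comment> \<open>The substitution \<open>s = \<i> * \<alpha>\<close>. The explicit factor becomes
    a growing exponential in \<alpha>^2, which cancels the one from \<open>c2\<close> because
    \<open>p\<close> and \<open>q\<close> have equal length.\<close>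
  then have key: "of_real (t ^ 12) * \<Theta>1 \<alpha> (\<i> * \<alpha>) = exp (- of_real (pi / t * (norm q)\<^sup>2) * (\<i> * \<alpha>)\<^sup>2) * \<Theta>2 \<alpha> (\<i> * \<alpha>)" for \<alpha> :: real
    by simp
  define e1 where "e1 = (\<lambda>x::real^24. of_real (t ^ 12) * complex_of_real (exp (- pi * t * (norm x)\<^sup>2)))"
  define e2 where "e2 = (\<lambda>x::real^24. complex_of_real (exp (- pi / t * (norm x)\<^sup>2)))"
  define m1 where "m1 = (\<lambda>x. 2 * pi * \<i> * a x)"
  define m2 where "m2 = (\<lambda>x. - (2 * pi / t) * a x)"
  have a: "a x = of_real (p \<bullet> x) + \<i> * of_real (q \<bullet> x)" for x
    by (simp add: a_def complex_eq_iff)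
  have norm_a: "norm (a x) \<le> (norm p + norm q) * norm x" for x
    unfolding a_def by (rule norm_Complex_inner_le)
  have gen: "(\<lambda>x. norm (of_real k * complex_of_real (exp (- c * (norm x)\<^sup>2))) * exp (R * norm (w * a x))) summable_on L"
    if c: "c > 0" for k c R :: real and w :: complex
  proof (rule summable_on_comparison_test)
    show "(\<lambda>x. \<bar>k\<bar> * (exp (- c * (norm x)\<^sup>2) * exp ((\<bar>R\<bar> * (norm w * (norm p + norm q))) * norm x))) summable_on L"
      using c by (intro summable_on_cmult_right gaussian_exp_summable)
    show "norm (of_real k * complex_of_real (exp (- c * (norm x)\<^sup>2))) * exp (R * norm (w * a x)) \<le>
        \<bar>k\<bar> * (exp (- c * (norm x)\<^sup>2) * exp ((\<bar>R\<bar> * (norm w * (norm p + norm q))) * norm x))" for x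
    proof -
      have "R * norm (w * a x) \<le> \<bar>R\<bar> * (norm w * ((norm p + norm q) * norm x))"
        unfolding norm_mult using norm_a[of x] by (intro mult_mono) auto
      then show ?thesis by (simp add: norm_mult mult.assoc mult_left_mono)
    qed
  qed auto
  have "(\<Sum>\<^sub>\<infinity>x\<in>L. e1 x * m1 x ^ d) = (\<Sum>\<^sub>\<infinity>x\<in>L. e2 x * m2 x ^ d)"
  proof (rule exp_sum_eq_imp_moments_eq)
    show "(\<lambda>x. norm (e1 x) * exp (R * norm (m1 x))) summable_on L" for R
      using gen[of "pi * t" "t ^ 12" R "2 * pi * \<i>"] t by (simp add: e1_def m1_def)
    show "(\<lambda>x. norm (e2 x) * exp (R * norm (m2 x))) summable_on L" for R
      using gen[of "pi / t" 1 R "- (2 * pi / t)"] t by (simp add: e2_def m2_def)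
    fix \<alpha> :: real
    have 1: "of_real (t ^ 12) * (c1 \<alpha> x * exp (\<i> * \<alpha> * l1 x)) = e1 x * exp (\<alpha> * m1 x)" for x
    proof -
      have "of_real \<alpha> * (2 * pi * \<i> * of_real (p \<bullet> x)) + \<i> * \<alpha> * l1 x = \<alpha> * m1 x"
        by (simp add: l1_def m1_def a algebra_simps)
      then show ?thesis
        by (simp add: c1_def e1_def mult.assoc flip: exp_add)
    qed
    have 2: "exp (- of_real (pi / t * (norm q)\<^sup>2) * (\<i> * \<alpha>)\<^sup>2) * (c2 \<alpha> x * exp (\<i> * \<alpha> * l2 x)) = e2 x * exp (\<alpha> * m2 x)" for x
    proof -
      have "(norm (x + \<alpha> *\<^sub>R p))\<^sup>2 = (norm x)\<^sup>2 + 2 * \<alpha> * (p \<bullet> x) + \<alpha>\<^sup>2 * (norm q)\<^sup>2"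
        unfolding pq(2)[symmetric] power2_norm_eq_inner
        by (simp add: inner_add_left inner_add_right inner_commute algebra_simps power2_eq_square)
      then have "- of_real (pi / t * (norm q)\<^sup>2) * (\<i> * \<alpha>)\<^sup>2 + (of_real (- pi / t * (norm (x + \<alpha> *\<^sub>R p))\<^sup>2) + \<i> * \<alpha> * l2 x)
         = of_real (- pi / t * (norm x)\<^sup>2) + \<alpha> * m2 x"
        by (simp add: l2_def m2_def a power_mult_distrib algebra_simps add_divide_distrib diff_divide_distrib)
      then show ?thesis
        unfolding c2_def e2_def exp_of_real[symmetric] exp_add[symmetric] by simp
    qed
    show "(\<Sum>\<^sub>\<infinity>x\<in>L. e1 x * exp (\<alpha> * m1 x)) = (\<Sum>\<^sub>\<infinity>x\<in>L. e2 x * exp (\<alpha> * m2 x))"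
      using key[of \<alpha>] unfolding \<Theta>1_def \<Theta>2_def infsum_cmult_right'[symmetric] 1 2 .
  qed
  moreover have "(\<Sum>\<^sub>\<infinity>x\<in>L. e1 x * m1 x ^ d) = of_real (t ^ 12) * (\<Sum>\<^sub>\<infinity>x\<in>L. of_real (exp (- pi * t * (norm x)\<^sup>2)) * (2 * pi * \<i> * a x) ^ d)"
    unfolding infsum_cmult_right'[symmetric] by (simp add: e1_def m1_def mult.assoc)
  ultimately show ?thesis by (simp add: e2_def m2_def)
qed

end

context leech
begin

text \<open>The exponent of \<open>q\<close> in the theta series; the rounding is exact on the
  lattice because the lattice is even.\<close>

definition half_norm :: "real^24 \<Rightarrow> nat" where
  "half_norm x = nat \<lfloor>(norm x)\<^sup>2 / 2\<rfloor>"

lemma half_norm: "x \<in> L \<Longrightarrow> (norm x)\<^sup>2 = 2 * real (half_norm x)"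
proof -
  assume "x \<in> L"
  then obtain k :: int where k: "x \<bullet> x = 2 * of_int k"
    using leech by (auto simp: leech_lattice_def even_lattice_def)
  then have "(norm x)\<^sup>2 / 2 = of_int k" by (simp add: power2_norm_eq_inner)
  moreover have "0 \<le> k" using inner_ge_zero[of x] unfolding k by simp
  ultimately show ?thesis by (simp add: half_norm_def)
qed

lemma norm_ge_2: "x \<in> L \<Longrightarrow> x \<noteq> 0 \<Longrightarrow> (norm x)\<^sup>2 \<ge> 4"
  using leech by (auto simp: leech_lattice_def has_minimum_norm_def power2_norm_eq_inner)

definition min_vectors :: "(real^24) set" where
  "min_vectors = {x \<in> L. norm x = 2}"

text \<open>Infinitely many vectors of one length would contribute equal positive terms to a
  convergent Gaussian sum.\<close>

lemma finite_shell: "finite {x \<in> L. norm x = r}"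
proof (rule ccontr)
  let ?M = "{x \<in> L. norm x = r}"
  assume inf: "infinite ?M"
  define S where "S = (\<Sum>\<^sub>\<infinity>x\<in>L. exp (- 1 * (norm x)\<^sup>2))"
  obtain n :: nat where n: "S < n * exp (- r\<^sup>2)"
    using reals_Archimedean3[of "exp (- r\<^sup>2)"] by auto
  obtain F where F: "finite F" "card F = n" "F \<subseteq> ?M"
    using infinite_arbitrarily_large[OF inf] by blast
  have "(\<Sum>x\<in>F. exp (- 1 * (norm x)\<^sup>2)) \<le> S"
    unfolding S_def using F by (intro finite_sum_le_infsum gaussian_summable) auto
  moreover have "(\<Sum>x\<in>F. exp (- 1 * (norm x)\<^sup>2)) = (\<Sum>x\<in>F. exp (- r\<^sup>2))"
    using F by (intro sum.cong) auto
  ultimately show False using n F(2) by simp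
qed

lemma finite_min_vectors: "finite min_vectors"
  unfolding min_vectors_def by (rule finite_shell)

text \<open>The theta series of \<open>L\<close> with the harmonic coefficient \<open>(a \<bullet> x)\<^sup>d\<close>, \<open>a = p + \<i>q\<close> isotropic,
  is a cusp form of weight \<open>12 + d\<close> without \<open>q\<^sup>1\<close> term, hence zero.\<close>

theorem isotropic_design:
  fixes p q :: "real^24"
  assumes pq: "p \<bullet> q = 0" "norm p = norm q" and d: "even d" "0 < d" "d \<le> 6"
  shows "(\<Sum>x\<in>min_vectors. Complex (p \<bullet> x) (q \<bullet> x) ^ d) = 0"
proof -
  define a where "a = (\<lambda>x. Complex (p \<bullet> x) (q \<bullet> x))"
  define K where "K = norm p + norm q"
  have norm_a: "norm (a x) \<le> K * norm x" for x
    unfolding a_def K_def by (rule norm_Complex_inner_le)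
  have summ: "(\<lambda>x. a x ^ d * w ^ half_norm x) summable_on L" if w: "norm w < 1" for w
  proof -
    \<comment> \<open>The maximum with 1/2 keeps the logarithm defined when
      \<open>w = 0\<close>.\<close>
    define \<rho> where "\<rho> = max (norm w) (1/2)"
    have \<rho>: "0 < \<rho>" "\<rho> < 1" "norm w \<le> \<rho>" using w by (auto simp: \<rho>_def)
    define c where "c = - ln \<rho> / 2"
    have c: "c > 0" using \<rho> by (simp add: c_def)
    show ?thesis
    proof (rule abs_summable_summable, rule summable_on_comparison_test)
      show "(\<lambda>x. (K ^ d * fact d) * (exp (- c * (norm x)\<^sup>2) * exp (1 * norm x))) summable_on L"
        by (intro summable_on_cmult_right gaussian_exp_summable c)
      fix x assume x: "x \<in> L"
      have "norm w ^ half_norm x \<le> \<rho> ^ half_norm x" using \<rho> by (intro power_mono) auto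
      also have "\<dots> = exp (real (half_norm x) * ln \<rho>)"
        using \<rho> by (simp add: exp_of_nat_mult)
      also have "\<dots> = exp (- c * (norm x)\<^sup>2)"
        by (simp add: half_norm[OF x] c_def)
      finally have 1: "norm w ^ half_norm x \<le> exp (- c * (norm x)\<^sup>2)" .
      have "norm x ^ d \<le> fact d * exp (norm x)" by (intro power_le_fact_exp) simp
      then have "K ^ d * norm x ^ d \<le> K ^ d * (fact d * exp (norm x))"
        by (intro mult_left_mono) (auto simp: K_def)
      moreover have "norm (a x) ^ d \<le> K ^ d * norm x ^ d"
        using power_mono[OF norm_a norm_ge_zero, of x d] by (simp add: power_mult_distrib)
      ultimately have 2: "norm (a x) ^ d \<le> K ^ d * (fact d * exp (norm x))" by linarith
      have "norm (a x) ^ d * norm w ^ half_norm x \<le> (K ^ d * (fact d * exp (norm x))) * exp (- c * (norm x)\<^sup>2)"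
        using 1 2 by (intro mult_mono) (auto simp: K_def)
      then show "norm (a x ^ d * w ^ half_norm x) \<le> (K ^ d * fact d) * (exp (- c * (norm x)\<^sup>2) * exp (1 * norm x))"
        by (simp add: norm_mult norm_power mult_ac)
    qed auto
  qed
  define shell where "shell = (\<lambda>n. {x \<in> L. half_norm x = n})"
  define A where "A = (\<lambda>n. \<Sum>\<^sub>\<infinity>x\<in>shell n. a x ^ d)"
  define P where "P = (\<lambda>w. \<Sum>\<^sub>\<infinity>x\<in>L. a x ^ d * w ^ half_norm x)"
  have A_summ: "(\<lambda>x. a x ^ d) summable_on shell n" for n
  proof -
    \<comment> \<open>Any nonzero point of the unit disc would do: on one shell the power of
      \<open>w\<close> is a constant factor.\<close>
    have "(\<lambda>x. a x ^ d * (1/2) ^ half_norm x) summable_on shell n"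
      by (rule summable_on_subset_banach[OF summ]) (auto simp: shell_def norm_divide)
    then have "(\<lambda>x. a x ^ d * (1/2) ^ half_norm x * 2 ^ n) summable_on shell n"
      by (rule summable_on_cmult_left)
    then show ?thesis
      by (rule summable_on_cong[THEN iffD1, rotated]) (simp add: shell_def power_one_over)
  qed
  have ser: "(\<lambda>n. A n * w ^ n) sums P w" if w: "norm w < 1" for w
  proof -
    have bij: "bij_betw (\<lambda>x. (half_norm x, x)) L (Sigma UNIV shell)"
      by (rule bij_betwI[where g = snd]) (auto simp: shell_def)
    have "((\<lambda>x. a x ^ d * w ^ half_norm x) has_sum P w) L"
      unfolding P_def using summ[OF w] by simp
    then have "((\<lambda>(n, x). a x ^ d * w ^ n) has_sum P w) (Sigma UNIV shell)"
      using has_sum_reindex_bij_betw[OF bij, of "\<lambda>(n, x). a x ^ d * w ^ n" "P w"] by simp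
    then have "((\<lambda>n. A n * w ^ n) has_sum P w) UNIV"
    proof (rule has_sum_SigmaD)
      fix n
      have "((\<lambda>x. a x ^ d * w ^ n) has_sum A n * w ^ n) (shell n)"
        unfolding A_def using A_summ by (intro has_sum_cmult_left has_sum_infsum)
      then show "((\<lambda>x. case (n, x) of (n, x) \<Rightarrow> a x ^ d * w ^ n) has_sum A n * w ^ n) (shell n)" by simp
    qed
    then show ?thesis by (rule has_sum_imp_sums)
  qed
  have shell0: "shell 0 = {0}"
  proof -
    have "x = 0" if "x \<in> L" "half_norm x = 0" for x
      using half_norm[OF that(1)] that(2) by simp
    then show ?thesis by (auto simp: shell_def) (simp add: half_norm_def)
  qed
  have shell1: "shell 1 = {}"
  proof (rule equals0I)
    fix x assume "x \<in> shell 1"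
    then have x: "x \<in> L" "(norm x)\<^sup>2 = 2" using half_norm by (auto simp: shell_def)
    then show False using norm_ge_2[of x] by (cases "x = 0") auto
  qed
  have shell2: "shell 2 = min_vectors"
  proof -
    have "half_norm x = 2 \<longleftrightarrow> norm x = 2" if "x \<in> L" for x
    proof -
      have "half_norm x = 2 \<longleftrightarrow> (norm x)\<^sup>2 = 2\<^sup>2" using half_norm[OF that] by auto
      then show ?thesis using power2_eq_iff_nonneg[of "norm x" 2] by simp
    qed
    then show ?thesis by (auto simp: shell_def min_vectors_def)
  qed
  have a0: "a 0 = 0" by (simp add: a_def complex_eq_iff)
  have P_holo: "P holomorphic_on ball 0 1"
    by (rule power_series_holomorphic[where a = A]) (use ser in auto)
  define H where "H = {z. Im z > 0}"
  have H: "open H" "connected H"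
    unfolding H_def by (simp_all add: open_halfspace_Im_gt convex_connected convex_halfspace_Im_gt)
  have Pe: "(\<lambda>z. P (exp (2 * pi * \<i> * g z))) holomorphic_on H"
    if "g holomorphic_on H" "\<And>z. z \<in> H \<Longrightarrow> Im (g z) > 0" for g
  proof -
    have "(P \<circ> (\<lambda>z. exp (2 * pi * \<i> * g z))) holomorphic_on H"
    proof (rule holomorphic_on_compose_gen[OF _ P_holo])
      show "(\<lambda>z. exp (2 * pi * \<i> * g z)) ` H \<subseteq> ball 0 1"
        using that(2) by (auto simp: exp_2pi_i_Im)
    qed (intro holomorphic_intros that)
    then show ?thesis by (simp add: o_def)
  qed
  \<comment> \<open>The real parameter \<open>t\<close> of Poisson summation is a point of the
    imaginary axis; the law there extends to the half plane by analytic continuation below.\<close>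
  have imag_axis: "P (exp (2 * pi * \<i> * (- 1 / (\<i> * of_real t)))) = (\<i> * of_real t) ^ (12 + d) * P (exp (2 * pi * \<i> * (\<i> * of_real t)))"
    if t: "t > 0" for t :: real
  proof -
    have e: "exp (2 * pi * \<i> * (\<i> * of_real s)) ^ half_norm x = of_real (exp (- pi * s * (norm x)\<^sup>2))" if "x \<in> L" for s x
    proof -
      have "exp (2 * pi * \<i> * (\<i> * of_real s)) = of_real (exp (- 2 * pi * s))"
        by (simp add: exp_of_real[symmetric] algebra_simps)
      moreover have "exp (- 2 * pi * s) ^ half_norm x = exp (- pi * s * (norm x)\<^sup>2)"
        by (simp add: half_norm[OF that] algebra_simps flip: exp_of_nat_mult)
      ultimately show ?thesis by (simp only: of_real_power[symmetric])
    qed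
    have Pt: "P (exp (2 * pi * \<i> * (\<i> * of_real s))) = (\<Sum>\<^sub>\<infinity>x\<in>L. of_real (exp (- pi * s * (norm x)\<^sup>2)) * a x ^ d)" for s
      unfolding P_def by (intro infsum_cong) (subst e, assumption, rule mult.commute)
    have "- 1 / (\<i> * of_real t) = \<i> * of_real (1 / t)"
      by (simp add: divide_inverse)
    then have Pinv: "P (exp (2 * pi * \<i> * (- 1 / (\<i> * of_real t)))) = (\<Sum>\<^sub>\<infinity>x\<in>L. of_real (exp (- pi / t * (norm x)\<^sup>2)) * a x ^ d)"
      using Pt[of "1 / t"] by simp
    define Y where "Y = P (exp (2 * pi * \<i> * (\<i> * of_real t)))"
    define Z where "Z = P (exp (2 * pi * \<i> * (- 1 / (\<i> * of_real t))))"
    have Y: "(2 * pi * \<i>) ^ d * Y = (\<Sum>\<^sub>\<infinity>x\<in>L. of_real (exp (- pi * t * (norm x)\<^sup>2)) * (2 * pi * \<i> * a x) ^ d)"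
      unfolding Y_def Pt infsum_cmult_right'[symmetric]
      by (intro infsum_cong) (simp only: power_mult_distrib mult_ac)
    have Z: "(- (2 * pi / t)) ^ d * Z = (\<Sum>\<^sub>\<infinity>x\<in>L. of_real (exp (- pi / t * (norm x)\<^sup>2)) * (- (2 * pi / t) * a x) ^ d)"
      unfolding Z_def Pinv infsum_cmult_right'[symmetric]
      by (intro infsum_cong) (simp only: power_mult_distrib of_real_power mult_ac)
    have "of_real (t ^ 12) * ((2 * pi * \<i>) ^ d * Y) = (- (2 * pi / t)) ^ d * Z"
      unfolding Y Z a_def by (rule isotropic_poisson[OF pq t])
    \<comment> \<open>Evenness of \<open>d\<close> removes the sign. Together with i^12 = 1 this
      makes the automorphy factor exactly \<open>z ^ (12 + d)\<close>.\<close>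
    moreover have "complex_of_real (- (2 * pi / t)) ^ d = of_real (2 * pi) ^ d / of_real t ^ d"
      using d(1) by (simp add: power_divide)
    moreover have "complex_of_real (2 * pi) * \<i> = 2 * pi * \<i>" by simp
    ultimately have "of_real (2 * pi) ^ d * (of_real (t ^ 12) * (\<i> ^ d * Y)) = of_real (2 * pi) ^ d * (Z / of_real t ^ d)"
      by (simp add: power_mult_distrib mult_ac)
    then have "of_real (t ^ 12) * (\<i> ^ d * Y) = Z / of_real t ^ d"
      by (subst (asm) mult_cancel_left) auto
    then have "Z = of_real t ^ d * (of_real (t ^ 12) * (\<i> ^ d * Y))"
      using t by (simp add: field_simps)
    also have "\<dots> = (\<i> ^ 12 * \<i> ^ d) * (of_real t ^ 12 * of_real t ^ d) * Y"
      by (simp add: numeral_eq_Suc)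
    also have "\<dots> = (\<i> * of_real t) ^ (12 + d) * Y"
      by (simp only: power_add power_mult_distrib mult_ac)
    finally show ?thesis by (simp only: Y_def Z_def)
  qed
  define g where "g = (\<lambda>z. P (exp (2 * pi * \<i> * (- 1 / z))) - z ^ (12 + d) * P (exp (2 * pi * \<i> * z)))"
  have S: "g z = 0" if "z \<in> H" for z
  proof (rule analytic_continuation[of g H "(\<lambda>t. \<i> * of_real t) ` {0<..}" \<i>])
    have "Im (- 1 / z) > 0" if "z \<in> H" for z
      using that by (auto simp: H_def Im_divide intro!: divide_pos_pos sum_power2_gt_zero_iff[THEN iffD2])
    then show "g holomorphic_on H"
      unfolding g_def by (intro holomorphic_intros Pe) (auto simp: H_def)
    show "\<i> islimpt (\<lambda>t. \<i> * complex_of_real t) ` {0<..}"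
      unfolding islimpt_approachable
    proof (intro allI impI)
      fix e :: real assume "e > 0"
      then show "\<exists>x'\<in>(\<lambda>t. \<i> * complex_of_real t) ` {0<..}. x' \<noteq> \<i> \<and> dist x' \<i> < e"
        by (intro bexI[of _ "\<i> * of_real (1 + e / 2)"] imageI)
           (auto simp: dist_norm complex_eq_iff norm_mult algebra_simps norm_divide)
    qed
    show "g z = 0" if "z \<in> (\<lambda>t. \<i> * complex_of_real t) ` {0<..}" for z
      using that imag_axis by (auto simp: g_def)
  qed (use H that in \<open>auto simp: H_def\<close>)
  have "A 2 = 0"
  proof (rule modular_vanishing[OF ser])
    \<comment> \<open>The zero vector contributes 0 because \<open>d > 0\<close>; the next shell is
      empty because there are no roots.\<close>
    show "A 0 = 0" "A 1 = 0" using d(2) by (simp_all add: A_def shell0 shell1[simplified] a0)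
    show "12 + d \<le> 18" using d by simp
    show "P (exp (2 * pi * \<i> * (- 1 / z))) = z ^ (12 + d) * P (exp (2 * pi * \<i> * z))" if "Im z > 0" for z
      using S[of z] that by (simp add: g_def H_def)
  qed
  then show ?thesis
    using finite_min_vectors by (simp add: A_def shell2 a_def infsum_finite)
qed

end

section \<open>Minimal vectors and the slice\<close>

lemma sum_offdiag:
  fixes f :: "'a \<Rightarrow> 'a \<Rightarrow> real"
  assumes "finite E"
  shows "(\<Sum>q\<in>E. \<Sum>r\<in>E - {q}. f q r) = (\<Sum>q\<in>E. \<Sum>r\<in>E. f q r) - (\<Sum>q\<in>E. f q q)"
  using assms by (simp add: sum_diff1 sum_subtractf)

lemma orthonormal_sum_squares:
  fixes x :: "'a::euclidean_space"
  assumes "pairwise orthogonal S" "\<And>e. e \<in> S \<Longrightarrow> norm e = 1" "finite S" "span S = UNIV"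
  shows "(\<Sum>e\<in>S. (e \<bullet> x)\<^sup>2) = (norm x)\<^sup>2"
proof -
  have "x \<bullet> x = (\<Sum>e\<in>S. (x \<bullet> e) *\<^sub>R e) \<bullet> x"
    using orthonormal_basis_expand[OF assms(1,2) _ assms(3), of x] assms(4) by simp
  also have "\<dots> = (\<Sum>e\<in>S. (x \<bullet> e) * (e \<bullet> x))"
    by (simp add: inner_sum_left)
  also have "\<dots> = (\<Sum>e\<in>S. (e \<bullet> x)\<^sup>2)"
    by (simp add: power2_eq_square inner_commute[of x])
  finally show ?thesis by (simp add: power2_norm_eq_inner)
qed

text \<open>Vanishing of the harmonic moments \<open>\<Sum> (a \<bullet> x)\<^sup>d\<close> for isotropic \<open>a\<close> determines the power
  moments: all equations needed involve vectors of one orthonormal basis containing \<open>p\<close>.\<close>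

lemma isotropic_moments:
  fixes X :: "(real^24) set" and p :: "real^24"
  assumes fin: "finite X" and nX: "\<And>x. x \<in> X \<Longrightarrow> norm x = 2"
    and iso: "\<And>p q d. p \<bullet> q = 0 \<Longrightarrow> norm p = norm q \<Longrightarrow> d \<in> {2, 4, 6} \<Longrightarrow>
      (\<Sum>x\<in>X. Complex (p \<bullet> x) (q \<bullet> x) ^ d) = 0"
    and p: "norm p = 1"
  shows "(\<Sum>x\<in>X. (p \<bullet> x)^2) = card X / 6"
    and "(\<Sum>x\<in>X. (p \<bullet> x)^4) = card X / 13"
    and "(\<Sum>x\<in>X. (p \<bullet> x)^6) = 5 * card X / 91"
proof -
  obtain S where pS: "p \<in> S" and orth: "pairwise orthogonal S" and unit: "\<And>x. x \<in> S \<Longrightarrow> norm x = 1"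
    and S: "independent S" "card S = DIM(real^24)" "span S = UNIV"
    using vector_in_orthonormal_basis[OF p] by blast
  have finS: "finite S" using S(1) by (rule independent_imp_finite)
  have cardS: "card S = 24" using S(2) by simp
  define N where "N = real (card X)"
  have sq: "(\<Sum>e\<in>S. (e \<bullet> x)\<^sup>2) = 4" if "x \<in> X" for x
    using orthonormal_sum_squares[OF orth unit finS S(3), of x] nX[OF that] by simp
  have orth': "e \<bullet> f = 0" if "e \<in> S" "f \<in> S" "e \<noteq> f" for e f
    using orth that by (auto simp: pairwise_def orthogonal_def)
  have re2: "Re (Complex u v ^ 2) = u^2 - v^2" for u v
    by (simp add: power2_eq_square)
  have re4: "Re (Complex u v ^ 4) = u^4 - 6 * u^2 * v^2 + v^4" for u v
    by (simp add: numeral_eq_Suc algebra_simps)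
  have re6: "Re (Complex u v ^ 6) = u^6 - 15 * u^4 * v^2 + 15 * u^2 * v^4 - v^6" for u v
    by (simp add: numeral_eq_Suc algebra_simps)
  have Re0: "(\<Sum>x\<in>X. Re (Complex (u \<bullet> x) (v \<bullet> x) ^ d)) = 0"
    if "u \<bullet> v = 0" "norm u = norm v" "d \<in> {2, 4, 6}" for u v d
    using arg_cong[OF iso[OF that], of Re] by (simp only: Re_sum zero_complex.simps)
  define M where "M = (\<lambda>k e. \<Sum>x\<in>X. (e \<bullet> x) ^ k)"
  have M2: "M 2 e = N / 6" if e: "e \<in> S" for e
  proof -
    \<comment> \<open>The real part of the quadratic identity for \<open>e\<close>, \<open>f\<close>
      is the difference of the two second moments; all of them are equal and add up to 4 for each
      vector of \<open>X\<close>.\<close>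
    have "M 2 e = M 2 f" if "f \<in> S" for f
      using Re0[of e f 2] orth'[of e f] unit[OF e] unit[OF that] e that
      unfolding re2 M_def by (cases "e = f") (auto simp: sum_subtractf)
    then have "(\<Sum>f\<in>S. M 2 f) = (\<Sum>f\<in>S. M 2 e)" by (intro sum.cong) auto
    moreover have "(\<Sum>f\<in>S. M 2 f) = 4 * N"
      unfolding M_def by (subst sum.swap) (simp add: sq N_def)
    ultimately show ?thesis by (simp add: cardS)
  qed
  have sum': "(\<Sum>q\<in>S - {e}. g q) = (\<Sum>q\<in>S. g q) - g e" if "e \<in> S" for e and g :: "real^24 \<Rightarrow> real"
    using that finS by (simp add: sum_diff1)
  have card': "card (S - {e}) = 23" if "e \<in> S" for e
    using that cardS by (simp add: card_Diff_singleton)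
  have sq': "(\<Sum>q\<in>S - {e}. (q \<bullet> x)\<^sup>2) = 4 - (e \<bullet> x)\<^sup>2" if "e \<in> S" "x \<in> X" for e x
    using sum'[OF that(1), of "\<lambda>q. (q \<bullet> x)\<^sup>2"] sq[OF that(2)] by simp
  have S4: "28 * M 4 e + (\<Sum>f\<in>S. M 4 f) = 4 * N" if e: "e \<in> S" for e
  proof -
    \<comment> \<open>Summing over all \<open>q\<close> other than \<open>e\<close> turns the mixed
      terms into (e . x)^2 (4 - (e . x)^2), so only fourth moments and the known second ones
      remain.\<close>
    have "(\<Sum>q\<in>S - {e}. \<Sum>x\<in>X. (e \<bullet> x)^4 - 6 * (e \<bullet> x)^2 * (q \<bullet> x)^2 + (q \<bullet> x)^4) = 0"
      using Re0[of e _ 4] orth' unit e unfolding re4 by (intro sum.neutral) auto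
    then have "0 = (\<Sum>x\<in>X. \<Sum>q\<in>S - {e}. (e \<bullet> x)^4 - 6 * (e \<bullet> x)^2 * (q \<bullet> x)^2 + (q \<bullet> x)^4)"
      by (subst sum.swap) simp
    also have "\<dots> = (\<Sum>x\<in>X. 23 * (e \<bullet> x)^4 - 6 * (e \<bullet> x)^2 * (4 - (e \<bullet> x)^2) + ((\<Sum>q\<in>S. (q \<bullet> x)^4) - (e \<bullet> x)^4))"
      by (intro sum.cong refl)
         (simp add: sum.distrib sum_subtractf card' cardS e sq' sum'[OF e, of "\<lambda>q. (q \<bullet> _) ^ 4"] flip: sum_distrib_left)
    also have "\<dots> = (\<Sum>x\<in>X. 28 * (e \<bullet> x)^4 - 24 * (e \<bullet> x)^2 + (\<Sum>q\<in>S. (q \<bullet> x)^4))"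
      by (intro sum.cong refl) (simp add: algebra_simps flip: power_add)
    also have "\<dots> = 28 * M 4 e - 24 * M 2 e + (\<Sum>q\<in>S. M 4 q)"
      unfolding M_def by (simp add: sum.distrib sum_subtractf sum_distrib_left sum.swap[of _ X S])
    finally show ?thesis using M2[OF e] by simp
  qed
  have M4: "M 4 e = N / 13" if e: "e \<in> S" for e
  proof -
    have "(\<Sum>e\<in>S. 28 * M 4 e + (\<Sum>f\<in>S. M 4 f)) = (\<Sum>e\<in>S. 4 * N)"
      using S4 by (intro sum.cong) auto
    then have "52 * (\<Sum>f\<in>S. M 4 f) = 96 * N"
      by (simp add: sum.distrib cardS flip: sum_distrib_left)
    with S4[OF e] show ?thesis by simp
  qed
  have S6: "480 * M 6 e + 8 * (\<Sum>f\<in>S. M 6 f) = 480 * N / 13" if e: "e \<in> S" for e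
  proof -
    \<comment> \<open>\<open>T\<close> is a mixed moment, not a moment along one basis vector. Pairs
      (e, q) give one relation between it and the sixth moments, triples (e, q, r) a second
      one.\<close>
    define T where "T = (\<Sum>x\<in>X. (e \<bullet> x)^2 * (\<Sum>q\<in>S - {e}. (q \<bullet> x)^4))"
    have s4: "(\<Sum>x\<in>X. \<Sum>q\<in>S - {e}. (q \<bullet> x)^4) = 23 * N / 13"
    proof -
      have "(\<Sum>x\<in>X. \<Sum>q\<in>S - {e}. (q \<bullet> x)^4) = (\<Sum>q\<in>S - {e}. M 4 q)"
        by (subst sum.swap) (simp add: M_def)
      also have "\<dots> = (\<Sum>q\<in>S - {e}. N / 13)" using M4 by (intro sum.cong) auto
      finally show ?thesis using card'[OF e] by simp
    qed
    have s6: "(\<Sum>x\<in>X. \<Sum>q\<in>S - {e}. (q \<bullet> x)^6) = (\<Sum>f\<in>S. M 6 f) - M 6 e"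
      by (subst sum.swap) (simp add: M_def sum'[OF e])
    have eq1: "38 * M 6 e - 60 * M 4 e + 15 * T - ((\<Sum>f\<in>S. M 6 f) - M 6 e) = 0"
    proof -
      have "(\<Sum>q\<in>S - {e}. \<Sum>x\<in>X. (e \<bullet> x)^6 - 15 * (e \<bullet> x)^4 * (q \<bullet> x)^2 + 15 * (e \<bullet> x)^2 * (q \<bullet> x)^4 - (q \<bullet> x)^6) = 0"
        using Re0[of e _ 6] orth' unit e unfolding re6 by (intro sum.neutral) auto
      then have "0 = (\<Sum>x\<in>X. \<Sum>q\<in>S - {e}. (e \<bullet> x)^6 - 15 * (e \<bullet> x)^4 * (q \<bullet> x)^2 + 15 * (e \<bullet> x)^2 * (q \<bullet> x)^4 - (q \<bullet> x)^6)"
        by (subst sum.swap) simp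
      also have "\<dots> = (\<Sum>x\<in>X. 23 * (e \<bullet> x)^6 - 15 * (e \<bullet> x)^4 * (4 - (e \<bullet> x)^2) +
           15 * (e \<bullet> x)^2 * (\<Sum>q\<in>S - {e}. (q \<bullet> x)^4) - (\<Sum>q\<in>S - {e}. (q \<bullet> x)^6))"
        by (intro sum.cong refl) (simp add: sum.distrib sum_subtractf card' cardS e sq' flip: sum_distrib_left)
      also have "\<dots> = (\<Sum>x\<in>X. 38 * (e \<bullet> x)^6 - 60 * (e \<bullet> x)^4 +
           15 * ((e \<bullet> x)^2 * (\<Sum>q\<in>S - {e}. (q \<bullet> x)^4)) - (\<Sum>q\<in>S - {e}. (q \<bullet> x)^6))"
        by (intro sum.cong refl) (simp add: algebra_simps flip: power_add)
      also have "\<dots> = 38 * M 6 e - 60 * M 4 e + 15 * T - ((\<Sum>f\<in>S. M 6 f) - M 6 e)"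
        unfolding s6[symmetric] by (simp add: sum.distrib sum_subtractf M_def T_def flip: sum_distrib_left)
      finally show ?thesis by simp
    qed
    \<comment> \<open>The mean of the sextics for (sqrt 2 e, q + r) and (sqrt 2 e, q - r), again
      orthogonal pairs of equal length; averaging removes the odd powers of q and r.\<close>
    define F where "F = (\<lambda>P Q R :: real. 8 * P^6 - 60 * P^4 * (Q^2 + R^2) + 30 * P^2 * (Q^4 + 6 * Q^2 * R^2 + R^4)
      - (Q^6 + 15 * Q^4 * R^2 + 15 * Q^2 * R^4 + R^6))"
    have F: "F P Q R = (Re (Complex (sqrt 2 * P) (Q + R) ^ 6) + Re (Complex (sqrt 2 * P) (Q - R) ^ 6)) / 2" for P Q R
    proof -
      have s: "sqrt 2 ^ 2 = (2::real)" "sqrt 2 ^ 4 = (4::real)" "sqrt 2 ^ 6 = (8::real)"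
        using power_mult[of "sqrt 2" 2 2] power_mult[of "sqrt 2" 2 3] by simp_all
      show ?thesis unfolding re6 power_mult_distrib s F_def by (simp add: field_simps numeral_eq_Suc)
    qed
    have F0: "(\<Sum>x\<in>X. F (e \<bullet> x) (q \<bullet> x) (r \<bullet> x)) = 0" if "q \<in> S - {e}" "r \<in> S - {e} - {q}" for q r
    proof -
      have o: "e \<bullet> q = 0" "e \<bullet> r = 0" "q \<bullet> r = 0" "r \<bullet> q = 0" using that e orth' by auto
      have n: "norm (q + r) = sqrt 2" "norm (q - r) = sqrt 2" "norm (sqrt 2 *\<^sub>R e) = sqrt 2"
        using o unit[of q] unit[of r] unit[of e] that e
        by (auto simp: norm_eq_sqrt_inner inner_add_left inner_add_right inner_diff_left inner_diff_right)
      have "(\<Sum>x\<in>X. Re (Complex (sqrt 2 * (e \<bullet> x)) (q \<bullet> x + r \<bullet> x) ^ 6)) = 0"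
        using Re0[of "sqrt 2 *\<^sub>R e" "q + r" 6] o n by (simp add: inner_add_left inner_add_right)
      moreover have "(\<Sum>x\<in>X. Re (Complex (sqrt 2 * (e \<bullet> x)) (q \<bullet> x - r \<bullet> x) ^ 6)) = 0"
        using Re0[of "sqrt 2 *\<^sub>R e" "q - r" 6] o n by (simp add: inner_diff_left inner_diff_right)
      ultimately show ?thesis
        unfolding F by (simp add: sum.distrib flip: sum_divide_distrib)
    qed
    have "(\<Sum>q\<in>S - {e}. \<Sum>r\<in>S - {e} - {q}. \<Sum>x\<in>X. F (e \<bullet> x) (q \<bullet> x) (r \<bullet> x)) = 0"
      by (rule sum.neutral, rule ballI, rule sum.neutral, rule ballI, rule F0)
    then have "0 = (\<Sum>x\<in>X. \<Sum>q\<in>S - {e}. \<Sum>r\<in>S - {e} - {q}. F (e \<bullet> x) (q \<bullet> x) (r \<bullet> x))"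
      by (simp add: sum.swap[of _ X])
    also have "\<dots> = (\<Sum>x\<in>X. 6868 * (e \<bullet> x)^6 - 12000 * (e \<bullet> x)^4 + 2880 * (e \<bullet> x)^2
        + 1170 * ((e \<bullet> x)^2 * (\<Sum>q\<in>S - {e}. (q \<bullet> x)^4)) - 14 * (\<Sum>q\<in>S - {e}. (q \<bullet> x)^6) - 120 * (\<Sum>q\<in>S - {e}. (q \<bullet> x)^4))"
    proof (intro sum.cong refl)
      fix x assume x: "x \<in> X"
      define P where "P = e \<bullet> x"
      define E where "E = S - {e}"
      define s where "s = (\<lambda>k. \<Sum>q\<in>E. (q \<bullet> x) ^ k)"
      have finE: "finite E" and cE: "card E = 23" using finS card'[OF e] by (simp_all add: E_def)
      have s_fold: "(\<Sum>q\<in>E. (q \<bullet> x)\<^sup>2) = s 2" "(\<Sum>q\<in>E. (q \<bullet> x) ^ 4) = s 4" "(\<Sum>q\<in>E. (q \<bullet> x) ^ 6) = s 6"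
        by (simp_all add: s_def)
      have s2: "s 2 = 4 - P^2" using sq'[OF e x] by (simp add: s_def E_def P_def)
      have "(\<Sum>q\<in>E. \<Sum>r\<in>E. F P (q \<bullet> x) (r \<bullet> x)) =
        4232 * P^6 - 60 * P^4 * (46 * s 2) + 30 * P^2 * (46 * s 4 + 6 * (s 2 * s 2)) - (46 * s 6 + 30 * (s 4 * s 2))"
      proof -
        have inner: "(\<Sum>r\<in>E. F P Q (r \<bullet> x)) = 184 * P^6 - 60 * P^4 * (23 * Q^2 + s 2) +
           30 * P^2 * (23 * Q^4 + 6 * Q^2 * s 2 + s 4) - (23 * Q^6 + 15 * Q^4 * s 2 + 15 * Q^2 * s 4 + s 6)" for Q
          unfolding F_def s_def by (simp add: sum.distrib sum_subtractf cE flip: sum_distrib_left)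
        show ?thesis
          unfolding inner by (simp add: sum.distrib sum_subtractf cE flip: sum_distrib_left sum_distrib_right)
             (simp add: algebra_simps s_fold)
      qed
      moreover have "(\<Sum>q\<in>E. F P (q \<bullet> x) (q \<bullet> x)) = 184 * P^6 - 120 * P^4 * s 2 + 240 * P^2 * s 4 - 32 * s 6"
      proof -
        have "F P Q Q = 8 * P^6 - 120 * P^4 * Q^2 + 240 * P^2 * Q^4 - 32 * Q^6" for Q
          unfolding F_def by (simp add: field_simps numeral_eq_Suc)
        then show ?thesis
          unfolding s_def by (simp add: sum.distrib sum_subtractf cE flip: sum_distrib_left)
      qed
      \<comment> \<open>The full double sum minus its diagonal, with the second power sum replaced
        by 4 - P^2.\<close>
      ultimately have "(\<Sum>q\<in>E. \<Sum>r\<in>E - {q}. F P (q \<bullet> x) (r \<bullet> x)) =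
         6868 * P^6 - 12000 * P^4 + 2880 * P^2 + 1170 * (P^2 * s 4) - 14 * s 6 - 120 * s 4"
        unfolding sum_offdiag[OF finE] s2 by (simp add: field_simps)
      then show "(\<Sum>q\<in>S - {e}. \<Sum>r\<in>S - {e} - {q}. F (e \<bullet> x) (q \<bullet> x) (r \<bullet> x)) =
        6868 * (e \<bullet> x)^6 - 12000 * (e \<bullet> x)^4 + 2880 * (e \<bullet> x)^2
        + 1170 * ((e \<bullet> x)^2 * (\<Sum>q\<in>S - {e}. (q \<bullet> x)^4)) - 14 * (\<Sum>q\<in>S - {e}. (q \<bullet> x)^6) - 120 * (\<Sum>q\<in>S - {e}. (q \<bullet> x)^4)"
        by (simp add: P_def E_def s_def)
    qed
    also have "\<dots> = 6868 * M 6 e - 12000 * M 4 e + 2880 * M 2 e + 1170 * T - 14 * ((\<Sum>f\<in>S. M 6 f) - M 6 e) - 120 * (23 * N / 13)"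
      unfolding s6[symmetric] s4[symmetric] by (simp add: sum.distrib sum_subtractf M_def T_def flip: sum_distrib_left)
    finally have eq2: "0 = 6868 * M 6 e - 12000 * (N / 13) + 2880 * (N / 6) + 1170 * T -
        14 * ((\<Sum>f\<in>S. M 6 f) - M 6 e) - 120 * (23 * N / 13)"
      unfolding M2[OF e] M4[OF e] .
    \<comment> \<open>The factor 78 = 1170 / 15 prepares the elimination of \<open>T\<close> between
      the two relations.\<close>
    from eq1 have "1170 * T = 78 * ((\<Sum>f\<in>S. M 6 f) - M 6 e) - 2964 * M 6 e + 4680 * (N / 13)"
      unfolding M4[OF e] by simp
    with eq2 show ?thesis by simp
  qed
  have M6: "M 6 e = 5 * N / 91" if e: "e \<in> S" for e
  proof -
    have "(\<Sum>e\<in>S. 480 * M 6 e + 8 * (\<Sum>f\<in>S. M 6 f)) = (\<Sum>e\<in>S. 480 * N / 13)"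
      using S6 by (intro sum.cong) auto
    then have "672 * (\<Sum>f\<in>S. M 6 f) = 24 * (480 * N / 13)"
      by (simp add: sum.distrib cardS flip: sum_distrib_left)
    with S6[OF e] show ?thesis by simp
  qed
  show "(\<Sum>x\<in>X. (p \<bullet> x)^2) = card X / 6" "(\<Sum>x\<in>X. (p \<bullet> x)^4) = card X / 13"
    "(\<Sum>x\<in>X. (p \<bullet> x)^6) = 5 * card X / 91"
    using M2[OF pS] M4[OF pS] M6[OF pS] by (simp_all add: M_def N_def)
qed

section \<open>Counting minimal vectors and the geometry of the slice\<close>

context leech
begin

lemma min_vectorsD: "x \<in> min_vectors \<Longrightarrow> x \<in> L" "x \<in> min_vectors \<Longrightarrow> norm x = 2"
  by (auto simp: min_vectors_def)

lemma moments:
  shows "(\<Sum>x\<in>min_vectors. (v \<bullet> x)^2) = card min_vectors / 6 * (norm v)^2"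
    and "(\<Sum>x\<in>min_vectors. (v \<bullet> x)^4) = card min_vectors / 13 * (norm v)^4"
    and "(\<Sum>x\<in>min_vectors. (v \<bullet> x)^6) = 5 * card min_vectors / 91 * (norm v)^6"
proof -
  have "(\<Sum>x\<in>min_vectors. (v \<bullet> x)^2) = card min_vectors / 6 * (norm v)^2 \<and>
    (\<Sum>x\<in>min_vectors. (v \<bullet> x)^4) = card min_vectors / 13 * (norm v)^4 \<and>
    (\<Sum>x\<in>min_vectors. (v \<bullet> x)^6) = 5 * card min_vectors / 91 * (norm v)^6"
  proof (cases "v = 0")
    case False
    define p where "p = v /\<^sub>R norm v"
    have p: "norm p = 1" using False by (simp add: p_def)
    have v: "v \<bullet> x = norm v * (p \<bullet> x)" for x using False by (simp add: p_def)
    have iso: "(\<Sum>x\<in>min_vectors. Complex (p \<bullet> x) (q \<bullet> x) ^ d) = 0"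
      if "p \<bullet> q = 0" "norm p = norm q" "d \<in> {2, 4, 6}" for p q :: "real^24" and d
      using that by (intro isotropic_design) auto
    have m: "(\<Sum>x\<in>min_vectors. (p \<bullet> x)^2) = card min_vectors / 6"
      "(\<Sum>x\<in>min_vectors. (p \<bullet> x)^4) = card min_vectors / 13"
      "(\<Sum>x\<in>min_vectors. (p \<bullet> x)^6) = 5 * card min_vectors / 91"
      by (rule isotropic_moments[OF finite_min_vectors _ _ p]; (rule iso | rule min_vectorsD); assumption)+
    have "(\<Sum>x\<in>min_vectors. (v \<bullet> x)^k) = (\<Sum>x\<in>min_vectors. (p \<bullet> x)^k) * (norm v)^k" for k
      unfolding sum_distrib_right by (intro sum.cong refl) (simp only: v power_mult_distrib mult.commute)
    then show ?thesis using m by simp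
  qed simp
  then show "(\<Sum>x\<in>min_vectors. (v \<bullet> x)^2) = card min_vectors / 6 * (norm v)^2"
    "(\<Sum>x\<in>min_vectors. (v \<bullet> x)^4) = card min_vectors / 13 * (norm v)^4"
    "(\<Sum>x\<in>min_vectors. (v \<bullet> x)^6) = 5 * card min_vectors / 91 * (norm v)^6" by blast+
qed

lemma norm_diff_sq: "(norm (x - y))\<^sup>2 = (norm x)\<^sup>2 + (norm y)\<^sup>2 - 2 * (x \<bullet> y)"
  for x y :: "real^24"
  by (simp add: power2_norm_eq_inner inner_diff_left inner_diff_right inner_commute)

lemma norm_add_sq: "(norm (x + y))\<^sup>2 = (norm x)\<^sup>2 + (norm y)\<^sup>2 + 2 * (x \<bullet> y)"
  for x y :: "real^24"
  by (simp add: power2_norm_eq_inner inner_add_left inner_add_right inner_commute)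

text \<open>The difference of distinct lattice vectors has norm at least 4. Lower bounds on inner
  products also come from this, applied to a negated vector or to a sum.\<close>

lemma inner_le:
  assumes "x \<in> L" "y \<in> L" "x \<noteq> y"
  shows "2 * (x \<bullet> y) \<le> (norm x)\<^sup>2 + (norm y)\<^sup>2 - 4"
  using norm_ge_2[OF diff_mem[OF assms(1,2)]] assms(3) unfolding norm_diff_sq by simp

lemma inner_obtain_int:
  assumes "x \<in> L" "y \<in> L"
  obtains k :: int where "x \<bullet> y = of_int k"
  using inner_int[OF assms] by (auto simp: Ints_def)

lemma uminus_min_vectors: "x \<in> min_vectors \<Longrightarrow> - x \<in> min_vectors"
  by (auto simp: min_vectors_def uminus_mem)

lemma card_min_vectors: "card min_vectors = 196560"
proof -
  obtain v where vL: "v \<in> L" and vv: "v \<bullet> v = 4"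
    using leech by (auto simp: leech_lattice_def has_minimum_norm_def)
  then have v: "v \<in> L" "norm v = 2" by (simp_all add: norm_eq_sqrt_inner)
  have vm: "v \<in> min_vectors" "- v \<in> min_vectors" using v by (auto simp: min_vectors_def uminus_mem)
  have "v \<noteq> - v"
  proof
    assume "v = - v"
    then have "v \<bullet> v = (- v) \<bullet> v" by (rule arg_cong)
    then show False using vv by simp
  qed
  \<comment> \<open>This is k^2 (k^2 - 1) (k^2 - 4), which vanishes at every inner product with
    \<open>v\<close> except 4 and -4. There its value is 2880, so the sum is 5760, while the moments
    make the sum 8/273 times the number of minimal vectors.\<close>
  define g where "g = (\<lambda>k::real. k^6 - 5 * k^4 + 4 * k^2)"
  have g0: "g (v \<bullet> x) = 0" if x: "x \<in> min_vectors" "x \<noteq> v" "x \<noteq> - v" for x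
  proof -
    obtain k :: int where k: "v \<bullet> x = of_int k" using inner_obtain_int[OF v(1) min_vectorsD(1)[OF x(1)]] .
    have "of_int k \<le> (2::real)"
      using inner_le[OF v(1) min_vectorsD(1)[OF x(1)]] x min_vectorsD(2)[OF x(1)] v k by auto
    moreover have "v \<noteq> - x" using x(3) by (metis minus_minus)
    then have "- of_int k \<le> (2::real)"
      using inner_le[OF v(1) uminus_mem[OF min_vectorsD(1)[OF x(1)]]] x min_vectorsD(2)[OF x(1)] v k by auto
    ultimately have "k \<in> {-2..2}" by auto
    then have "k \<in> {-2, -1, 0, 1, 2}" by auto
    then show ?thesis unfolding k g_def by auto
  qed
  have "(\<Sum>x\<in>min_vectors. g (v \<bullet> x)) = (\<Sum>x\<in>{v, - v}. g (v \<bullet> x))"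
    using vm finite_min_vectors g0 by (intro sum.mono_neutral_right) auto
  also have "\<dots> = 5760"
    using \<open>v \<noteq> - v\<close> vv by (simp add: g_def)
  finally have "(\<Sum>x\<in>min_vectors. (v \<bullet> x)^6) - 5 * (\<Sum>x\<in>min_vectors. (v \<bullet> x)^4) + 4 * (\<Sum>x\<in>min_vectors. (v \<bullet> x)^2) = 5760"
    by (simp add: g_def sum.distrib sum_subtractf sum_distrib_left)
  then show ?thesis unfolding moments v(2) by simp
qed

text \<open>Working with unscaled minimal vectors \<open>x\<close> in place of
  \<open>y = x / 2\<close> turns the condition on the inner product with the normalised
  \<open>W\<close> into the integer 2.\<close>

definition slice :: "real^24 \<Rightarrow> (real^24) set" where
  "slice W = {x \<in> min_vectors. x \<bullet> W = 2}"

lemma card_slice: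
  assumes W: "W \<in> L" "norm W = sqrt 6"
  shows "card (slice W) = 11178"
proof -
  have W2: "(norm W)\<^sup>2 = 6" "norm W ^ 4 = 36" "norm W ^ 6 = 216"
    using power_mult[of "sqrt 6" 2 2] power_mult[of "sqrt 6" 2 3] by (simp_all add: W)
  \<comment> \<open>This is k^2 (k^2 - 1) (k^2 - 9). Inner products with \<open>W\<close> lie
    between -3 and 3, and only 2 and -2 are not roots; \<open>slice\<close> is one half of these by
    symmetry.\<close>
  define g where "g = (\<lambda>k::real. k^6 - 10 * k^4 + 9 * k^2)"
  have g0: "g (W \<bullet> x) = (if \<bar>W \<bullet> x\<bar> = 2 then - 60 else 0)" if x: "x \<in> min_vectors" for x
  proof -
    obtain k :: int where k: "W \<bullet> x = of_int k" using inner_obtain_int[OF W(1) min_vectorsD(1)[OF x(1)]] .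
    have "x \<noteq> W" "- x \<noteq> W" using W2(1) min_vectorsD(2)[OF x] by auto
    then have "of_int k \<le> (3::real)" "- of_int k \<le> (3::real)"
      using inner_le[OF W(1) min_vectorsD(1)[OF x(1)]] inner_le[OF W(1) uminus_mem[OF min_vectorsD(1)[OF x(1)]]] min_vectorsD(2)[OF x(1)] W2 k by auto
    then have "k \<in> {-3..3}" by auto
    then have "k \<in> {-3, -2, -1, 0, 1, 2, 3}" by auto
    then show ?thesis unfolding k g_def by auto
  qed
  have "(\<Sum>x\<in>min_vectors. g (W \<bullet> x)) = (\<Sum>x\<in>min_vectors. if \<bar>W \<bullet> x\<bar> = 2 then - 60 else 0)"
    using g0 by (intro sum.cong) auto
  also have "\<dots> = - 60 * card {x \<in> min_vectors. \<bar>W \<bullet> x\<bar> = 2}"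
    using finite_min_vectors by (simp add: sum.If_cases Int_def)
  also have "{x \<in> min_vectors. \<bar>W \<bullet> x\<bar> = 2} = slice W \<union> uminus ` slice W"
  proof -
    have "x \<in> uminus ` slice W" if "x \<in> min_vectors" "W \<bullet> x = - 2" for x
      using that uminus_min_vectors[OF that(1)] by (intro image_eqI[of _ _ "- x"]) (auto simp: slice_def inner_commute)
    then show ?thesis by (auto simp: slice_def uminus_min_vectors inner_commute abs_if split: if_splits)
  qed
  also have "card \<dots> = card (slice W) + card (uminus ` slice W)"
    using finite_min_vectors by (intro card_Un_disjoint) (auto simp: slice_def)
  also have "card (uminus ` slice W) = card (slice W)" by (intro card_image) (auto simp: inj_on_def)
  finally have "(\<Sum>x\<in>min_vectors. (W \<bullet> x)^6) - 10 * (\<Sum>x\<in>min_vectors. (W \<bullet> x)^4) + 9 * (\<Sum>x\<in>min_vectors. (W \<bullet> x)^2) = - 120 * real (card (slice W))"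
    by (simp add: g_def sum.distrib sum_subtractf sum_distrib_left)
  then show ?thesis unfolding moments W2 card_min_vectors by simp
qed

text \<open>The value -2 is excluded by comparing \<open>x + y\<close> with \<open>W\<close>: their
  inner product is 4, and their difference has norm at least 4.\<close>

lemma slice_inner:
  assumes W: "W \<in> L" "norm W = sqrt 6" and x: "x \<in> slice W" "y \<in> slice W" "x \<noteq> y"
  shows "x \<bullet> y \<in> {-1, 0, 1, 2}"
proof -
  have xL: "x \<in> L" "y \<in> L" "norm x = 2" "norm y = 2" "x \<bullet> W = 2" "y \<bullet> W = 2"
    using x by (auto simp: slice_def min_vectorsD)
  obtain k :: int where k: "x \<bullet> y = of_int k" using inner_obtain_int[OF xL(1,2)] .
  have "of_int k \<le> (2::real)" using inner_le[OF xL(1,2) x(3)] xL k by simp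
  moreover have "- 1 \<le> (of_int k :: real)"
  proof -
    have n: "(norm (x + y))\<^sup>2 = 8 + 2 * of_int k"
      using xL(3,4) k unfolding norm_add_sq by simp
    have i: "(x + y) \<bullet> W = 4" using xL by (simp add: inner_add_left)
    have "x + y \<noteq> W"
    proof
      assume "x + y = W"
      then have "W \<bullet> W = 4" using i by simp
      then show False using W(2) by (simp flip: power2_norm_eq_inner)
    qed
    then show ?thesis using inner_le[OF add_mem[OF xL(1,2)] W(1)] n i W(2) by simp
  qed
  ultimately have "k \<in> {-1..2}" by auto
  then have "k \<in> {-1, 0, 1, 2}" by auto
  then show ?thesis using k by auto
qed

definition slice_point :: "real^24 \<Rightarrow> real^24 \<Rightarrow> real^24" where
  "slice_point W x = (x /\<^sub>R 2 - (sqrt 6 / 6) *\<^sub>R (W /\<^sub>R sqrt 6)) /\<^sub>R sqrt (1 - (sqrt 6 / 6)\<^sup>2)"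

lemma slice_code_eq:
  "leech_slice_code L W = slice_point W ` slice W"
proof -
  have iff: "(x /\<^sub>R 2) \<bullet> (W /\<^sub>R sqrt 6) = sqrt 6 / 6 \<longleftrightarrow> x \<bullet> W = 2" for x
  proof -
    have "sqrt 6 / 6 = inverse (sqrt 6)" by (simp add: field_simps)
    show ?thesis unfolding \<open>sqrt 6 / 6 = inverse (sqrt 6)\<close> by simp
  qed
  have "leech_slice_code L W = {slice_point W x | x. x \<in> min_vectors \<and> (x /\<^sub>R 2) \<bullet> (W /\<^sub>R sqrt 6) = sqrt 6 / 6}"
    unfolding leech_slice_code_def unit_minimal_vectors_def min_vectors_def slice_point_def Let_def by blast
  then show ?thesis unfolding iff slice_def by blast
qed

text \<open>Projection and rescaling act on inner products by this affine map, which takes -1, 0, 1,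
  2 to -1/2, -1/5, 1/10, 2/5.\<close>

lemma slice_point_inner:
  assumes W: "norm W = sqrt 6" and x: "x \<bullet> W = 2" "y \<bullet> W = 2"
  shows "slice_point W x \<bullet> slice_point W y = (3 * (x \<bullet> y) - 2) / 10"
    and "slice_point W x \<bullet> W = 0"
proof -
  have WW: "W \<bullet> W = 6" using W by (simp flip: power2_norm_eq_inner)
  have c: "sqrt 6 / 6 * inverse (sqrt 6) = (1/6 :: real)" by (simp add: field_simps)
  have d: "1 - (sqrt 6 / 6)\<^sup>2 = (5/6 :: real)" by (simp add: power_divide)
  define s :: real where "s = inverse (sqrt (5/6))"
  have s: "s * s = 6/5" unfolding s_def inverse_mult_distrib[symmetric] by simp
  have p: "slice_point W z = s *\<^sub>R (inverse 2 *\<^sub>R z - (1/6) *\<^sub>R W)" for z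
    unfolding slice_point_def scaleR_scaleR c d s_def ..
  have "slice_point W x \<bullet> slice_point W y = (s * s) * ((inverse 2 *\<^sub>R x - (1/6) *\<^sub>R W) \<bullet> (inverse 2 *\<^sub>R y - (1/6) *\<^sub>R W))"
    unfolding p by simp
  also have "(inverse 2 *\<^sub>R x - (1/6) *\<^sub>R W) \<bullet> (inverse 2 *\<^sub>R y - (1/6) *\<^sub>R W) = (x \<bullet> y) / 4 - 1/6"
    using x WW by (simp add: inner_diff_left inner_diff_right inner_commute[of W x] inner_commute[of W y])
  finally show "slice_point W x \<bullet> slice_point W y = (3 * (x \<bullet> y) - 2) / 10" unfolding s by simp
  show "slice_point W x \<bullet> W = 0" unfolding p using x WW by (simp add: inner_diff_left)
qed

lemma slice_code_image:
  assumes W: "W \<in> L" "norm W = sqrt 6" and \<phi>: "hyperplane_isometry W \<phi>"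
  defines "C \<equiv> \<phi> ` leech_slice_code L W"
  shows "spherical_code C" "card C = 11178" "inner_products C \<subseteq> {-1/2, -1/5, 1/10, 2/5}"
proof -
  define f where "f = (\<lambda>x. \<phi> (slice_point W x))"
  have C: "C = f ` slice W" by (simp add: C_def slice_code_eq f_def image_image)
  have lin: "linear \<phi>" and nrm: "\<And>x. x \<bullet> W = 0 \<Longrightarrow> norm (\<phi> x) = norm x"
    using \<phi> by (auto simp: hyperplane_isometry_def)
  have inner: "\<phi> x \<bullet> \<phi> y = x \<bullet> y" if "x \<bullet> W = 0" "y \<bullet> W = 0" for x y
  proof -
    have "(norm (\<phi> (x + y)))\<^sup>2 = (norm (x + y))\<^sup>2" using that by (simp add: nrm inner_add_left)
    then show ?thesis
      using nrm[OF that(1)] nrm[OF that(2)]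
      by (simp add: linear_add[OF lin] dot_norm)
  qed
  have fi: "f x \<bullet> f y = (3 * (x \<bullet> y) - 2) / 10" if "x \<in> slice W" "y \<in> slice W" for x y
    unfolding f_def using that W(2)
    by (subst inner) (auto simp: slice_def slice_point_inner)
  have xx: "x \<bullet> x = 4" if "x \<in> slice W" for x
    using that by (auto simp: slice_def min_vectors_def simp flip: power2_norm_eq_inner)
  have fn: "norm (f x) = 1" if "x \<in> slice W" for x
    using fi[OF that that] xx[OF that] by (simp add: norm_eq_sqrt_inner)
  have "inj_on f (slice W)"
  proof (rule inj_onI, rule ccontr)
    fix x y assume xy: "x \<in> slice W" "y \<in> slice W" "f x = f y" "x \<noteq> y"
    have "f x \<bullet> f y = 1" using fn[OF xy(2)] xy(3) by (simp flip: power2_norm_eq_inner)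
    then have "x \<bullet> y = 4" using fi[OF xy(1,2)] by simp
    then show False using slice_inner[OF W xy(1,2,4)] by auto
  qed
  then show "card C = 11178" unfolding C using card_slice[OF W] by (simp add: card_image)
  \<comment> \<open>Finiteness is read off from the nonzero cardinality.\<close>
  then show "spherical_code C"
    using fn card.infinite[of C] unfolding spherical_code_def by (auto simp: C)
  show "inner_products C \<subseteq> {-1/2, -1/5, 1/10, 2/5}"
  proof
    fix t assume "t \<in> inner_products C"
    then obtain x y where xy: "x \<in> slice W" "y \<in> slice W" "x \<noteq> y" "t = f x \<bullet> f y"
      unfolding inner_products_def C by auto
    show "t \<in> {-1/2, -1/5, 1/10, 2/5}"
      using slice_inner[OF W xy(1-3)] fi[OF xy(1,2)] xy(4) by auto
  qed
qed

end

section \<open>Attainment of 2/5 and transfer to dimension 23\<close>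

text \<open>An s-code must attain its maximum. If 2/5 were missing, the cubic with the other three
  values as roots would limit the code to about a hundred points.\<close>

lemma two_fifths_attained:
  fixes C :: "(real^23) set"
  assumes C: "spherical_code C" "card C = 11178" "inner_products C \<subseteq> {-1/2, -1/5, 1/10, 2/5}"
  shows "2/5 \<in> inner_products C"
proof (rule ccontr)
  assume no: "2/5 \<notin> inner_products C"
  define F :: "real \<Rightarrow> real" where "F = (\<lambda>t. (t + 1/2) * (t + 1/5) * (t - 1/10))"
  have "F t \<le> 0" if t: "t \<in> inner_products C" for t
  proof -
    have "F (-1/2) = 0" "F (-1/5) = 0" "F (1/10) = 0" by (simp_all add: F_def)
    moreover consider "t = -1/2" | "t = -1/5" | "t = 1/10" using t no C(3) by blast
    ultimately show ?thesis by (metis order_refl)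
  qed
  moreover have "F t = (\<Sum>k\<le>5. nth_default 0 [37/2300, 3/20, 3/5, 1] k * gegenbauer k 23 t 1)" for t
    by (simp add: F_def nth_default_def gegenbauer_def eval_nat_numeral) (simp add: field_simps)
  ultimately have "37/2300 * card C \<le> F 1 \<or> C = {}"
    using delsarte_bound_list[OF C(1), of "[37/2300, 3/20, 3/5, 1]" F] by simp
  then show False using C(2) by (auto simp: F_def)
qed

lemma hyperplane_isometry_exists:
  assumes "W \<noteq> 0" obtains \<phi> where "hyperplane_isometry W \<phi>"
proof -
  have "subspace {x. W \<bullet> x = 0}" by (rule subspace_hyperplane)
  moreover have "dim {x. W \<bullet> x = 0} = dim (UNIV :: (real^23) set)"
    using dim_hyperplane[OF assms] by (simp add: dim_UNIV)
  ultimately show ?thesis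
  proof (rule isometries_subspaces[OF _ subspace_UNIV])
    fix \<phi> :: "real^24 \<Rightarrow> real^23"
    assume "linear \<phi>" "\<And>x. x \<in> {x. W \<bullet> x = 0} \<Longrightarrow> norm (\<phi> x) = norm x"
    then show ?thesis by (intro that[of \<phi>]) (auto simp: hyperplane_isometry_def inner_commute)
  qed
qed

section \<open>Existence of the Leech lattice\<close>

text \<open>An LLL-reduced basis of \<open>\<surd>8 \<Lambda>\<^sub>2\<^sub>4\<close>, its Gram matrix divided by \<open>8\<close>, the inverse of the latter, and
  generators of the extended binary Golay code in the form \<open>(I | J - A)\<close>, where \<open>A\<close> is the adjacency
  matrix of the icosahedron. The Golay code is self-dual, so the generators are also parity checks.\<close>

definition leech_basis :: "int list list" where
  "leech_basis = [
    [-2,0,0,0,0,0,0,0,0,0,0,0,-2,0,0,-2,-2,0,0,0,-2,-2,-2,-2],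
    [2,-2,0,0,0,0,0,0,0,0,0,0,2,-2,0,2,0,-2,-2,0,2,0,0,0],
    [0,0,-2,0,0,0,0,0,0,0,0,0,0,0,-2,-2,0,-2,0,-2,0,-2,-2,-2],
    [0,-2,0,2,0,0,0,0,0,0,0,0,2,-2,2,2,0,0,0,0,0,2,0,2],
    [0,0,0,-2,0,0,0,0,0,0,0,0,-2,0,-2,-2,-2,-2,-2,0,0,0,-2,0],
    [0,0,2,0,0,0,0,0,0,0,-2,0,-2,-2,0,0,0,2,0,0,-2,-2,0,-2],
    [-3,1,1,1,1,1,1,1,1,1,1,1,1,1,1,1,1,1,1,1,1,1,1,1],
    [0,2,-2,0,0,0,0,0,0,0,0,-2,-2,0,0,-2,0,0,0,-2,-2,0,0,2],
    [0,0,0,0,0,2,0,2,0,0,0,0,0,-2,0,-2,0,-2,-2,-2,0,0,-2,0],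
    [2,2,2,-2,-2,0,0,0,0,0,0,0,-2,0,0,0,0,0,0,0,-2,2,0,0],
    [0,-2,0,0,0,2,0,0,0,0,0,0,0,0,2,2,0,0,-2,0,2,0,2,2],
    [1,1,-1,-1,1,-1,-1,1,-1,-1,-1,1,1,1,-1,-1,1,-1,1,-1,1,1,1,3],
    [1,-1,1,1,-1,1,1,-1,1,1,-1,1,1,-1,1,1,3,1,1,-1,1,1,-1,1],
    [-2,0,2,0,0,0,0,2,0,0,0,0,-2,0,0,0,0,2,-2,0,0,-2,2,0],
    [0,0,0,0,0,0,0,0,0,0,0,0,0,0,-4,0,0,0,0,0,4,0,0,0],
    [-2,0,0,2,0,2,0,0,0,0,0,0,0,2,0,-2,-2,0,2,0,0,0,0,-2],
    [0,0,-2,0,0,0,0,0,0,2,0,-2,0,0,2,-2,-2,0,0,0,-2,0,-2,0],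
    [1,-1,-1,-1,1,1,1,1,1,1,1,1,3,-1,1,1,1,-1,1,-1,1,1,-1,1],
    [1,-1,1,1,1,-1,1,-1,-1,1,-1,1,1,-1,-1,1,3,-1,-1,-1,1,-1,1,1],
    [1,1,-1,1,-1,-1,-1,1,1,1,1,1,3,-1,1,1,1,-1,-1,-1,1,-1,-1,-1],
    [0,-2,0,-2,0,-2,0,0,-2,0,0,0,0,0,0,0,-2,0,-2,2,0,0,2,0],
    [0,-2,0,2,0,2,0,0,0,0,0,0,2,0,0,0,2,-2,0,0,2,0,0,2],
    [-1,-1,1,-1,1,-1,-1,-1,1,-1,-1,1,-3,-1,-1,-1,-1,1,-1,1,-1,1,-1,-1],
    [0,-2,-2,2,-2,0,0,0,0,0,0,0,0,0,0,2,-2,0,0,0,0,0,-2,-2]]"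

definition leech_gram :: "int list list" where
  "leech_gram = [
    [4,-2,2,-2,2,2,-1,1,1,0,-2,-2,-2,1,-1,2,2,-2,-2,-1,0,-2,2,1],
    [-2,4,0,2,0,-1,-1,-2,1,-1,2,0,1,-1,1,-2,-1,2,2,2,1,2,-1,1],
    [2,0,4,-2,2,0,-2,1,2,-1,-2,0,-1,-1,1,1,1,0,0,1,-1,0,0,1],
    [-2,2,-2,4,-2,-1,1,-1,0,-1,2,0,2,-1,-1,-1,0,2,1,1,0,2,-1,1],
    [2,0,2,-2,4,0,-2,1,2,1,-1,0,-2,0,1,0,1,-1,-1,-1,1,-1,2,0],
    [2,-1,0,-1,0,4,-1,0,0,1,-1,-2,0,2,-1,0,0,-2,0,-1,0,-2,2,0],
    [-1,-1,-2,1,-2,-1,4,-1,-1,-1,1,0,1,1,0,1,-1,1,0,0,-1,1,-1,-1],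
    [1,-2,1,-1,1,0,-1,4,1,1,-1,1,-1,0,-1,0,2,-1,-1,-1,-1,-1,0,-1],
    [1,1,2,0,2,0,-1,1,4,0,0,0,0,0,0,0,1,1,0,1,-1,1,0,0],
    [0,-1,-1,-1,1,1,-1,1,0,4,-1,0,0,0,-1,-1,0,-1,-1,-1,0,-2,1,-1],
    [-2,2,-2,2,-1,-1,1,-1,0,-1,4,0,1,1,0,-1,-1,1,1,0,1,2,-1,0],
    [-2,0,0,0,0,-2,0,1,0,0,0,4,0,-1,1,-1,-1,1,1,0,0,1,-1,-2],
    [-2,1,-1,2,-2,0,1,-1,0,0,1,0,4,-1,0,-1,-1,2,2,1,-2,2,-1,0],
    [1,-1,-1,-1,0,2,1,0,0,0,1,-1,-1,4,0,0,-1,-2,0,-1,1,-1,1,-1],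
    [-1,1,1,-1,1,-1,0,-1,0,-1,0,1,0,0,4,0,-2,0,1,0,0,1,0,0],
    [2,-2,1,-1,0,0,1,0,0,-1,-1,-1,-1,0,0,4,1,-1,-2,-1,-1,0,0,1],
    [2,-1,1,0,1,0,-1,2,1,0,-1,-1,-1,-1,-2,1,4,0,-2,0,0,-1,0,1],
    [-2,2,0,2,-1,-2,1,-1,1,-1,1,1,2,-2,0,-1,0,4,1,2,-1,2,-2,0],
    [-2,2,0,1,-1,0,0,-1,0,-1,1,1,2,0,1,-2,-2,1,4,1,0,2,-1,-1],
    [-1,2,1,1,-1,-1,0,-1,1,-1,0,0,1,-1,0,-1,0,2,1,4,-1,1,-2,1],
    [0,1,-1,0,1,0,-1,-1,-1,0,1,0,-2,1,0,-1,0,-1,0,-1,4,-1,1,0],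
    [-2,2,0,2,-1,-2,1,-1,1,-2,2,1,2,-1,1,0,-1,2,2,1,-1,4,-2,0],
    [2,-1,0,-1,2,2,-1,0,0,1,-1,-1,-1,1,0,0,0,-2,-1,-2,1,-2,4,0],
    [1,1,1,1,0,0,-1,-1,0,-1,0,-2,0,-1,0,1,1,0,-1,1,0,0,0,4]]"

definition leech_gram_inv :: "int list list" where
  "leech_gram_inv = [
    [34,27,-19,-19,-26,-12,3,13,4,8,-4,8,4,-1,7,2,1,4,5,-2,3,3,8,5],
    [27,38,-14,-20,-21,-11,8,15,1,5,-9,10,10,3,1,4,1,0,0,-5,3,1,7,5],
    [-19,-14,38,25,8,5,5,-20,-7,6,10,-1,-4,4,-1,-8,9,-11,-7,-5,-6,-5,-5,-10],
    [-19,-20,25,22,13,6,-1,-16,-5,1,8,-4,-5,2,-1,-5,4,-6,-4,-1,-5,-4,-6,-8],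
    [-26,-21,8,13,26,11,-4,-6,-4,-10,1,-7,-1,0,-7,1,-5,-1,-4,4,-1,-2,-8,-3],
    [-12,-11,5,6,11,8,0,-2,-2,-3,2,-3,-2,-2,-2,0,-2,0,-2,3,1,1,-3,-1],
    [3,8,5,-1,-4,0,6,1,-1,3,0,3,2,0,0,-1,2,-3,-2,-2,1,0,1,0],
    [13,15,-20,-16,-6,-2,1,16,2,-2,-7,2,5,-2,0,6,-6,6,2,3,6,4,4,6],
    [4,1,-7,-5,-4,-2,-1,2,4,-1,-1,0,0,-2,1,0,-1,1,2,0,1,0,1,2],
    [8,5,6,1,-10,-3,3,-2,-1,8,3,3,-2,1,4,-2,5,-1,1,-2,-1,1,3,-1],
    [-4,-9,10,8,1,2,0,-7,-1,3,6,-1,-4,-1,2,-3,3,-2,0,0,-2,-1,-1,-3],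
    [8,10,-1,-4,-7,-3,3,2,0,3,-1,4,2,1,1,0,2,-1,0,-2,0,0,2,1],
    [4,10,-4,-5,-1,-2,2,5,0,-2,-4,2,6,1,-2,2,-2,-1,-2,-1,2,-1,0,1],
    [-1,3,4,2,0,-2,0,-2,-2,1,-1,1,1,4,-1,0,2,-1,-1,-2,-2,-1,0,-1],
    [7,1,-1,-1,-7,-2,0,0,1,4,2,1,-2,-1,4,-1,2,1,2,0,0,1,2,0],
    [2,4,-8,-5,1,0,-1,6,0,-2,-3,0,2,0,-1,4,-3,3,1,2,2,1,1,2],
    [1,1,9,4,-5,-2,2,-6,-1,5,3,2,-2,2,2,-3,6,-3,0,-3,-3,-1,1,-2],
    [4,0,-11,-6,-1,0,-3,6,1,-1,-2,-1,-1,-1,1,3,-3,6,3,3,2,3,2,3],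
    [5,0,-7,-4,-4,-2,-2,2,2,1,0,0,-2,-1,2,1,0,3,4,1,0,1,2,2],
    [-2,-5,-5,-1,4,3,-2,3,0,-2,0,-2,-1,-2,0,2,-3,3,1,4,2,2,0,1],
    [3,3,-6,-5,-1,1,1,6,1,-1,-2,0,2,-2,0,2,-3,2,0,2,4,2,1,2],
    [3,1,-5,-4,-2,1,0,4,0,1,-1,0,-1,-1,1,1,-1,3,1,2,2,4,2,2],
    [8,7,-5,-6,-8,-3,1,4,1,3,-1,2,0,0,2,1,1,2,2,0,1,2,4,2],
    [5,5,-10,-8,-3,-1,0,6,2,-1,-3,1,1,-1,0,2,-2,3,2,1,2,2,2,4]]"

definition golay_generators :: "int list list" where
  "golay_generators = [
    [1,0,0,0,0,0,0,0,0,0,0,0,1,0,0,1,1,0,0,0,1,1,1,1],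
    [0,1,0,0,0,0,0,0,0,0,0,0,0,1,0,0,1,1,1,0,0,1,1,1],
    [0,0,1,0,0,0,0,0,0,0,0,0,0,0,1,1,0,1,0,1,0,1,1,1],
    [0,0,0,1,0,0,0,0,0,0,0,0,1,0,1,1,1,1,1,0,0,0,1,0],
    [0,0,0,0,1,0,0,0,0,0,0,0,1,1,0,1,1,1,0,1,0,0,0,1],
    [0,0,0,0,0,1,0,0,0,0,0,0,0,1,1,1,1,1,0,0,1,1,0,0],
    [0,0,0,0,0,0,1,0,0,0,0,0,0,1,0,1,0,0,1,1,1,1,0,1],
    [0,0,0,0,0,0,0,1,0,0,0,0,0,0,1,0,1,0,1,1,1,1,1,0],
    [0,0,0,0,0,0,0,0,1,0,0,0,1,0,0,0,0,1,1,1,1,0,1,1],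
    [0,0,0,0,0,0,0,0,0,1,0,0,1,1,1,0,0,1,1,1,0,1,0,0],
    [0,0,0,0,0,0,0,0,0,0,1,0,1,1,1,1,0,0,0,1,1,0,1,0],
    [0,0,0,0,0,0,0,0,0,0,0,1,1,1,1,0,1,0,1,0,1,0,0,1]]"

section \<open>Computed facts about the tables\<close>

definition list_dot :: "int list \<Rightarrow> int list \<Rightarrow> int" where
  "list_dot xs ys = sum_list (map2 (*) xs ys)"

lemma leech_gram_check: "map (\<lambda>r. map (list_dot r) leech_basis) leech_basis = map (map ((*) 8)) leech_gram"
  by code_simp

text \<open>An inverse with integer entries certifies unimodularity: the dual basis has integer
  coordinates in the basis.\<close>

lemma leech_gram_inv_check:
  "map (\<lambda>r. map (list_dot r) leech_gram_inv) leech_gram = map (\<lambda>i. map (\<lambda>j. if i = j then 1 else 0) [0..<24]) [0..<24]"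
  by code_simp

lemma leech_basis_lengths:
  "length leech_basis = 24" "length leech_gram = 24" "length leech_gram_inv = 24" "length golay_generators = 12"
  "list_all (\<lambda>r. length r = 24) (leech_basis @ leech_gram @ leech_gram_inv @ golay_generators)"
  by code_simp+

text \<open>The classical congruences for the scaled Leech lattice: common parity of the
  coordinates, orthogonality to the Golay code modulo 4, and the coordinate sum modulo 8. All are
  linear, so they pass from the basis to every lattice vector.\<close>

lemma leech_basis_congruences:
  "list_all (\<lambda>r. list_all (\<lambda>x. even (x - hd r)) r) leech_basis"
  "list_all (\<lambda>r. list_all (\<lambda>h. list_dot h r mod 4 = 0) golay_generators) leech_basis"
  "list_all (\<lambda>r. (sum_list r - 4 * hd r) mod 8 = 0) leech_basis"
  by code_simp+

lemma leech_gram_even: "list_all (\<lambda>i. leech_gram ! i ! i = 4) [0..<24]"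
  by code_simp

definition pair_syndrome :: "nat \<times> nat \<Rightarrow> bool list" where
  "pair_syndrome = (\<lambda>(a, b). map (\<lambda>h. odd (h ! a + h ! b)) golay_generators)"

text \<open>Checking pairs is a cheap way to exclude code words of weight 4: four distinct columns
  with even sum would give two pairs with equal syndromes.\<close>

lemma pair_syndromes_distinct:
  "distinct (map pair_syndrome (concat (map (\<lambda>a. map (\<lambda>b. (a, b)) [0..<a]) [0..<24])))"
  by code_simp

text \<open>Two minimal vectors with inner product -1 have a sum of norm 4 + 4 - 2 = 6, which serves
  as \<open>W\<close>.\<close>

lemma leech_gram_entry: "leech_gram ! 5 ! 1 = -1"
  by code_simp

definition mat :: "nat \<Rightarrow> nat \<Rightarrow> int" where "mat i k = leech_basis ! i ! k"
definition gram :: "nat \<Rightarrow> nat \<Rightarrow> int" where "gram i k = leech_gram ! i ! k"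
definition gram_inv :: "nat \<Rightarrow> nat \<Rightarrow> int" where "gram_inv i k = leech_gram_inv ! i ! k"

lemma list_dot_eq_sum:
  assumes "length xs = n" "length ys = n"
  shows "list_dot xs ys = (\<Sum>k<n. xs ! k * ys ! k)"
  using assms by (simp add: list_dot_def sum_list_sum_nth atLeast0LessThan)

lemma row_lengths:
  assumes "i < 24"
  shows "length (leech_basis ! i) = 24" "length (leech_gram ! i) = 24" "length (leech_gram_inv ! i) = 24"
proof -
  have "leech_basis ! i \<in> set leech_basis" "leech_gram ! i \<in> set leech_gram"
    "leech_gram_inv ! i \<in> set leech_gram_inv"
    using assms leech_basis_lengths(1-3) by simp_all
  then show "length (leech_basis ! i) = 24" "length (leech_gram ! i) = 24" "length (leech_gram_inv ! i) = 24"
    using leech_basis_lengths(5) by (auto simp: list_all_iff)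
qed

lemma golay_lengths: "h \<in> set golay_generators \<Longrightarrow> length h = 24"
  using leech_basis_lengths(5) by (auto simp: list_all_iff)

lemma mat_gram:
  assumes "i < 24" "j < 24"
  shows "(\<Sum>k<24. mat i k * mat j k) = 8 * gram i j"
proof -
  have "map (\<lambda>r. map (list_dot r) leech_basis) leech_basis ! i ! j = map (map ((*) 8)) leech_gram ! i ! j"
    by (simp only: leech_gram_check)
  then show ?thesis
    using assms leech_basis_lengths(1,2) row_lengths[of i] row_lengths[of j]
    by (simp add: list_dot_eq_sum[where n = 24] mat_def gram_def)
qed

lemma gram_mult_inv:
  assumes "i < 24" "j < 24"
  shows "(\<Sum>k<24. gram i k * gram_inv j k) = (if i = j then 1 else 0)"
proof -
  have "map (\<lambda>r. map (list_dot r) leech_gram_inv) leech_gram ! i ! j =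
      map (\<lambda>i. map (\<lambda>j. if i = j then 1 else 0) [0..<24]) [0..<24] ! i ! j"
    by (simp only: leech_gram_inv_check)
  then show ?thesis
    using assms leech_basis_lengths(2,3) row_lengths[of i] row_lengths[of j]
    by (simp add: list_dot_eq_sum[where n = 24] gram_def gram_inv_def)
qed

lemma gram_diag: "i < 24 \<Longrightarrow> gram i i = 4"
  using leech_gram_even by (simp add: list_all_iff gram_def)

lemma mat_congruences:
  assumes "i < 24"
  shows "k < 24 \<Longrightarrow> even (mat i k - mat i 0)"
    and "h \<in> set golay_generators \<Longrightarrow> (\<Sum>k<24. h ! k * mat i k) mod 4 = 0"
    and "((\<Sum>k<24. mat i k) - 4 * mat i 0) mod 8 = 0"
proof -
  define r where "r = leech_basis ! i"
  have r: "r \<in> set leech_basis" "length r = 24"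
    using assms leech_basis_lengths(1) row_lengths(1)[OF assms] by (auto simp: r_def)
  then have "r \<noteq> []" by auto
  then have r3: "hd r = mat i 0" by (simp add: hd_conv_nth r_def mat_def)
  have mat: "mat i k = r ! k" for k by (simp add: mat_def r_def)
  show "even (mat i k - mat i 0)" if "k < 24"
    using leech_basis_congruences(1) r that unfolding r3[symmetric] mat[of k]
    by (auto simp: list_all_iff)
  show "(\<Sum>k<24. h ! k * mat i k) mod 4 = 0" if "h \<in> set golay_generators"
  proof -
    have "list_dot h r mod 4 = 0"
      using leech_basis_congruences(2) r(1) that by (auto simp: list_all_iff)
    then show ?thesis
      unfolding mat by (simp add: list_dot_eq_sum[OF golay_lengths[OF that] r(2)])
  qed
  show "((\<Sum>k<24. mat i k) - 4 * mat i 0) mod 8 = 0"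
  proof -
    have "(sum_list r - 4 * hd r) mod 8 = 0"
      using leech_basis_congruences(3) r(1) by (auto simp: list_all_iff)
    then show ?thesis
      unfolding r3[symmetric] mat by (simp add: sum_list_sum_nth atLeast0LessThan r(2) hd_conv_nth[OF \<open>r \<noteq> []\<close>])
  qed
qed

section \<open>Absence of vectors of norm 2\<close>

lemma syndrome_pair_inj:
  assumes "a < 24" "b < a" "c < 24" "d < c" "pair_syndrome (a, b) = pair_syndrome (c, d)"
  shows "a = c \<and> b = d"
proof -
  define ps where "ps = concat (map (\<lambda>a. map (\<lambda>b. (a, b)) [0..<a]) [0..<24])"
  have "inj_on pair_syndrome (set ps)"
    using pair_syndromes_distinct unfolding ps_def[symmetric] distinct_map by blast
  moreover have "(a, b) \<in> set ps" "(c, d) \<in> set ps" using assms by (force simp: ps_def)+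
  ultimately show ?thesis using assms(5) by (auto dest: inj_onD)
qed

lemma four_columns_independent:
  assumes "a < 24" "b < 24" "c < 24" "d < 24" "distinct [a, b, c, d]"
  shows "\<exists>h\<in>set golay_generators. odd (h ! a + h ! b + h ! c + h ! d)"
proof (rule ccontr)
  assume "\<not> ?thesis"
  then have ev: "even (h ! a + h ! b + h ! c + h ! d)" if "h \<in> set golay_generators" for h
    using that by blast
  have "pair_syndrome (max a b, min a b) = pair_syndrome (max c d, min c d)"
    unfolding pair_syndrome_def prod.case
  proof (rule map_cong[OF refl])
    fix h assume h: "h \<in> set golay_generators"
    have "h ! max a b + h ! min a b = h ! a + h ! b" "h ! max c d + h ! min c d = h ! c + h ! d"
      by (auto simp: max_def min_def)
    then show "odd (h ! max a b + h ! min a b) = odd (h ! max c d + h ! min c d)"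
      using ev[OF h] by (simp only:) auto
  qed
  then have "max a b = max c d \<and> min a b = min c d"
    using assms by (intro syndrome_pair_inj) auto
  then show False using assms(5) by (auto simp: max_def min_def split: if_splits)
qed

text \<open>A root has sum of squares 16 in the scaled coordinates. Odd coordinates already give 24.
  Even ones, halved, have sum of squares 4: either a single entry 2 or -2, whose sum violates the
  congruence modulo 8, or four entries 1 or -1, whose support would be a Golay word of weight
  4.\<close>

lemma no_roots:
  fixes z :: "nat \<Rightarrow> int"
  assumes par: "\<And>k. k < 24 \<Longrightarrow> even (z k - z 0)"
    and golay: "\<And>h. h \<in> set golay_generators \<Longrightarrow> (\<Sum>k<24. h ! k * z k) mod 4 = 0"
    and sum: "((\<Sum>k<24. z k) - 4 * z 0) mod 8 = 0"
  shows "(\<Sum>k<24. (z k)\<^sup>2) \<noteq> 16"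
proof
  assume n: "(\<Sum>k<24. (z k)\<^sup>2) = 16"
  show False
  proof (cases "even (z 0)")
    case False
    have "1 \<le> (z k)\<^sup>2" if "k < 24" for k
    proof -
      have "z k \<noteq> 0" using par[OF that] False by auto
      then show ?thesis by (simp add: int_one_le_iff_zero_less)
    qed
    then have "(\<Sum>k<24::nat. 1::int) \<le> (\<Sum>k<24. (z k)\<^sup>2)" by (intro sum_mono) auto
    then show False using n by simp
  next
    case True
    define y where "y = (\<lambda>k. z k div 2)"
    have z: "z k = 2 * y k" if "k < 24" for k
      using par[OF that] True by (auto simp: y_def)
    have "(\<Sum>k<24. (z k)\<^sup>2) = (\<Sum>k<24. 4 * (y k)\<^sup>2)"
      by (intro sum.cong refl) (simp add: z power_mult_distrib)
    then have ny: "(\<Sum>k<24. (y k)\<^sup>2) = 4" using n by (simp flip: sum_distrib_left)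
    define S where "S = {k. k < 24 \<and> y k \<noteq> 0}"
    have fin: "finite S" and S24: "S \<subseteq> {..<24}" by (auto simp: S_def)
    have restrict: "(\<Sum>k<24. g k) = (\<Sum>k\<in>S. g k)" if "\<And>k. k < 24 \<Longrightarrow> y k = 0 \<Longrightarrow> g k = 0" for g :: "nat \<Rightarrow> int"
      using that S24 by (intro sum.mono_neutral_right) (auto simp: S_def)
    have nS: "(\<Sum>k\<in>S. (y k)\<^sup>2) = 4" using ny restrict[of "\<lambda>k. (y k)\<^sup>2"] by simp
    show False
    proof (cases "\<exists>a\<in>S. \<bar>y a\<bar> \<ge> 2")
      case True
      then obtain a where a: "a \<in> S" "\<bar>y a\<bar> \<ge> 2" by blast
      have "2\<^sup>2 \<le> \<bar>y a\<bar>\<^sup>2" using a(2) by (intro power_mono) auto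
      then have "2\<^sup>2 \<le> (y a)\<^sup>2" by simp
      moreover have split: "(\<Sum>k\<in>S. (y k)\<^sup>2) = (y a)\<^sup>2 + (\<Sum>k\<in>S - {a}. (y k)\<^sup>2)"
        using a(1) fin by (simp add: sum.remove)
      moreover have "(\<Sum>k\<in>S - {a}. 1) \<le> (\<Sum>k\<in>S - {a}. (y k)\<^sup>2)"
        by (intro sum_mono) (auto simp: S_def int_one_le_iff_zero_less)
      moreover have "(\<Sum>k\<in>S - {a}. 1) = int (card (S - {a}))" "(2::int)\<^sup>2 = 4" by simp_all
      ultimately have c: "int (card (S - {a})) = 0" and ya: "(y a)\<^sup>2 \<le> 2\<^sup>2"
        using nS by linarith+
      from c have "S - {a} = {}" using fin by (simp only: of_nat_eq_0_iff card_eq_0_iff) blast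
      then have "S = {a}" using a(1) by blast
      moreover have "\<bar>y a\<bar> \<le> 2" using ya abs_le_square_iff[of "y a" 2] by simp
      ultimately have "S = {a}" "\<bar>y a\<bar> \<le> 2" by blast+
      with a(2) have ya: "y a = 2 \<or> y a = - 2" by linarith
      have "(\<Sum>k<24. z k) = z a" using restrict[of z] z \<open>S = {a}\<close> by simp
      moreover have "a < 24" using a(1) S24 by auto
      ultimately have "(2 * y a - 8 * y 0) mod 8 = 0" using sum z[of a] z[of 0] by simp
      then show False using ya by presburger
    next
      case False
      have y1: "\<bar>y k\<bar> = 1" if "k \<in> S" for k using that False by (force simp: S_def)
      have y_odd: "odd (y k)" if "k \<in> S" for k
        using y1[OF that] by (auto simp: abs_if split: if_splits)
      have "(\<Sum>k\<in>S. (y k)\<^sup>2) = (\<Sum>k\<in>S. 1)"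
        using y1 by (intro sum.cong refl) (metis power2_abs one_power2)
      then have "card S = 4" using nS by simp
      then obtain a b c d where S: "S = {a, b, c, d}" and dist: "distinct [a, b, c, d]"
        by (auto simp: card_Suc_eq numeral_eq_Suc)
      have "a < 24" "b < 24" "c < 24" "d < 24" using S S24 by auto
      then obtain h where h: "h \<in> set golay_generators" "odd (h ! a + h ! b + h ! c + h ! d)"
        using four_columns_independent[OF _ _ _ _ dist] by blast
      have "(\<Sum>k<24. h ! k * z k) = (\<Sum>k\<in>S. h ! k * z k)" using z by (intro restrict) simp
      also have "\<dots> = (\<Sum>k\<in>S. 2 * (h ! k * y k))" using S24 z by (intro sum.cong) auto
      also have "\<dots> = 2 * (h ! a * y a + h ! b * y b + h ! c * y c + h ! d * y d)"
        using dist by (simp add: S)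
      finally have mod4: "(2 * (h ! a * y a + h ! b * y b + h ! c * y c + h ! d * y d)) mod 4 = 0"
        using golay[OF h(1)] by simp
      have ev: "even s" if "(2 * s) mod 4 = 0" for s :: int using that by presburger
      from mod4 have "even (h ! a * y a + h ! b * y b + h ! c * y c + h ! d * y d)" by (rule ev)
      moreover have "odd (y a)" "odd (y b)" "odd (y c)" "odd (y d)"
        using y_odd by (simp_all add: S)
      ultimately show False using h(2) by auto
    qed
  qed
qed

section \<open>A concrete Leech lattice\<close>

lemma leech_lattice_exists:
  obtains L :: "(real^24) set" and W where "leech_lattice L" "W \<in> L" "norm W = sqrt 6"
proof -
  \<comment> \<open>Any enumeration of the coordinates serves, since inner products do not depend on
    it.\<close>
  obtain idx :: "24 \<Rightarrow> nat" where idx: "bij_betw idx UNIV {..<24}"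
    using finite_same_card_bij[of "UNIV :: 24 set" "{..<24::nat}"] by auto
  define vec :: "(nat \<Rightarrow> int) \<Rightarrow> real^24" where "vec = (\<lambda>f. (1 / sqrt 8) *\<^sub>R (\<chi> j. of_int (f (idx j))))"
  have vec_inner: "vec f \<bullet> vec g = of_int (\<Sum>k<24. f k * g k) / 8" for f g
  proof -
    have "vec f \<bullet> vec g = (1 / sqrt 8 * (1 / sqrt 8)) * (\<Sum>j\<in>UNIV. of_int (f (idx j)) * of_int (g (idx j)))"
      unfolding vec_def inner_scaleR_left inner_scaleR_right
      unfolding inner_vec_def by (simp only: mult.assoc vec_lambda_beta inner_real_def)
    also have "1 / sqrt 8 * (1 / sqrt 8) = (1/8 :: real)" by simp
    also have "(\<Sum>j\<in>UNIV. of_int (f (idx j)) * of_int (g (idx j))) = (\<Sum>k<24. of_int (f k) * of_int (g k) :: real)"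
      by (rule sum.reindex_bij_betw[OF idx, of "\<lambda>k. of_int (f k) * of_int (g k) :: real"])
    finally show ?thesis by simp
  qed
  define b where "b = (\<lambda>i. vec (mat i))"
  have b_inner: "b i \<bullet> b j = of_int (gram i j)" if "i < 24" "j < 24" for i j
    unfolding b_def vec_inner mat_gram[OF that] by simp
  \<comment> \<open>The dual basis, written with the inverse Gram matrix.\<close>
  define d where "d = (\<lambda>k. \<Sum>j<24. of_int (gram_inv k j) *\<^sub>R b j)"
  have bd: "b i \<bullet> d k = (if i = k then 1 else 0)" if "i < 24" "k < 24" for i k
  proof -
    have "b i \<bullet> d k = (\<Sum>j<24. of_int (gram_inv k j) * of_int (gram i j))"
      using that by (simp add: d_def inner_sum_right b_inner)
    also have "\<dots> = of_int (\<Sum>j<24. gram i j * gram_inv k j)" by (simp add: mult.commute)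
    finally show ?thesis unfolding gram_mult_inv[OF that] by simp
  qed
  have comb_d: "(\<Sum>i<24. r i *\<^sub>R b i) \<bullet> d k = r k" if "k < 24" for r k
  proof -
    have "(\<Sum>i<24. r i *\<^sub>R b i) \<bullet> d k = (\<Sum>i<24. if i = k then r i else 0)"
      using that by (simp add: inner_sum_left bd if_distrib cong: if_cong)
    then show ?thesis using that by simp
  qed
  define B where "B = b ` {..<24}"
  have inj: "inj_on b {..<24}"
  proof (rule inj_onI, rule ccontr)
    fix i j :: nat assume ij: "i \<in> {..<24}" "j \<in> {..<24}" "b i = b j" "i \<noteq> j"
    then show False using bd[of i i] bd[of j i] by auto
  qed
  have finB: "finite B" and cardB: "card B = 24" using inj by (simp_all add: B_def card_image)
  have sumB: "(\<Sum>v\<in>B. f v *\<^sub>R v) = (\<Sum>i<24. f (b i) *\<^sub>R b i)" for f :: "real^24 \<Rightarrow> real"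
    unfolding B_def using inj by (simp add: sum.reindex)
  have ind: "independent B"
  proof (rule independent_if_scalars_zero[OF finB])
    fix f v assume "(\<Sum>v\<in>B. f v *\<^sub>R v) = 0" "v \<in> B"
    then obtain k where "k < 24" "v = b k" "(\<Sum>i<24. f (b i) *\<^sub>R b i) = 0"
      unfolding sumB by (auto simp: B_def)
    then show "f v = 0" using comb_d[of k "\<lambda>i. f (b i)"] by simp
  qed
  have span: "span B = UNIV"
    using dim_eq_card_independent[OF ind] cardB by (simp flip: dim_eq_full)
  define L where "L = {\<Sum>b\<in>B. of_int (c b) *\<^sub>R b | c :: real^24 \<Rightarrow> int. True}"
  have L_iff: "x \<in> L \<longleftrightarrow> (\<exists>c :: nat \<Rightarrow> int. x = (\<Sum>i<24. of_int (c i) *\<^sub>R b i))" for x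
  proof
    assume "x \<in> L"
    then obtain c :: "real^24 \<Rightarrow> int" where "x = (\<Sum>i<24. of_int (c (b i)) *\<^sub>R b i)"
      unfolding L_def sumB by blast
    then show "\<exists>c :: nat \<Rightarrow> int. x = (\<Sum>i<24. of_int (c i) *\<^sub>R b i)"
      by (intro exI[of _ "\<lambda>i. c (b i)"])
  next
    assume "\<exists>c :: nat \<Rightarrow> int. x = (\<Sum>i<24. of_int (c i) *\<^sub>R b i)"
    then obtain c :: "nat \<Rightarrow> int" where "x = (\<Sum>i<24. of_int (c i) *\<^sub>R b i)" by blast
    also have "\<dots> = (\<Sum>v\<in>B. of_int (c (inv_into {..<24} b v)) *\<^sub>R v)"
      unfolding sumB using inj by (intro sum.cong) auto
    finally have "\<exists>c :: real^24 \<Rightarrow> int. x = (\<Sum>v\<in>B. of_int (c v) *\<^sub>R v)"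
      by (intro exI[of _ "\<lambda>v. c (inv_into {..<24} b v)"])
    then show "x \<in> L" unfolding L_def by simp
  qed
  have bL: "b k \<in> L" if "k < 24" for k
  proof -
    have "(\<Sum>i<24. of_int (if i = k then 1 else 0) *\<^sub>R b i) = (\<Sum>i<24. if i = k then b i else 0)"
      by (intro sum.cong) auto
    then have "b k = (\<Sum>i<24. of_int (if i = k then 1 else 0) *\<^sub>R b i)" using that by simp
    then show ?thesis unfolding L_iff by (rule exI[of "\<lambda>c :: nat \<Rightarrow> int. b k = (\<Sum>i<24. of_int (c i) *\<^sub>R b i)"])
  qed
  have lattice: "is_lattice L"
    unfolding is_lattice_def L_def using ind span by blast
  have b_int: "x \<bullet> b k \<in> \<int>" if "x \<in> L" "k < 24" for x k
    using that unfolding L_iff by (auto simp: inner_sum_left b_inner intro!: Ints_sum)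
  have unimod: "unimodular L"
    unfolding unimodular_def dual_lattice_def
  proof (intro equalityI subsetI CollectI ballI)
    fix x y assume "y \<in> L" "x \<in> L"
    then show "x \<bullet> y \<in> \<int>"
      unfolding L_iff[of y] using b_int[of x] by (auto simp: inner_sum_right intro!: Ints_sum)
  next
    fix y assume "y \<in> {y. \<forall>x\<in>L. x \<bullet> y \<in> \<int>}"
    then have y: "x \<bullet> y \<in> \<int>" if "x \<in> L" for x using that by blast
    have "y \<in> span B" using span by simp
    then obtain f where "y = (\<Sum>v\<in>B. f v *\<^sub>R v)" using finB by (auto simp: span_finite)
    then have yf: "y = (\<Sum>i<24. f (b i) *\<^sub>R b i)" unfolding sumB .
    have "f (b k) \<in> \<int>" if "k < 24" for k
    proof -
      \<comment> \<open>The coordinates of a dual vector are its pairings with the dual basis, which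
        consists of integral combinations of the \<open>b j\<close>.\<close>
      have "f (b k) = y \<bullet> d k" using comb_d[OF that, of "\<lambda>i. f (b i)"] yf by simp
      also have "\<dots> = (\<Sum>j<24. of_int (gram_inv k j) * (b j \<bullet> y))"
        by (simp add: d_def inner_sum_right inner_commute[of y])
      also have "\<dots> \<in> \<int>" using y bL by (auto intro!: Ints_sum)
      finally show ?thesis .
    qed
    then have "y = (\<Sum>i<24. of_int \<lfloor>f (b i)\<rfloor> *\<^sub>R b i)"
      unfolding yf by (intro sum.cong) auto
    then show "y \<in> L" unfolding L_iff by (intro exI[of _ "\<lambda>i. \<lfloor>f (b i)\<rfloor>"])
  qed
  have even: "\<exists>k::int. x \<bullet> x = 2 * of_int k" if xL: "x \<in> L" for x
  proof -
    obtain c :: "nat \<Rightarrow> int" where x: "x = (\<Sum>i<24. of_int (c i) *\<^sub>R b i)" using xL unfolding L_iff by blast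
    \<comment> \<open>Adding one basis vector at a time: its square contributes a multiple of 4 and
      the cross term occurs twice, so the parity of the norm is preserved.\<close>
    have "\<exists>k::int. (\<Sum>i<n. of_int (c i) *\<^sub>R b i) \<bullet> (\<Sum>i<n. of_int (c i) *\<^sub>R b i) = 2 * of_int k" if "n \<le> 24" for n
      using that
    proof (induction n)
      case 0
      then show ?case by (intro exI[of _ 0]) simp
    next
      case (Suc n)
      define s where "s = (\<Sum>i<n. of_int (c i) *\<^sub>R b i)"
      from Suc obtain k :: int where k: "s \<bullet> s = 2 * of_int k" unfolding s_def by auto
      have "s \<bullet> b n = of_int (\<Sum>i<n. c i * gram i n)"
        using Suc.prems by (simp add: s_def inner_sum_left b_inner)
      then have "(s + of_int (c n) *\<^sub>R b n) \<bullet> (s + of_int (c n) *\<^sub>R b n) =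
          2 * of_int (k + c n * (\<Sum>i<n. c i * gram i n) + 2 * (c n)\<^sup>2)"
        using k b_inner[of n n] gram_diag[of n] Suc.prems
        by (simp add: inner_add_left inner_add_right inner_commute[of "b n" s] power2_eq_square algebra_simps)
      then show ?case unfolding sum.lessThan_Suc s_def[symmetric] by blast
    qed
    from this[of 24] show ?thesis by (simp add: x)
  qed
  have min: "4 \<le> x \<bullet> x" if x: "x \<in> L" "x \<noteq> 0" for x
  proof -
    obtain c :: "nat \<Rightarrow> int" where c: "x = (\<Sum>i<24. of_int (c i) *\<^sub>R b i)" using x(1) unfolding L_iff by blast
    define z where "z = (\<lambda>k. \<Sum>i<24. c i * mat i k)"
    have "x = vec z"
      unfolding c b_def vec_def z_def
      by (simp add: vec_eq_iff sum_divide_distrib)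
    then have xx: "x \<bullet> x = of_int (\<Sum>k<24. (z k)\<^sup>2) / 8" by (simp add: vec_inner power2_eq_square)
    have "(\<Sum>k<24. (z k)\<^sup>2) \<noteq> 16"
    proof (rule no_roots)
      show "even (z k - z 0)" if "k < 24" for k
      proof -
        have "z k - z 0 = (\<Sum>i<24. c i * (mat i k - mat i 0))"
          by (simp add: z_def right_diff_distrib sum_subtractf)
        also have "even \<dots>"
          by (rule dvd_sum, rule dvd_mult, rule mat_congruences(1)) (use that in auto)
        finally show ?thesis .
      qed
      show "(\<Sum>k<24. h ! k * z k) mod 4 = 0" if "h \<in> set golay_generators" for h
      proof -
        have eq: "(\<Sum>k<24. h ! k * z k) = (\<Sum>i<24. c i * (\<Sum>k<24. h ! k * mat i k))"
          unfolding z_def sum_distrib_left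
          by (subst sum.swap) (intro sum.cong refl mult.left_commute)
        have d4: "4 dvd (\<Sum>k<24. h ! k * mat i k)" if "i < 24" for i
          using mat_congruences(2)[OF that \<open>h \<in> set golay_generators\<close>] by (simp only: dvd_eq_mod_eq_0)
        have "4 dvd (\<Sum>i<24. c i * (\<Sum>k<24. h ! k * mat i k))"
          by (rule dvd_sum, rule dvd_mult, rule d4) simp
        then show ?thesis unfolding eq by (simp only: dvd_eq_mod_eq_0)
      qed
      show "((\<Sum>k<24. z k) - 4 * z 0) mod 8 = 0"
      proof -
        have eq: "(\<Sum>k<24. z k) - 4 * z 0 = (\<Sum>i<24. c i * ((\<Sum>k<24. mat i k) - 4 * mat i 0))"
        proof -
          have "(\<Sum>k<24. z k) = (\<Sum>i<24. c i * (\<Sum>k<24. mat i k))"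
            unfolding z_def sum_distrib_left by (rule sum.swap)
          moreover have "4 * z 0 = (\<Sum>i<24. c i * (4 * mat i 0))"
            unfolding z_def sum_distrib_left by (intro sum.cong refl mult.left_commute)
          ultimately show ?thesis by (simp only: right_diff_distrib sum_subtractf)
        qed
        have d8: "8 dvd ((\<Sum>k<24. mat i k) - 4 * mat i 0)" if "i < 24" for i
          using mat_congruences(3)[OF that] by (simp only: dvd_eq_mod_eq_0)
        have "8 dvd (\<Sum>i<24. c i * ((\<Sum>k<24. mat i k) - 4 * mat i 0))"
          by (rule dvd_sum, rule dvd_mult, rule d8) simp
        then show ?thesis unfolding eq by (simp only: dvd_eq_mod_eq_0)
      qed
    qed
    \<comment> \<open>Norm 2 corresponds to 16 before the scaling by 1 / sqrt 8. A positive even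
      norm other than 2 is at least 4.\<close>
    then have "x \<bullet> x \<noteq> 2"
    proof (rule contrapos_nn)
      assume "x \<bullet> x = 2"
      then have "real_of_int (\<Sum>k<24. (z k)\<^sup>2) = real_of_int 16" unfolding xx by linarith
      then show "(\<Sum>k<24. (z k)\<^sup>2) = 16" by (simp only: of_int_eq_iff)
    qed
    moreover obtain m :: int where m: "x \<bullet> x = 2 * of_int m" using even[OF x(1)] by blast
    moreover have "x \<bullet> x > 0" using x(2) by simp
    ultimately have "m > 0" "m \<noteq> 1" by auto
    then show ?thesis using m by simp
  qed
  have "b 0 \<bullet> b 0 = 4" "b 0 \<in> L" using b_inner[of 0 0] gram_diag[of 0] bL[of 0] by auto
  then have "has_minimum_norm L 4"
    unfolding has_minimum_norm_def using min by (intro conjI bexI[of _ "b 0"]) auto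
  then have leech: "leech_lattice L"
    unfolding leech_lattice_def even_lattice_def using lattice unimod even by blast
  define W where "W = b 5 + b 1"
  have "b 5 \<bullet> b 1 = -1" using b_inner[of 5 1] leech_gram_entry by (simp add: gram_def)
  moreover from this have "b 1 \<bullet> b 5 = -1" by (simp add: inner_commute)
  ultimately have "W \<bullet> W = 6"
    using b_inner[of 5 5] b_inner[of 1 1] gram_diag[of 5] gram_diag[of 1]
    unfolding W_def inner_add_left inner_add_right by simp
  moreover have "W \<in> L"
  proof -
    have "b 5 \<in> dual_lattice L" "b 1 \<in> dual_lattice L" using bL[of 5] bL[of 1] unimod by (auto simp: unimodular_def)
    then have "W \<in> dual_lattice L" by (auto simp: dual_lattice_def W_def inner_add_right)
    then show ?thesis using unimod by (simp add: unimodular_def)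
  qed
  ultimately show ?thesis using leech by (intro that[of L W]) (simp_all add: norm_eq_sqrt_inner)
qed

section \<open>Assembly: upper bounds and the attaining slice\<close>

text \<open>\<open>Max\<close> is meaningful only on a finite set; infinitely many codes compete,
  but their sizes are bounded.\<close>

lemma codes_finite_image:
  assumes "\<And>C :: (real^'n) set. P C \<Longrightarrow> card C \<le> N"
  shows "finite (card ` {C. P C})"
  by (rule finite_subset[of _ "{..N}"]) (use assms in auto)

lemma max_code_size_eq:
  fixes C :: "(real^'n) set"
  assumes bound: "\<And>C :: (real^'n) set. spherical_code C \<Longrightarrow> max_inner_product_le C s \<Longrightarrow> avoiding T C \<Longrightarrow> card C \<le> N"
    and C: "spherical_code C" "max_inner_product_le C s" "avoiding T C" "card C = N"
  shows "max_code_size TYPE('n) s T = N"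
  unfolding max_code_size_def
proof (rule Max_eqI)
  show "finite (card ` {C :: (real^'n) set. spherical_code C \<and> max_inner_product_le C s \<and> avoiding T C})"
    by (rule codes_finite_image[of _ N]) (use bound in blast)
qed (use bound C in auto)

theorem theorem5p3:
  shows "max_code_size TYPE(23) (2/5) {-1/2<..<-1/5} = 11178 \<and>
         max_code_size TYPE(23) (2/5) {-1/5<..<1/10} = 11178 \<and>
         (\<forall>(\<Lambda> :: (real^24) set) (W :: real^24) (\<phi> :: real^24 \<Rightarrow> real^23).
            leech_lattice \<Lambda> \<and> W \<in> \<Lambda> \<and> norm W = sqrt 6 \<and> hyperplane_isometry W \<phi> \<longrightarrow>
              maximal_avoiding_code (2/5) {-1/2<..<-1/5} (\<phi> ` leech_slice_code \<Lambda> W) \<and>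
              maximal_avoiding_code (2/5) {-1/5<..<1/10} (\<phi> ` leech_slice_code \<Lambda> W))"
proof -
  have slice: "s_code (2/5) C \<and> avoiding {-1/2<..<-1/5} C \<and> avoiding {-1/5<..<1/10} C \<and> card C = 11178"
    if "leech_lattice \<Lambda>" "W \<in> \<Lambda>" "norm W = sqrt 6" "hyperplane_isometry W \<phi>" "C = \<phi> ` leech_slice_code \<Lambda> W"
    for \<Lambda> W \<phi> and C :: "(real^23) set"
  proof -
    interpret leech \<Lambda> using that(1) by unfold_locales
    have C: "spherical_code C" "card C = 11178" "inner_products C \<subseteq> {-1/2, -1/5, 1/10, 2/5}"
      unfolding that(5) using slice_code_image[OF that(2-4)] by blast+
    have mem: "2/5 \<in> inner_products C" using two_fifths_attained[OF C] .
    have "Max (inner_products C) = 2/5"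
      using C(3) mem by (intro Max_eqI) (auto intro: finite_subset)
    then show ?thesis
      using C mem by (auto simp: s_code_def max_inner_product_def avoiding_def)
  qed
  \<comment> \<open>One concrete lattice settles both values of \<open>max_code_size\<close>; an
    arbitrary Leech lattice then yields maximal codes because its slice has the same size.\<close>
  obtain \<Lambda> :: "(real^24) set" and W where W: "leech_lattice \<Lambda>" "W \<in> \<Lambda>" "norm W = sqrt 6"
    by (rule leech_lattice_exists)
  then have "W \<noteq> 0" by auto
  then obtain \<phi> where "hyperplane_isometry W \<phi>" by (rule hyperplane_isometry_exists)
  from slice[OF W this refl] obtain C :: "(real^23) set" where
    C: "s_code (2/5) C" "avoiding {-1/2<..<-1/5} C" "avoiding {-1/5<..<1/10} C" "card C = 11178" by blast
  then have C': "spherical_code C" "max_inner_product_le C (2/5)"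
    by (auto simp: s_code_def max_inner_product_le_def)
  have "max_code_size TYPE(23) (2/5) {-1/2<..<-1/5} = 11178"
    by (rule max_code_size_eq[OF card_code_le_1 C' C(2,4)])
  moreover have "max_code_size TYPE(23) (2/5) {-1/5<..<1/10} = 11178"
    by (rule max_code_size_eq[OF card_code_le_2 C' C(3,4)])
  ultimately show ?thesis
    using slice by (auto simp: maximal_avoiding_code_def)
qed

end
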